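(* Let $\mathbb{K}$ be an algebraically closed field and let $n_1,n_2,n_3\in\mathbb{N}$. Let $c_1=2^{h(1/3)}$ and $c_2=2^{\tau+h(\tau)}$, where $h$ is the binary entropy function and $\tau\in(0,1/2)$ is the unique solution of $h(2\tau)-h(\tau)+\tau=0$. For every nonzero tensor $T\in\mathbb{K}^{n_1}\otimes\mathbb{K}^{n_2}\otimes\mathbb{K}^{n_3}$, exactly one of the following is true, where $\tilde{Q}(T)$ denotes the asymptotic subrank of $T$: (a) $\tilde{Q}(T)=1$; (b) $\tilde{Q}(T)=c_1$; (c) $\tilde{Q}(T)=2$; (d) $\tilde{Q}(T)\geq c_2$.
   Context: The binary entropy function is $h(p)=-p\log_2p-(1-p)\log_2(1-p)$ for $p\in[0,1]$ (with $0\log_2 0=0$). The subrank $Q(T)$ of $T\in\mathbb{K}^{n_1}\otimes\mathbb{K}^{n_2}\otimes\mathbb{K}^{n_3}$ is the largest number $r$ such that there are linear maps $A_i:\mathbb{K}^{n_i}\to\mathbb{K}^r$ ($i=1,2,3$) with $(A_1\otimes A_2\otimes A_3)T=\sum_{i=1}^re_i\otimes e_i\otimes e_i$. The asymptotic subrank of $T$ is $\tilde{Q}(T)=\lim_{n\to\infty}Q(T^{\boxtimes n})^{1/n}$, where $\boxtimes$ is the Kronecker product of tensors: for $T\in\mathbb{K}^{n_1}\otimes\mathbb{K}^{n_2}\otimes\mathbb{K}^{n_3}$ and $S\in\mathbb{K}^{m_1}\otimes\mathbb{K}^{m_2}\otimes\mathbb{K}^{m_3}$, $T\boxtimes S$ is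 the tensor product $T\otimes S$ viewed as an order-three tensor in $(\mathbb{K}^{n_1}\otimes\mathbb{K}^{m_1})\otimes(\mathbb{K}^{n_2}\otimes\mathbb{K}^{m_2})\otimes(\mathbb{K}^{n_3}\otimes\mathbb{K}^{m_3})$. The limit exists and equals the supremum by Fekete's Lemma, since $Q$ is super-multiplicative. *)

theory Defs
  imports Complex_Main "HOL-Computational_Algebra.Polynomial" "Jordan_Normal_Form.Matrix"
begin

text \<open>
  A tensor in \<open>K^n1 \<otimes> K^n2 \<otimes> K^n3\<close> is its array of coefficients in the standard basis
  (indices starting at 0), extended by zero outside the index range.  Hence equality and
  vanishing of tensors are ordinary equality and vanishing of functions.
\<close>

type_synonym 'a tensor3 = "nat \<Rightarrow> nat \<Rightarrow> nat \<Rightarrow> 'a"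

definition tensor_space :: "nat \<Rightarrow> nat \<Rightarrow> nat \<Rightarrow> 'a::zero tensor3 set" where
  "tensor_space n1 n2 n3 = {T. \<forall>i j k. \<not> (i < n1 \<and> j < n2 \<and> k < n3) \<longrightarrow> T i j k = 0}"

definition unit_tensor :: "nat \<Rightarrow> 'a::zero_neq_one tensor3" where
  "unit_tensor r = (\<lambda>i j k. if i < r \<and> i = j \<and> j = k then 1 else 0)"

text \<open>\<open>(A1 \<otimes> A2 \<otimes> A3) T\<close> for linear maps given by their matrices.\<close>

definition tensor_map :: "'a::comm_semiring_1 mat \<Rightarrow> 'a mat \<Rightarrow> 'a mat \<Rightarrow> 'a tensor3 \<Rightarrow> 'a tensor3" where
  "tensor_map A1 A2 A3 T = (\<lambda>a b c.
     if a < dim_row A1 \<and> b < dim_row A2 \<and> c < dim_row A3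
     then (\<Sum>i<dim_col A1. \<Sum>j<dim_col A2. \<Sum>k<dim_col A3.
             A1 $$ (a, i) * A2 $$ (b, j) * A3 $$ (c, k) * T i j k)
     else 0)"

definition subrank :: "nat \<Rightarrow> nat \<Rightarrow> nat \<Rightarrow> 'a::field tensor3 \<Rightarrow> nat" where
  "subrank n1 n2 n3 T = (GREATEST r.
     \<exists>A1 \<in> carrier_mat r n1. \<exists>A2 \<in> carrier_mat r n2. \<exists>A3 \<in> carrier_mat r n3.
       tensor_map A1 A2 A3 T = unit_tensor r)"

text \<open>
  Kronecker product of \<open>T\<close> with a tensor \<open>S\<close> of format \<open>m1 \<times> m2 \<times> m3\<close>.  The basis vector
  \<open>e_i \<otimes> e_i'\<close> of \<open>K^n \<otimes> K^m\<close> is identified with the basis vector of index \<open>i * m + i'\<close>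
  of \<open>K^(n * m)\<close>.
\<close>

definition tensor_kron ::
  "nat \<Rightarrow> nat \<Rightarrow> nat \<Rightarrow> 'a::comm_semiring_1 tensor3 \<Rightarrow> 'a tensor3 \<Rightarrow> 'a tensor3" where
  "tensor_kron m1 m2 m3 T S = (\<lambda>a b c.
     T (a div m1) (b div m2) (c div m3) * S (a mod m1) (b mod m2) (c mod m3))"

lemma div_less_and_mod_less_iff: "a div m < n \<and> a mod m < m \<longleftrightarrow> a < n * m" for a m n :: nat
  by (cases "m = 0") (auto simp: less_mult_imp_div_less div_less_iff_less_mult)

lemma tensor_kron_in_tensor_space:
  assumes "T \<in> tensor_space n1 n2 n3" "S \<in> tensor_space m1 m2 m3"
  shows "tensor_kron m1 m2 m3 T S \<in> tensor_space (n1 * m1) (n2 * m2) (n3 * m3)"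
  using assms unfolding tensor_space_def tensor_kron_def
  by (clarsimp simp flip: div_less_and_mod_less_iff) (metis mult_zero_left mult_zero_right)

primrec tensor_kron_power ::
  "nat \<Rightarrow> nat \<Rightarrow> nat \<Rightarrow> 'a::comm_semiring_1 tensor3 \<Rightarrow> nat \<Rightarrow> 'a tensor3" where
  "tensor_kron_power n1 n2 n3 T 0 = unit_tensor 1"
| "tensor_kron_power n1 n2 n3 T (Suc n) = tensor_kron n1 n2 n3 (tensor_kron_power n1 n2 n3 T n) T"

lemma tensor_kron_power_in_tensor_space:
  assumes "T \<in> tensor_space n1 n2 n3"
  shows "tensor_kron_power n1 n2 n3 T n \<in> tensor_space (n1 ^ n) (n2 ^ n) (n3 ^ n)"
proof (induction n)
  case 0
  show ?case by (simp add: tensor_space_def unit_tensor_def)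
next
  case (Suc n)
  show ?case
    using tensor_kron_in_tensor_space[OF Suc assms] by (simp add: mult.commute)
qed

definition asymptotic_subrank :: "nat \<Rightarrow> nat \<Rightarrow> nat \<Rightarrow> 'a::field tensor3 \<Rightarrow> real" where
  "asymptotic_subrank n1 n2 n3 T =
     lim (\<lambda>n. root n (real (subrank (n1 ^ n) (n2 ^ n) (n3 ^ n) (tensor_kron_power n1 n2 n3 T n))))"

text \<open>The convention \<open>0 log 0 = 0\<close> holds automatically.\<close>

definition binary_entropy :: "real \<Rightarrow> real" where
  "binary_entropy p = - p * log 2 p - (1 - p) * log 2 (1 - p)"

end

theory Submission
  imports Defs "HOL-Combinatorics.Multiset_Permutations" "HOL-Real_Asymp.Real_Asymp"
begin

text \<open>
  The asymptotic subrank is invariant under passing to an equivalent concise tensor and bounded by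
  each dimension.  If a concise tensor has a factor of dimension 1, the value is 1.  If the smallest
  dimension is 2, a short analysis of matrix pencils shows that a diagonal of size two appears
  after a degeneration, unless the tensor is the W-tensor, for which Strassen's construction
  and Tao's slice rank bound both give \<open>2^h(1/3)\<close>.

  If all dimensions are at least 3, the tensor restricts to a concise tensor \<open>T\<close> of format
  \<open>3 \<times> 3 \<times> 3\<close>.  If \<open>T\<close> contracts to invertible matrices in the second and in the third factor, it
  degenerates to the structure tensor of the null algebra
  \<open>x0 y0 z0 + x1 (y1 z0 + y0 z1) + x2 (y2 z0 + y0 z2)\<close>, whose value is \<open>c2\<close>: the type with
  marginals \<open>(1 - 2\<tau>, \<tau>, \<tau>)\<close> and \<open>(1 - \<tau>, \<tau>/2, \<tau>/2)\<close> balances the entropies exactly when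
  \<open>h(2\<tau>) - h(\<tau>) + \<tau> = 0\<close>.  Otherwise one of these two spaces of \<open>3 \<times> 3\<close> matrices is
  singular, and either it degenerates to the determinant tensor (value 3) or all its matrices are
  supported on one row and one column, which leads to the null algebra again or to a
  pattern of value \<open>2^(3/2)\<close>.

  All lower bounds use combinatorial degenerations: a nonnegative integer weight that splits over
  the three factors and vanishes on a matching costs nothing asymptotically, which also
  replaces the progression-free sets in Strassen's theorem on tight tensors.
\<close>

section \<open>Restriction of tensors\<close>

text \<open>Only lower bounds are needed above 2. Alternative (d) is an inequality, so for the other
  two patterns it suffices that \<open>\<tau> + h(\<tau>) \<le> 3/2\<close> and
  \<open>log 2 3 \<ge> 3/2\<close>. Upper bounds come from the dimensions and, for the W-tensor
  alone, from counting slices. No degeneration is ever formed. A weight that splits over the three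
  indices has a fixed total on words with prescribed types or prescribed sums; if that total is zero
  and no support entry has negative weight, every position lies in the zero face. Degenerations thus
  become conditions on the support, entries of positive weight may be arbitrary, and a change of
  basis only has to clear part of a tensor. The obstacle in reaching format 3 is to shrink one
  factor without losing rank in the other two; a generic choice of slices serves both at once
  because the field is infinite. Algebraic closedness enters through this infinitude and through the
  singular member of a pencil of 2 x 2 matrices.\<close>

definition tri :: "nat \<Rightarrow> nat \<Rightarrow> nat \<Rightarrow> 'a::field tensor3 \<Rightarrow> (nat \<Rightarrow> 'a) \<Rightarrow> (nat \<Rightarrow> 'a) \<Rightarrow> (nat \<Rightarrow> 'a) \<Rightarrow> 'a"
  where "tri n1 n2 n3 T x y z = (\<Sum>i<n1. \<Sum>j<n2. \<Sum>k<n3. x i * y j * z k * T i j k)"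

text \<open>The vectors \<open>X a\<close>, \<open>Y b\<close>, \<open>Z c\<close> are the rows of
  three matrices. Entries are compared only inside the target format, so a tensor may be given by a
  formula on all indices.\<close>

definition restricts ::
  "nat \<Rightarrow> nat \<Rightarrow> nat \<Rightarrow> 'a::field tensor3 \<Rightarrow> nat \<Rightarrow> nat \<Rightarrow> nat \<Rightarrow> 'a tensor3 \<Rightarrow> bool" where
  "restricts n1 n2 n3 T m1 m2 m3 S \<longleftrightarrow>
     (\<exists>X Y Z. \<forall>a<m1. \<forall>b<m2. \<forall>c<m3. S a b c = tri n1 n2 n3 T (X a) (Y b) (Z c))"

abbreviation (input) swap12 :: "'a tensor3 \<Rightarrow> 'a tensor3" where "swap12 T \<equiv> (\<lambda>i j k. T j i k)"
abbreviation (input) swap23 :: "'a tensor3 \<Rightarrow> 'a tensor3" where "swap23 T \<equiv> (\<lambda>i j k. T i k j)"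

lemma tri_swap12: "tri n2 n1 n3 (swap12 T) y x z = tri n1 n2 n3 T x y z"
proof -
  have "(\<Sum>i<n2. \<Sum>j<n1. \<Sum>k<n3. y i * x j * z k * T j i k) = (\<Sum>j<n1. \<Sum>i<n2. \<Sum>k<n3. y i * x j * z k * T j i k)"
    by (rule sum.swap)
  then show ?thesis unfolding tri_def by (simp only: mult.commute[of "y _" "x _"])
qed

lemma tri_swap23: "tri n1 n3 n2 (swap23 T) x z y = tri n1 n2 n3 T x y z"
proof -
  have "(\<Sum>j<n3. \<Sum>k<n2. x i * z j * y k * T i k j) = (\<Sum>k<n2. \<Sum>j<n3. x i * z j * y k * T i k j)" for i
    by (rule sum.swap)
  then show ?thesis unfolding tri_def by (simp only: mult.assoc mult.left_commute[of "z _" "y _"])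
qed

text \<open>Linearity is phrased for sums of scaled vectors because substituting a basis expansion
  then becomes a rewrite; a single scalar is handled as a sum with one term.\<close>

lemma tri_sum1:
  "tri n1 n2 n3 T (\<lambda>i. \<Sum>a\<in>A. c a * X a i) y z = (\<Sum>a\<in>A. c a * tri n1 n2 n3 T (X a) y z)"
proof -
  have "tri n1 n2 n3 T (\<lambda>i. \<Sum>a\<in>A. c a * X a i) y z
      = (\<Sum>i<n1. \<Sum>j<n2. \<Sum>k<n3. \<Sum>a\<in>A. c a * (X a i * y j * z k * T i j k))"
    unfolding tri_def by (simp add: sum_distrib_right mult.assoc)
  also have "\<dots> = (\<Sum>i<n1. \<Sum>j<n2. \<Sum>a\<in>A. \<Sum>k<n3. c a * (X a i * y j * z k * T i j k))"
    by (intro sum.cong refl sum.swap)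
  also have "\<dots> = (\<Sum>i<n1. \<Sum>a\<in>A. \<Sum>j<n2. \<Sum>k<n3. c a * (X a i * y j * z k * T i j k))"
    by (intro sum.cong refl sum.swap)
  also have "\<dots> = (\<Sum>a\<in>A. \<Sum>i<n1. \<Sum>j<n2. \<Sum>k<n3. c a * (X a i * y j * z k * T i j k))"
    by (rule sum.swap)
  also have "\<dots> = (\<Sum>a\<in>A. c a * tri n1 n2 n3 T (X a) y z)"
    unfolding tri_def by (simp add: sum_distrib_left)
  finally show ?thesis .
qed

lemma tri_sum2:
  "tri n1 n2 n3 T x (\<lambda>i. \<Sum>a\<in>A. c a * Y a i) z = (\<Sum>a\<in>A. c a * tri n1 n2 n3 T x (Y a) z)"
  using tri_sum1[of n2 n1 n3 "swap12 T" c Y A x z] by (simp only: tri_swap12[where T=T])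

lemma tri_sum3:
  "tri n1 n2 n3 T x y (\<lambda>i. \<Sum>a\<in>A. c a * Z a i) = (\<Sum>a\<in>A. c a * tri n1 n2 n3 T x y (Z a))"
  using tri_sum2[of n1 n3 n2 "swap23 T" x c Z A y] by (simp only: tri_swap23[where T=T])

lemma tri_compose:
  assumes "\<And>a b c. a < m1 \<Longrightarrow> b < m2 \<Longrightarrow> c < m3 \<Longrightarrow> S a b c = tri n1 n2 n3 T (X a) (Y b) (Z c)"
  shows "tri m1 m2 m3 S x y z
    = tri n1 n2 n3 T (\<lambda>i. \<Sum>a<m1. x a * X a i) (\<lambda>i. \<Sum>a<m2. y a * Y a i) (\<lambda>i. \<Sum>a<m3. z a * Z a i)"
  unfolding tri_sum1 unfolding tri_sum2 unfolding tri_sum3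
  unfolding tri_def[of m1] sum_distrib_left using assms
  by (intro sum.cong refl) (simp add: mult.assoc)

lemma tri_unit_vectors:
  assumes "a < n1" "b < n2" "c < n3"
  shows "tri n1 n2 n3 T (\<lambda>i. of_bool (i = a)) (\<lambda>j. of_bool (j = b)) (\<lambda>k. of_bool (k = c)) = T a b c"
proof -
  have k: "(\<Sum>k<n3. (of_bool (i = a) * of_bool (j = b) * of_bool (k = c) * T i j k :: 'a))
     = of_bool (i = a) * of_bool (j = b) * T i j c" for i j
  proof -
    have "(\<Sum>k<n3. (of_bool (i = a) * of_bool (j = b) * of_bool (k = c) * T i j k :: 'a))
       = (\<Sum>k<n3. if k = c then of_bool (i = a) * of_bool (j = b) * T i j k else 0)"
      by (intro sum.cong) auto
    then show ?thesis using assms by simp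
  qed
  have j: "(\<Sum>j<n2. (of_bool (i = a) * of_bool (j = b) * T i j c :: 'a)) = of_bool (i = a) * T i b c" for i
  proof -
    have "(\<Sum>j<n2. (of_bool (i = a) * of_bool (j = b) * T i j c :: 'a))
       = (\<Sum>j<n2. if j = b then of_bool (i = a) * T i j c else 0)"
      by (intro sum.cong) auto
    then show ?thesis using assms by simp
  qed
  have i: "(\<Sum>i<n1. (of_bool (i = a) * T i b c :: 'a)) = T a b c"
  proof -
    have "(\<Sum>i<n1. (of_bool (i = a) * T i b c :: 'a)) = (\<Sum>i<n1. if i = a then T i b c else 0)"
      by (intro sum.cong) auto
    then show ?thesis using assms by simp
  qed
  show ?thesis unfolding tri_def k j i ..
qed

lemma restrictsI:
  "(\<And>a b c. a < m1 \<Longrightarrow> b < m2 \<Longrightarrow> c < m3 \<Longrightarrow> S a b c = tri n1 n2 n3 T (X a) (Y b) (Z c))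
   \<Longrightarrow> restricts n1 n2 n3 T m1 m2 m3 S"
  unfolding restricts_def by blast

lemma restricts_trans:
  assumes "restricts n1 n2 n3 T m1 m2 m3 S" "restricts m1 m2 m3 S l1 l2 l3 R"
  shows "restricts n1 n2 n3 T l1 l2 l3 R"
proof -
  obtain X Y Z where 1: "\<And>a b c. a < m1 \<Longrightarrow> b < m2 \<Longrightarrow> c < m3 \<Longrightarrow> S a b c = tri n1 n2 n3 T (X a) (Y b) (Z c)"
    using assms(1) unfolding restricts_def by blast
  obtain X' Y' Z' where 2: "\<And>a b c. a < l1 \<Longrightarrow> b < l2 \<Longrightarrow> c < l3 \<Longrightarrow> R a b c = tri m1 m2 m3 S (X' a) (Y' b) (Z' c)"
    using assms(2) unfolding restricts_def by blast
  show ?thesis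
    by (rule restrictsI[of _ _ _ _ _ _ _ _ "\<lambda>a i. \<Sum>a'<m1. X' a a' * X a' i"
        "\<lambda>a i. \<Sum>a'<m2. Y' a a' * Y a' i" "\<lambda>a i. \<Sum>a'<m3. Z' a a' * Z a' i"])
      (simp only: 2 tri_compose[OF 1])
qed

lemma restricts_select:
  assumes "\<And>a. a < m1 \<Longrightarrow> f a < n1" "\<And>b. b < m2 \<Longrightarrow> g b < n2" "\<And>c. c < m3 \<Longrightarrow> h c < n3"
    and "\<And>a b c. a < m1 \<Longrightarrow> b < m2 \<Longrightarrow> c < m3 \<Longrightarrow> S a b c = T (f a) (g b) (h c)"
  shows "restricts n1 n2 n3 T m1 m2 m3 S"
  by (rule restrictsI[of _ _ _ _ _ _ _ _ "\<lambda>a i. of_bool (i = f a)" "\<lambda>b j. of_bool (j = g b)" "\<lambda>c k. of_bool (k = h c)"])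
    (simp add: assms tri_unit_vectors)

lemma restricts_refl: "restricts n1 n2 n3 T n1 n2 n3 T"
  by (rule restricts_select[of _ id _ _ id _ _ id]) auto

lemma restricts_swap12:
  "restricts n2 n1 n3 (swap12 T) m2 m1 m3 (swap12 S) \<longleftrightarrow> restricts n1 n2 n3 T m1 m2 m3 S"
proof
  assume "restricts n2 n1 n3 (swap12 T) m2 m1 m3 (swap12 S)"
  then obtain Y X Z where "\<forall>a<m2. \<forall>b<m1. \<forall>c<m3. S b a c = tri n2 n1 n3 (swap12 T) (Y a) (X b) (Z c)"
    unfolding restricts_def by blast
  then show "restricts n1 n2 n3 T m1 m2 m3 S"
    by (intro restrictsI[of _ _ _ _ _ _ _ _ X Y Z]) (simp add: tri_swap12[where T=T])
next
  assume "restricts n1 n2 n3 T m1 m2 m3 S"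
  then obtain X Y Z where "\<forall>a<m1. \<forall>b<m2. \<forall>c<m3. S a b c = tri n1 n2 n3 T (X a) (Y b) (Z c)"
    unfolding restricts_def by blast
  then show "restricts n2 n1 n3 (swap12 T) m2 m1 m3 (swap12 S)"
    by (intro restrictsI[of _ _ _ _ _ _ _ _ Y X Z]) (simp add: tri_swap12[where T=T])
qed

lemma restricts_swap23:
  "restricts n1 n3 n2 (swap23 T) m1 m3 m2 (swap23 S) \<longleftrightarrow> restricts n1 n2 n3 T m1 m2 m3 S"
proof
  assume "restricts n1 n3 n2 (swap23 T) m1 m3 m2 (swap23 S)"
  then obtain X Z Y where "\<forall>a<m1. \<forall>b<m3. \<forall>c<m2. S a c b = tri n1 n3 n2 (swap23 T) (X a) (Z b) (Y c)"
    unfolding restricts_def by blast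
  then show "restricts n1 n2 n3 T m1 m2 m3 S"
    by (intro restrictsI[of _ _ _ _ _ _ _ _ X Y Z]) (simp add: tri_swap23[where T=T])
next
  assume "restricts n1 n2 n3 T m1 m2 m3 S"
  then obtain X Y Z where "\<forall>a<m1. \<forall>b<m2. \<forall>c<m3. S a b c = tri n1 n2 n3 T (X a) (Y b) (Z c)"
    unfolding restricts_def by blast
  then show "restricts n1 n3 n2 (swap23 T) m1 m3 m2 (swap23 S)"
    by (intro restrictsI[of _ _ _ _ _ _ _ _ X Z Y]) (simp add: tri_swap23[where T=T])
qed

section \<open>Kronecker products and powers\<close>

text \<open>Quotient and remainder by \<open>m\<close> run over a product of index ranges; used once
  per factor, this makes trilinear forms multiplicative under the Kronecker product.\<close>

lemma sum_div_mod:
  fixes f g :: "nat \<Rightarrow> 'a::comm_semiring_0"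
  shows "(\<Sum>a<n * m. f (a div m) * g (a mod m)) = (\<Sum>i<n. f i) * (\<Sum>j<m. g j)"
proof -
  have "(\<Sum>i<n. f i) * (\<Sum>j<m. g j) = (\<Sum>(i, j)\<in>{..<n} \<times> {..<m}. f i * g j)"
    by (simp add: sum_product sum.cartesian_product)
  also have "\<dots> = (\<Sum>a<n * m. f (a div m) * g (a mod m))"
  proof (rule sum.reindex_bij_witness[of _ "\<lambda>a. (a div m, a mod m)" "\<lambda>(i, j). i * m + j"], goal_cases)
    case (2 p) then show ?case by (auto simp flip: div_less_and_mod_less_iff)
  next
    case (4 a) then show ?case using div_less_and_mod_less_iff by auto
  qed auto
  finally show ?thesis ..
qed

lemma tri_kron:
  "tri (n1 * m1) (n2 * m2) (n3 * m3) (tensor_kron m1 m2 m3 T S)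
     (\<lambda>a. x (a div m1) * x' (a mod m1)) (\<lambda>b. y (b div m2) * y' (b mod m2)) (\<lambda>c. z (c div m3) * z' (c mod m3))
   = tri n1 n2 n3 T x y z * tri m1 m2 m3 S x' y' z'"
proof -
  have "tri (n1 * m1) (n2 * m2) (n3 * m3) (tensor_kron m1 m2 m3 T S)
     (\<lambda>a. x (a div m1) * x' (a mod m1)) (\<lambda>b. y (b div m2) * y' (b mod m2)) (\<lambda>c. z (c div m3) * z' (c mod m3))
    = (\<Sum>a<n1 * m1. \<Sum>b<n2 * m2. \<Sum>c<n3 * m3.
        (x (a div m1) * y (b div m2) * z (c div m3) * T (a div m1) (b div m2) (c div m3)) *
        (x' (a mod m1) * y' (b mod m2) * z' (c mod m3) * S (a mod m1) (b mod m2) (c mod m3)))"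
    unfolding tri_def tensor_kron_def by (intro sum.cong refl) (simp add: ac_simps)
  also have "\<dots> = (\<Sum>a<n1 * m1. \<Sum>b<n2 * m2.
        (\<Sum>k<n3. x (a div m1) * y (b div m2) * z k * T (a div m1) (b div m2) k) *
        (\<Sum>k<m3. x' (a mod m1) * y' (b mod m2) * z' k * S (a mod m1) (b mod m2) k))"
    by (intro sum.cong refl)
      (rule sum_div_mod[where f = "\<lambda>k. x _ * y _ * z k * T _ _ k" and g = "\<lambda>k. x' _ * y' _ * z' k * S _ _ k"])
  also have "\<dots> = (\<Sum>a<n1 * m1.
        (\<Sum>j<n2. \<Sum>k<n3. x (a div m1) * y j * z k * T (a div m1) j k) *
        (\<Sum>j<m2. \<Sum>k<m3. x' (a mod m1) * y' j * z' k * S (a mod m1) j k))"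
    by (intro sum.cong refl)
      (rule sum_div_mod[where f = "\<lambda>j. \<Sum>k<n3. x _ * y j * z k * T _ j k" and g = "\<lambda>j. \<Sum>k<m3. x' _ * y' j * z' k * S _ j k"])
  also have "\<dots> = tri n1 n2 n3 T x y z * tri m1 m2 m3 S x' y' z'"
    unfolding tri_def
    by (rule sum_div_mod[where f = "\<lambda>i. \<Sum>j<n2. \<Sum>k<n3. x i * y j * z k * T i j k" and g = "\<lambda>i. \<Sum>j<m2. \<Sum>k<m3. x' i * y' j * z' k * S i j k"])
  finally show ?thesis .
qed

lemma restricts_kron:
  assumes "restricts n1 n2 n3 T m1 m2 m3 S" "restricts n1' n2' n3' T' m1' m2' m3' S'"
  shows "restricts (n1 * n1') (n2 * n2') (n3 * n3') (tensor_kron n1' n2' n3' T T')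
    (m1 * m1') (m2 * m2') (m3 * m3') (tensor_kron m1' m2' m3' S S')"
proof -
  obtain X Y Z where 1: "\<And>a b c. a < m1 \<Longrightarrow> b < m2 \<Longrightarrow> c < m3 \<Longrightarrow> S a b c = tri n1 n2 n3 T (X a) (Y b) (Z c)"
    using assms(1) unfolding restricts_def by blast
  obtain X' Y' Z' where 2: "\<And>a b c. a < m1' \<Longrightarrow> b < m2' \<Longrightarrow> c < m3' \<Longrightarrow> S' a b c = tri n1' n2' n3' T' (X' a) (Y' b) (Z' c)"
    using assms(2) unfolding restricts_def by blast
  show ?thesis
  proof (rule restrictsI[of _ _ _ _ _ _ _ _ "\<lambda>a i. X (a div m1') (i div n1') * X' (a mod m1') (i mod n1')"
      "\<lambda>a i. Y (a div m2') (i div n2') * Y' (a mod m2') (i mod n2')"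
      "\<lambda>a i. Z (a div m3') (i div n3') * Z' (a mod m3') (i mod n3')"])
    fix a b c assume "a < m1 * m1'" "b < m2 * m2'" "c < m3 * m3'"
    then have "a div m1' < m1 \<and> a mod m1' < m1'" "b div m2' < m2 \<and> b mod m2' < m2'" "c div m3' < m3 \<and> c mod m3' < m3'"
      by (simp_all add: div_less_and_mod_less_iff)
    then show "tensor_kron m1' m2' m3' S S' a b c =
       tri (n1 * n1') (n2 * n2') (n3 * n3') (tensor_kron n1' n2' n3' T T')
        (\<lambda>i. X (a div m1') (i div n1') * X' (a mod m1') (i mod n1'))
        (\<lambda>i. Y (b div m2') (i div n2') * Y' (b mod m2') (i mod n2'))
        (\<lambda>i. Z (c div m3') (i div n3') * Z' (c mod m3') (i mod n3'))"
      unfolding tri_kron by (simp add: tensor_kron_def 1 2)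
  qed
qed

lemma restricts_power:
  assumes "restricts n1 n2 n3 T m1 m2 m3 S"
  shows "restricts (n1 ^ n) (n2 ^ n) (n3 ^ n) (tensor_kron_power n1 n2 n3 T n)
     (m1 ^ n) (m2 ^ n) (m3 ^ n) (tensor_kron_power m1 m2 m3 S n)"
proof (induction n)
  case 0
  show ?case using restricts_refl by simp
next
  case (Suc n)
  show ?case using restricts_kron[OF Suc assms] by (simp add: mult.commute)
qed

text \<open>The last factor of a power occupies the lowest digit of an index, so the last
  \<open>n\<close> factors read the remainder and the first \<open>m\<close> factors the quotient.
  Super-multiplicativity of the subrank rests on this splitting.\<close>

lemma tensor_kron_power_add:
  "tensor_kron_power n1 n2 n3 T (m + n)
   = tensor_kron (n1 ^ n) (n2 ^ n) (n3 ^ n) (tensor_kron_power n1 n2 n3 T m) (tensor_kron_power n1 n2 n3 T n)"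
proof (induction n)
  case 0
  show ?case by (simp add: tensor_kron_def unit_tensor_def)
next
  case (Suc n)
  have d: "a div p div p ^ n = a div p ^ Suc n" "a div p mod p ^ n = a mod p ^ Suc n div p"
    "a mod p ^ Suc n mod p = a mod p" for a p :: nat
  proof -
    show "a div p div p ^ n = a div p ^ Suc n" by (simp add: div_mult2_eq)
    show "a mod p ^ Suc n mod p = a mod p" by (simp add: mod_mod_cancel)
    show "a div p mod p ^ n = a mod p ^ Suc n div p"
      by (cases "p = 0") (simp_all add: mod_mult2_eq)
  qed
  show ?case
    unfolding add_Suc_right tensor_kron_power.simps(2) Suc
    by (simp only: tensor_kron_def d mult.assoc)
qed

lemma tensor_kron_power_mult:
  "tensor_kron_power n1 n2 n3 T (N * k)
   = tensor_kron_power (n1 ^ N) (n2 ^ N) (n3 ^ N) (tensor_kron_power n1 n2 n3 T N) k"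
proof (induction k)
  case 0
  show ?case by simp
next
  case (Suc k)
  have "tensor_kron_power n1 n2 n3 T (N * Suc k) = tensor_kron_power n1 n2 n3 T (N * k + N)"
    by (simp add: add.commute)
  then show ?case by (simp only: tensor_kron_power_add Suc tensor_kron_power.simps)
qed

lemma tensor_kron_power_swap12:
  "tensor_kron_power n2 n1 n3 (swap12 T) n = swap12 (tensor_kron_power n1 n2 n3 T n)"
  by (induction n) (auto simp: tensor_kron_def unit_tensor_def fun_eq_iff)

lemma tensor_kron_power_swap23:
  "tensor_kron_power n1 n3 n2 (swap23 T) n = swap23 (tensor_kron_power n1 n2 n3 T n)"
  by (induction n) (auto simp: tensor_kron_def unit_tensor_def fun_eq_iff)

section \<open>Homogeneous linear systems\<close>

text \<open>One unknown is eliminated per equation. Later dimension counts reduce to this: kernels,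
  dependencies and expansions in a basis are each phrased as fewer equations than unknowns. The
  solution is zero outside \<open>S\<close>, so it can be added to a vector of disjoint
  support.\<close>

lemma homogeneous_system:
  fixes a :: "'e \<Rightarrow> 's \<Rightarrow> 'a::field"
  assumes "finite E" "finite S" "card E < card S"
  shows "\<exists>v. (\<exists>s\<in>S. v s \<noteq> 0) \<and> (\<forall>s. s \<notin> S \<longrightarrow> v s = 0) \<and> (\<forall>e\<in>E. (\<Sum>s\<in>S. v s * a e s) = 0)"
  using assms
proof (induction E arbitrary: S a rule: finite_induct)
  case empty
  then obtain s where "s \<in> S" by fastforce
  then show ?case by (intro exI[of _ "\<lambda>t. of_bool (t = s)"]) auto
next
  case (insert e E)
  show ?case
  proof (cases "\<forall>s\<in>S. a e s = 0")
    case True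
    have "card E < card S" using insert.hyps insert.prems by simp
    from insert.IH[OF insert.prems(1) this, of a]
    obtain v where v: "\<exists>s\<in>S. v s \<noteq> 0" "\<forall>s. s \<notin> S \<longrightarrow> v s = 0" "\<forall>e\<in>E. (\<Sum>s\<in>S. v s * a e s) = 0"
      by blast
    have "(\<Sum>s\<in>S. v s * a e s) = 0" using True by simp
    then show ?thesis using v by (intro exI[of _ v]) simp
  next
    case False
    then obtain s0 where s0: "s0 \<in> S" "a e s0 \<noteq> 0" by blast
    define S' where "S' = S - {s0}"
    have S': "finite S'" "card E < card S'" "s0 \<notin> S'" "S = insert s0 S'"
      using insert.hyps insert.prems s0 unfolding S'_def by auto
    \<comment> \<open>Equation \<open>e\<close> is solved for the unknown \<open>s0\<close> and
      substituted into all other equations; \<open>v'\<close> is the back substitution.\<close>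
    from insert.IH[OF S'(1,2), of "\<lambda>f s. a f s - a f s0 * a e s / a e s0"]
    obtain v where v: "\<exists>s\<in>S'. v s \<noteq> 0" "\<And>s. s \<notin> S' \<Longrightarrow> v s = 0"
      "\<And>f. f \<in> E \<Longrightarrow> (\<Sum>s\<in>S'. v s * (a f s - a f s0 * a e s / a e s0)) = 0" by blast
    define v' where "v' = (\<lambda>s. if s = s0 then - (\<Sum>s\<in>S'. v s * a e s) / a e s0 else v s)"
    have sum: "(\<Sum>s\<in>S. v' s * a f s) = (\<Sum>s\<in>S'. v s * a f s) - (\<Sum>s\<in>S'. v s * a e s) / a e s0 * a f s0" for f
    proof -
      have "(\<Sum>s\<in>S'. v' s * a f s) = (\<Sum>s\<in>S'. v s * a f s)"
        using S'(3) by (intro sum.cong) (auto simp: v'_def)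
      then show ?thesis using S' by (simp add: v'_def)
    qed
    have "(\<Sum>s\<in>S. v' s * a f s) = 0" if "f \<in> E" for f
    proof -
      have "(\<Sum>s\<in>S'. v s * (a f s - a f s0 * a e s / a e s0))
          = (\<Sum>s\<in>S'. v s * a f s) - (\<Sum>s\<in>S'. (v s * a e s) * (a f s0 / a e s0))"
        unfolding sum_subtractf[symmetric] by (intro sum.cong refl) (simp add: algebra_simps)
      also have "\<dots> = (\<Sum>s\<in>S. v' s * a f s)"
        unfolding sum by (simp add: sum_distrib_right[symmetric] sum_divide_distrib[symmetric])
      finally show ?thesis using v(3)[OF that] by simp
    qed
    moreover have "(\<Sum>s\<in>S. v' s * a e s) = 0" unfolding sum using s0 by simp
    moreover have "\<exists>s\<in>S. v' s \<noteq> 0" using v(1) S' by (auto simp: v'_def)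
    moreover have "\<forall>s. s \<notin> S \<longrightarrow> v' s = 0" using v(2) S' by (auto simp: v'_def)
    ultimately show ?thesis by (intro exI[of _ v']) auto
  qed
qed

section \<open>Subrank\<close>

abbreviation has_subrank :: "nat \<Rightarrow> nat \<Rightarrow> nat \<Rightarrow> 'a::field tensor3 \<Rightarrow> nat \<Rightarrow> bool" where
  "has_subrank n1 n2 n3 T r \<equiv> restricts n1 n2 n3 T r r r (unit_tensor r)"

lemma subrank_altdef: "subrank n1 n2 n3 T = (GREATEST r. has_subrank n1 n2 n3 T r)"
proof -
  have "(\<exists>A1\<in>carrier_mat r n1. \<exists>A2\<in>carrier_mat r n2. \<exists>A3\<in>carrier_mat r n3.
          tensor_map A1 A2 A3 T = unit_tensor r) \<longleftrightarrow> has_subrank n1 n2 n3 T r" (is "?L \<longleftrightarrow> ?R") for r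
  proof
    assume ?L
    then obtain A1 A2 A3 where A: "A1 \<in> carrier_mat r n1" "A2 \<in> carrier_mat r n2" "A3 \<in> carrier_mat r n3"
      and eq: "tensor_map A1 A2 A3 T = unit_tensor r" by blast
    show ?R
    proof (rule restrictsI[of _ _ _ _ _ _ _ _ "\<lambda>a i. A1 $$ (a, i)" "\<lambda>a i. A2 $$ (a, i)" "\<lambda>a i. A3 $$ (a, i)"])
      fix a b c assume "a < r" "b < r" "c < r"
      then have "tensor_map A1 A2 A3 T a b c
          = tri n1 n2 n3 T (\<lambda>i. A1 $$ (a, i)) (\<lambda>i. A2 $$ (b, i)) (\<lambda>i. A3 $$ (c, i))"
        using A by (simp add: tensor_map_def tri_def)
      then show "unit_tensor r a b c
          = tri n1 n2 n3 T (\<lambda>i. A1 $$ (a, i)) (\<lambda>i. A2 $$ (b, i)) (\<lambda>i. A3 $$ (c, i))"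
        unfolding eq .
    qed
  next
    assume ?R
    then obtain X Y Z where
      *: "\<And>a b c. a < r \<Longrightarrow> b < r \<Longrightarrow> c < r \<Longrightarrow> unit_tensor r a b c = tri n1 n2 n3 T (X a) (Y b) (Z c)"
      unfolding restricts_def by blast
    have "tensor_map (mat r n1 (\<lambda>(a, i). X a i)) (mat r n2 (\<lambda>(a, i). Y a i)) (mat r n3 (\<lambda>(a, i). Z a i)) T
        = unit_tensor r"
    proof (intro ext)
      fix a b c
      show "tensor_map (mat r n1 (\<lambda>(a, i). X a i)) (mat r n2 (\<lambda>(a, i). Y a i)) (mat r n3 (\<lambda>(a, i). Z a i)) T a b c
        = unit_tensor r a b c"
        by (cases "a < r \<and> b < r \<and> c < r") (auto simp: tensor_map_def * tri_def, auto simp: unit_tensor_def)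
    qed
    then show ?L by (intro bexI) auto
  qed
  then show ?thesis unfolding subrank_def by simp
qed

text \<open>A solution of maximal support vanishes on at most \<open>card I\<close> coordinates: on
  a larger zero set there would be more unknowns than equations, and a nonzero solution supported
  there could be added without cancelling anything.\<close>

lemma maximal_support_solution:
  fixes X :: "nat \<Rightarrow> 'i \<Rightarrow> 'a::field"
  assumes "finite I"
  shows "\<exists>v. (\<forall>i\<in>I. (\<Sum>a<r. v a * X a i) = 0) \<and> r \<le> card {a\<in>{..<r}. v a \<noteq> 0} + card I"
proof -
  define P where "P v \<longleftrightarrow> (\<forall>i\<in>I. (\<Sum>a<r. v a * X a i) = 0)" for v
  define s where "s v = card {a\<in>{..<r}. v a \<noteq> 0}" for v :: "nat \<Rightarrow> 'a"
  have "P (\<lambda>_. 0)" by (simp add: P_def)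
  moreover have "\<forall>v. P v \<longrightarrow> s v \<le> r"
    unfolding s_def by (metis (no_types, lifting) card_lessThan card_mono finite_lessThan mem_Collect_eq subsetI)
  ultimately obtain v where v: "P v" and max: "\<And>u. P u \<Longrightarrow> s u \<le> s v"
    using ex_has_greatest_nat[of P _ s "Suc r"] by (metis less_Suc_eq_le)
  have "r \<le> s v + card I"
  proof (rule ccontr)
    assume "\<not> r \<le> s v + card I"
    define N where "N = {a\<in>{..<r}. v a = 0}"
    have "r = card (N \<union> {a\<in>{..<r}. v a \<noteq> 0})"
      unfolding N_def by (subst card_lessThan[symmetric], rule arg_cong[of _ _ card]) auto
    also have "\<dots> = card N + s v" unfolding s_def N_def by (rule card_Un_disjoint) auto
    finally have "r = card N + s v" .
    then have "card I < card N" using \<open>\<not> r \<le> s v + card I\<close> by simp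
    from homogeneous_system[OF assms _ this, of "\<lambda>i a. X a i"]
    obtain u where u: "\<exists>a\<in>N. u a \<noteq> 0" "\<And>a. a \<notin> N \<Longrightarrow> u a = 0" "\<And>i. i \<in> I \<Longrightarrow> (\<Sum>a\<in>N. u a * X a i) = 0"
      by (auto simp: N_def)
    have "(\<Sum>a<r. u a * X a i) = (\<Sum>a\<in>N. u a * X a i)" for i
      using u(2) by (intro sum.mono_neutral_right) (auto simp: N_def)
    then have "P (\<lambda>a. v a + u a)"
      using v u(3) by (simp add: P_def distrib_right sum.distrib)
    moreover have "s v < s (\<lambda>a. v a + u a)"
      unfolding s_def
    proof (rule psubset_card_mono)
      obtain a where "a \<in> N" "u a \<noteq> 0" using u(1) by blast
      then have "a \<in> {a \<in> {..<r}. v a + u a \<noteq> 0} - {a \<in> {..<r}. v a \<noteq> 0}" by (simp add: N_def)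
      moreover have "b \<in> {a \<in> {..<r}. v a + u a \<noteq> 0}" if "b \<in> {a \<in> {..<r}. v a \<noteq> 0}" for b
        using that u(2)[of b] by (simp add: N_def)
      ultimately show "{a \<in> {..<r}. v a \<noteq> 0} \<subset> {a \<in> {..<r}. v a + u a \<noteq> 0}" by blast
    qed simp
    ultimately show False using max by fastforce
  qed
  then show ?thesis using v unfolding P_def s_def by blast
qed

text \<open>
  Tao's slice rank argument: contracting the unit tensor with a vector that annihilates the
  slices in \<open>I\<close> and has maximal support leaves a diagonal matrix of large rank.
\<close>

lemma has_subrank_le_slices:
  fixes T :: "'a::field tensor3"
  assumes sub: "has_subrank n1 n2 n3 T r"
    and fin: "finite I" "finite J" "finite K"
    and supp: "\<And>i j k. i < n1 \<Longrightarrow> j < n2 \<Longrightarrow> k < n3 \<Longrightarrow> T i j k \<noteq> 0 \<Longrightarrow> i \<in> I \<or> j \<in> J \<or> k \<in> K"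
  shows "r \<le> card I + card J + card K"
proof (rule ccontr)
  assume large: "\<not> ?thesis"
  obtain X Y Z where
    U: "\<And>a b c. a < r \<Longrightarrow> b < r \<Longrightarrow> c < r \<Longrightarrow> unit_tensor r a b c = tri n1 n2 n3 T (X a) (Y b) (Z c)"
    using sub unfolding restricts_def by blast
  obtain v where v: "\<And>i. i \<in> I \<Longrightarrow> (\<Sum>a<r. v a * X a i) = 0" "r \<le> card {a\<in>{..<r}. v a \<noteq> 0} + card I"
    using maximal_support_solution[OF fin(1)] by blast
  define S where "S = {a\<in>{..<r}. v a \<noteq> 0}"
  define x where "x i = (\<Sum>a<r. v a * X a i)" for i
  \<comment> \<open>The second vector \<open>y\<close> has to vanish on \<open>J\<close>, and its
    contraction with \<open>x\<close> on \<open>K\<close>. These are \<open>card J + card K\<close>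
    conditions on coefficients supported in \<open>S\<close>, which has at least
    \<open>r - card I\<close> elements.\<close>
  define eqs where "eqs e b = (case e of Inl j \<Rightarrow> Y b j
    | Inr k \<Rightarrow> tri n1 n2 n3 T x (Y b) (\<lambda>k'. of_bool (k' = k)))" for e b
  have "card (J <+> K) < card S"
    using large v(2) fin by (simp add: S_def card_Plus)
  from homogeneous_system[OF _ _ this, of eqs] fin
  obtain w where w: "\<exists>b\<in>S. w b \<noteq> 0" "\<And>b. b \<notin> S \<Longrightarrow> w b = 0"
    "\<And>e. e \<in> J <+> K \<Longrightarrow> (\<Sum>b\<in>S. w b * eqs e b) = 0" by (auto simp: S_def)
  define y where "y j = (\<Sum>b\<in>S. w b * Y b j)" for j
  obtain c where c: "c \<in> S" "w c \<noteq> 0" using w(1) by blast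
  have cr: "c < r" "v c \<noteq> 0" using c by (auto simp: S_def)
  have x0: "x i = 0" if "i \<in> I" for i using v(1)[OF that] by (simp add: x_def)
  have y0: "y j = 0" if "j \<in> J" for j using w(3)[OF InlI[OF that]] by (simp add: eqs_def y_def)
  have k0: "tri n1 n2 n3 T x y (\<lambda>k'. of_bool (k' = k)) = 0" if "k \<in> K" for k
    using w(3)[OF InrI[OF that]] unfolding eqs_def y_def tri_sum2 by simp
  \<comment> \<open>Computed through the unit tensor this number is nonzero; computed through the
    support of \<open>T\<close> it is zero.\<close>
  have "tri n1 n2 n3 T x y (Z c) = v c * w c"
  proof -
    have "tri n1 n2 n3 T x y (Z c) = (\<Sum>a<r. v a * (\<Sum>b\<in>S. w b * unit_tensor r a b c))"
      unfolding x_def y_def tri_sum1 tri_sum2 using U cr by (intro sum.cong refl) (auto simp: S_def)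
    also have "\<dots> = (\<Sum>a<r. if a = c then v a * w c else 0)"
    proof (intro sum.cong refl)
      fix a assume "a \<in> {..<r}"
      have "(\<Sum>b\<in>S. w b * unit_tensor r a b c) = (\<Sum>b\<in>S. if b = c then (if a = c then w c else 0) else 0)"
        using cr by (intro sum.cong refl) (auto simp: unit_tensor_def)
      also have "\<dots> = (if a = c then w c else 0)" using c by (simp add: S_def)
      finally show "v a * (\<Sum>b\<in>S. w b * unit_tensor r a b c) = (if a = c then v a * w c else 0)" by simp
    qed
    also have "\<dots> = v c * w c" using cr by simp
    finally show ?thesis .
  qed
  moreover have "tri n1 n2 n3 T x y (Z c) = 0"
  proof -
    have "tri n1 n2 n3 T x y (Z c) = tri n1 n2 n3 T x y (\<lambda>k. \<Sum>l<n3. Z c l * of_bool (k = l))"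
      unfolding tri_def by (intro sum.cong refl) (simp add: if_distrib cong: if_cong)
    also have "\<dots> = (\<Sum>l<n3. Z c l * tri n1 n2 n3 T x y (\<lambda>k. of_bool (k = l)))"
      by (rule tri_sum3)
    also have "\<dots> = 0"
    proof (intro sum.neutral ballI)
      fix l assume "l \<in> {..<n3}"
      show "Z c l * tri n1 n2 n3 T x y (\<lambda>k. of_bool (k = l)) = 0"
      proof (cases "l \<in> K")
        case True then show ?thesis using k0 by simp
      next
        case False
        then have "x i * y j * of_bool (k = l) * T i j k = 0" if "i < n1" "j < n2" "k < n3" for i j k
          using supp[OF that] x0 y0 by (cases "k = l") auto
        then have "tri n1 n2 n3 T x y (\<lambda>k. of_bool (k = l)) = 0"
          unfolding tri_def by (intro sum.neutral ballI) blast
        then show ?thesis by simp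
      qed
    qed
    finally show ?thesis .
  qed
  ultimately show False using c cr by simp
qed

lemma has_subrank_le_dim: "has_subrank n1 n2 n3 T r \<Longrightarrow> r \<le> n1"
  using has_subrank_le_slices[of n1 n2 n3 T r "{..<n1}" "{}" "{}"] by auto

lemma has_subrank_0: "has_subrank n1 n2 n3 T 0"
  by (rule restrictsI) auto

lemma has_subrank_subrank: "has_subrank n1 n2 n3 T (subrank n1 n2 n3 T)"
  unfolding subrank_altdef
  using has_subrank_0 has_subrank_le_dim
  by (rule GreatestI_nat[where P = "has_subrank n1 n2 n3 T"])

lemma has_subrank_le: "has_subrank n1 n2 n3 T r \<Longrightarrow> r \<le> subrank n1 n2 n3 T"
  unfolding subrank_altdef using has_subrank_le_dim
  by (rule Greatest_le_nat[where P = "has_subrank n1 n2 n3 T", rotated])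

lemma subrank_mono: "restricts n1 n2 n3 T m1 m2 m3 S \<Longrightarrow> subrank m1 m2 m3 S \<le> subrank n1 n2 n3 T"
  by (intro has_subrank_le) (rule restricts_trans[OF _ has_subrank_subrank])

lemma subrank_le_dim: "subrank n1 n2 n3 T \<le> n1"
  using has_subrank_le_dim has_subrank_subrank .

lemma has_subrank_swap12: "has_subrank n2 n1 n3 (swap12 T) r \<longleftrightarrow> has_subrank n1 n2 n3 T r"
proof -
  have "swap12 (unit_tensor r :: 'a tensor3) = unit_tensor r"
    unfolding unit_tensor_def by (intro ext if_cong refl) auto
  then show ?thesis using restricts_swap12[of n2 n1 n3 T r r r "unit_tensor r"] by (simp only:)
qed

lemma has_subrank_swap23: "has_subrank n1 n3 n2 (swap23 T) r \<longleftrightarrow> has_subrank n1 n2 n3 T r"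
proof -
  have "swap23 (unit_tensor r :: 'a tensor3) = unit_tensor r"
    unfolding unit_tensor_def by (intro ext if_cong refl) auto
  then show ?thesis using restricts_swap23[of n1 n3 n2 T r r r "unit_tensor r"] by (simp only:)
qed

lemma asymptotic_subrank_swap12: "asymptotic_subrank n2 n1 n3 (swap12 T) = asymptotic_subrank n1 n2 n3 T"
  by (simp only: asymptotic_subrank_def tensor_kron_power_swap12[where T = T] subrank_altdef
      has_subrank_swap12[where T = "tensor_kron_power n1 n2 n3 T _"])

lemma asymptotic_subrank_swap23: "asymptotic_subrank n1 n3 n2 (swap23 T) = asymptotic_subrank n1 n2 n3 T"
  by (simp only: asymptotic_subrank_def tensor_kron_power_swap23[where T = T] subrank_altdef
      has_subrank_swap23[where T = "tensor_kron_power n1 n2 n3 T _"])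

lemma has_subrank_kron:
  assumes "has_subrank n1 n2 n3 T r" "has_subrank m1 m2 m3 S s"
  shows "has_subrank (n1 * m1) (n2 * m2) (n3 * m3) (tensor_kron m1 m2 m3 T S) (r * s)"
proof -
  have "tensor_kron s s s (unit_tensor r) (unit_tensor s) = (unit_tensor (r * s) :: 'a tensor3)"
  proof (intro ext)
    fix a b c
    have "a div s = b div s \<and> a mod s = b mod s \<longleftrightarrow> a = b" for a b :: nat
      by (metis div_mult_mod_eq)
    moreover have "a < r * s \<longleftrightarrow> a div s < r \<and> a mod s < s" using div_less_and_mod_less_iff by blast
    ultimately show "tensor_kron s s s (unit_tensor r) (unit_tensor s) a b c = (unit_tensor (r * s) :: 'a tensor3) a b c"
      by (auto simp: tensor_kron_def unit_tensor_def)
  qed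
  then show ?thesis using restricts_kron[OF assms] by simp
qed

section \<open>The asymptotic subrank\<close>

text \<open>Fekete's argument for \<open>ln (a n)\<close>: the supremum of \<open>b n / n\<close> is
  nearly attained at some \<open>N\<close>, and every \<open>n\<close> is a multiple of
  \<open>N\<close> plus a remainder whose share tends to zero. That the limit bounds each single
  term is recorded as well, since lower bounds are read off at individual powers.\<close>

lemma fekete_root:
  fixes a :: "nat \<Rightarrow> nat"
  assumes sup: "\<And>m n. a m * a n \<le> a (m + n)" and pos: "\<And>n. 1 \<le> a n" and le: "\<And>n. a n \<le> C ^ n"
  shows "\<exists>L. (\<lambda>n. root n (a n)) \<longlonglongrightarrow> L \<and> (\<forall>n\<ge>1. root n (a n) \<le> L)"
proof -
  define b where "b n = ln (real (a n))" for n
  have b0: "b n \<ge> 0" for n using pos[of n] by (simp add: b_def)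
  have badd: "b m + b n \<le> b (m + n)" for m n
  proof -
    have "b m + b n = ln (real (a m * a n))" using pos[of m] pos[of n] by (simp add: b_def ln_mult)
    also have "\<dots> \<le> b (m + n)"
      using sup[of m n] pos[of m] pos[of n] pos[of "m + n"] unfolding b_def
      by (subst ln_le_cancel_iff) (auto simp del: of_nat_mult)
    finally show ?thesis .
  qed
  have bmul: "real q * b n \<le> b (q * n)" for q n
  proof (induction q)
    case 0 then show ?case using b0 by simp
  next
    case (Suc q)
    then show ?case using badd[of n "q * n"] by (simp add: algebra_simps)
  qed
  have C: "C \<ge> 1" using le[of 1] pos[of 1] by simp
  have ble: "b n / n \<le> ln C" if "n \<ge> 1" for n
  proof -
    have "real (a n) \<le> real C ^ n" using le[of n] by (metis of_nat_le_iff of_nat_power)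
    then have "b n \<le> ln (real C ^ n)" using pos[of n] C unfolding b_def by (subst ln_le_cancel_iff) auto
    also have "\<dots> = n * ln C" using C by (simp add: ln_realpow)
    finally show ?thesis using that by (simp add: field_simps)
  qed
  define s where "s = (SUP n\<in>{1..}. b n / n)"
  have bdd: "bdd_above ((\<lambda>n. b n / n) ` {1..})" using ble by (intro bdd_aboveI2[of _ _ "ln C"]) auto
  have bs: "b n / n \<le> s" if "n \<ge> 1" for n unfolding s_def using that by (intro cSUP_upper bdd) auto
  have lim: "(\<lambda>n. b n / n) \<longlonglongrightarrow> s"
  proof (rule order_tendstoI)
    fix y assume "y < s"
    then obtain N where N: "N \<ge> 1" "y < b N / N"
      unfolding s_def using less_cSUP_iff[OF _ bdd, of y] by fastforce
    have "(\<lambda>n. b N / N * (1 - N / real n)) \<longlonglongrightarrow> b N / N * (1 - 0)"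
      by (intro tendsto_intros lim_const_over_n)
    then have "eventually (\<lambda>n. y < b N / N * (1 - N / real n)) sequentially"
      using N by (intro order_tendstoD) auto
    then show "eventually (\<lambda>n. y < b n / n) sequentially"
      using eventually_ge_at_top[of 1]
    proof eventually_elim
      case (elim n)
      have "real n - N \<le> real (n div N) * N"
      proof -
        have "n < n div N * N + N" using N(1) mod_less_divisor[of N n] div_mult_mod_eq[of n N] by linarith
        then have "real n \<le> real (n div N * N + N)" by linarith
        then show ?thesis by simp
      qed
      then have "b N / N * (real n - N) \<le> b N / N * (real (n div N) * N)"
        using b0[of N] by (intro mult_left_mono) auto
      also have "\<dots> = real (n div N) * b N" using N by simp
      also have "\<dots> \<le> b (n div N * N)" by (rule bmul)
      also have "\<dots> \<le> b n" using badd[of "n div N * N" "n mod N"] b0[of "n mod N"] by simp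
      finally have "b N / N * (real n - N) / n \<le> b n / n" by (intro divide_right_mono) auto
      also have "b N / N * (real n - N) / n = b N / N * (1 - N / real n)"
        using elim(2) by (simp add: field_simps)
      finally show ?case using elim(1) by linarith
    qed
  next
    fix y assume "s < y"
    show "eventually (\<lambda>n. b n / n < y) sequentially"
      using eventually_ge_at_top[of 1]
      by (rule eventually_mono) (use bs \<open>s < y\<close> le_less_trans in blast)
  qed
  have root: "root n (a n) = exp (b n / n)" if "n \<ge> 1" for n
  proof -
    have "root n (a n) = real (a n) powr (1 / n)" using that pos[of n] by (intro root_powr_inverse) auto
    then show ?thesis using pos[of n] by (simp add: powr_def b_def)
  qed
  have "(\<lambda>n. exp (b n / n)) \<longlonglongrightarrow> exp s" by (intro tendsto_exp lim)
  moreover have "eventually (\<lambda>n. exp (b n / n) = root n (a n)) sequentially"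
    using eventually_ge_at_top[of 1] by eventually_elim (simp add: root)
  ultimately have "(\<lambda>n. root n (a n)) \<longlonglongrightarrow> exp s" by (rule Lim_transform_eventually)
  moreover have "\<forall>n\<ge>1. root n (a n) \<le> exp s" using bs by (simp add: root)
  ultimately show ?thesis by blast
qed

text \<open>Restrictions see only the entries inside the format, so this is the form of nonvanishing
  that travels along them; for members of \<open>tensor_space\<close> it amounts to being
  nonzero.\<close>

definition nonzero_on :: "nat \<Rightarrow> nat \<Rightarrow> nat \<Rightarrow> 'a::zero tensor3 \<Rightarrow> bool" where
  "nonzero_on n1 n2 n3 T \<longleftrightarrow> (\<exists>i<n1. \<exists>j<n2. \<exists>k<n3. T i j k \<noteq> 0)"

lemma restricts_nonzero_on:
  assumes "restricts n1 n2 n3 T m1 m2 m3 S" "nonzero_on m1 m2 m3 S"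
  shows "nonzero_on n1 n2 n3 T"
proof (rule ccontr)
  assume "\<not> ?thesis"
  then have "tri n1 n2 n3 T x y z = 0" for x y z by (simp add: nonzero_on_def tri_def)
  then show False using assms unfolding restricts_def nonzero_on_def by metis
qed

context
  fixes n1 n2 n3 :: nat and T :: "'a::field tensor3"
  assumes nz: "nonzero_on n1 n2 n3 T"
begin

lemma subrank_power_pos: "1 \<le> subrank (n1 ^ n) (n2 ^ n) (n3 ^ n) (tensor_kron_power n1 n2 n3 T n)"
proof -
  obtain i j k where ijk: "i < n1" "j < n2" "k < n3" "T i j k \<noteq> 0" using nz unfolding nonzero_on_def by blast
  have "has_subrank n1 n2 n3 T 1"
  proof (rule restrictsI[of _ _ _ _ _ _ _ _ "\<lambda>_ i'. \<Sum>a<1. inverse (T i j k) * of_bool (i' = i)"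
        "\<lambda>_ j'. of_bool (j' = j)" "\<lambda>_ k'. of_bool (k' = k)"])
    fix a b c :: nat assume "a < 1" "b < 1" "c < 1"
    then show "unit_tensor 1 a b c = tri n1 n2 n3 T (\<lambda>i'. \<Sum>a<1::nat. inverse (T i j k) * of_bool (i' = i))
        (\<lambda>j'. of_bool (j' = j)) (\<lambda>k'. of_bool (k' = k))"
      unfolding tri_sum1 using ijk by (simp add: tri_unit_vectors unit_tensor_def)
  qed
  from restricts_power[OF this, of n]
  have "restricts (n1 ^ n) (n2 ^ n) (n3 ^ n) (tensor_kron_power n1 n2 n3 T n) 1 1 1 (tensor_kron_power 1 1 1 (unit_tensor 1) n)"
    by simp
  moreover have "tensor_kron_power 1 1 1 (unit_tensor 1) n = (unit_tensor 1 :: 'a tensor3)"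
    by (induction n) (auto simp: fun_eq_iff tensor_kron_def unit_tensor_def)
  ultimately show ?thesis by (intro has_subrank_le) simp
qed

lemma asymptotic_subrank_fekete:
  "(\<lambda>n. root n (subrank (n1 ^ n) (n2 ^ n) (n3 ^ n) (tensor_kron_power n1 n2 n3 T n))) \<longlonglongrightarrow> asymptotic_subrank n1 n2 n3 T
   \<and> (\<forall>n\<ge>1. root n (subrank (n1 ^ n) (n2 ^ n) (n3 ^ n) (tensor_kron_power n1 n2 n3 T n)) \<le> asymptotic_subrank n1 n2 n3 T)"
proof -
  have "\<exists>L. (\<lambda>n. root n (subrank (n1 ^ n) (n2 ^ n) (n3 ^ n) (tensor_kron_power n1 n2 n3 T n))) \<longlonglongrightarrow> L
   \<and> (\<forall>n\<ge>1. root n (subrank (n1 ^ n) (n2 ^ n) (n3 ^ n) (tensor_kron_power n1 n2 n3 T n)) \<le> L)"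
  proof (rule fekete_root)
    fix m n
    show "subrank (n1 ^ m) (n2 ^ m) (n3 ^ m) (tensor_kron_power n1 n2 n3 T m) *
           subrank (n1 ^ n) (n2 ^ n) (n3 ^ n) (tensor_kron_power n1 n2 n3 T n)
         \<le> subrank (n1 ^ (m + n)) (n2 ^ (m + n)) (n3 ^ (m + n)) (tensor_kron_power n1 n2 n3 T (m + n))"
      unfolding tensor_kron_power_add power_add
      by (intro has_subrank_le has_subrank_kron has_subrank_subrank)
  qed (rule subrank_power_pos subrank_le_dim)+
  then obtain L where L: "(\<lambda>n. root n (subrank (n1 ^ n) (n2 ^ n) (n3 ^ n) (tensor_kron_power n1 n2 n3 T n))) \<longlonglongrightarrow> L"
    "\<forall>n\<ge>1. root n (subrank (n1 ^ n) (n2 ^ n) (n3 ^ n) (tensor_kron_power n1 n2 n3 T n)) \<le> L" by blast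
  have "asymptotic_subrank n1 n2 n3 T = L" unfolding asymptotic_subrank_def by (rule limI[OF L(1)])
  then show ?thesis using L by simp
qed

lemmas asymptotic_subrank_tendsto = asymptotic_subrank_fekete[THEN conjunct1]

lemma asymptotic_subrank_ge_root:
  "n \<ge> 1 \<Longrightarrow> root n (subrank (n1 ^ n) (n2 ^ n) (n3 ^ n) (tensor_kron_power n1 n2 n3 T n)) \<le> asymptotic_subrank n1 n2 n3 T"
  using asymptotic_subrank_fekete by blast

lemma asymptotic_subrank_ge_1: "1 \<le> asymptotic_subrank n1 n2 n3 T"
  using asymptotic_subrank_ge_root[of 1] subrank_power_pos[of 1] by simp

end

lemma asymptotic_subrank_mono:
  assumes "restricts n1 n2 n3 T m1 m2 m3 S" "nonzero_on m1 m2 m3 S"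
  shows "asymptotic_subrank m1 m2 m3 S \<le> asymptotic_subrank n1 n2 n3 T"
proof (rule LIMSEQ_le[OF asymptotic_subrank_tendsto[OF assms(2)]
      asymptotic_subrank_tendsto[OF restricts_nonzero_on[OF assms]]], intro exI allI impI)
  fix n :: nat assume "1 \<le> n"
  then show "root n (subrank (m1 ^ n) (m2 ^ n) (m3 ^ n) (tensor_kron_power m1 m2 m3 S n))
    \<le> root n (subrank (n1 ^ n) (n2 ^ n) (n3 ^ n) (tensor_kron_power n1 n2 n3 T n))"
    by (simp add: subrank_mono[OF restricts_power[OF assms(1)]])
qed

text \<open>The \<open>n\<close>-th root of \<open>K\<close> tends to 1. This absorbs the factor 3
  that arises from slicing in three directions.\<close>

lemma asymptotic_subrank_upper:
  assumes nz: "nonzero_on n1 n2 n3 T" and "c > 0" "K > 0"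
    and "\<And>n. n \<ge> 1 \<Longrightarrow> real (subrank (n1 ^ n) (n2 ^ n) (n3 ^ n) (tensor_kron_power n1 n2 n3 T n)) \<le> K * c ^ n"
  shows "asymptotic_subrank n1 n2 n3 T \<le> c"
proof (rule LIMSEQ_le[OF asymptotic_subrank_tendsto[OF nz]])
  have "(\<lambda>n. root n K * c) \<longlonglongrightarrow> 1 * c"
    using \<open>K > 0\<close> by (intro tendsto_intros LIMSEQ_root_const)
  then show "(\<lambda>n. root n K * c) \<longlonglongrightarrow> c" by simp
  have "root n (subrank (n1 ^ n) (n2 ^ n) (n3 ^ n) (tensor_kron_power n1 n2 n3 T n)) \<le> root n K * c"
    if "1 \<le> n" for n
  proof -
    have "root n (subrank (n1 ^ n) (n2 ^ n) (n3 ^ n) (tensor_kron_power n1 n2 n3 T n)) \<le> root n (K * c ^ n)"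
      using assms(4)[OF that] that by simp
    also have "\<dots> = root n K * c" using that \<open>c > 0\<close> by (simp add: real_root_mult real_root_power_cancel)
    finally show ?thesis .
  qed
  then show "\<exists>N. \<forall>n\<ge>N. root n (subrank (n1 ^ n) (n2 ^ n) (n3 ^ n) (tensor_kron_power n1 n2 n3 T n)) \<le> root n K * c"
    by blast
qed

lemma asymptotic_subrank_le_dim: "nonzero_on n1 n2 n3 T \<Longrightarrow> asymptotic_subrank n1 n2 n3 T \<le> n1"
proof (rule asymptotic_subrank_upper[of _ _ _ _ _ 1])
  fix n
  show "real (subrank (n1 ^ n) (n2 ^ n) (n3 ^ n) (tensor_kron_power n1 n2 n3 T n)) \<le> 1 * real n1 ^ n"
    using subrank_le_dim[of "n1 ^ n"] by (metis mult_1 of_nat_le_iff of_nat_power)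
qed (auto simp: nonzero_on_def)

section \<open>Combinatorial lower bounds for the asymptotic subrank\<close>

text \<open>The head of the list is the lowest digit, in agreement with the recursion of
  \<open>tensor_kron_power\<close>.\<close>

fun enc :: "nat \<Rightarrow> nat list \<Rightarrow> nat" where
  "enc p [] = 0"
| "enc p (x # xs) = enc p xs * p + x"

lemma enc_less: "set xs \<subseteq> {..<p} \<Longrightarrow> enc p xs < p ^ length xs"
proof (induction xs)
  case (Cons x xs)
  then have "enc p (x # xs) div p < p ^ length xs \<and> enc p (x # xs) mod p < p" by simp
  then have "enc p (x # xs) < p ^ length xs * p" unfolding div_less_and_mod_less_iff .
  then show ?case by (simp add: mult.commute)
qed simp

lemma tensor_kron_power_enc:
  assumes "length xs = length ys" "length ys = length zs"
    and "set xs \<subseteq> {..<n1}" "set ys \<subseteq> {..<n2}" "set zs \<subseteq> {..<n3}"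
  shows "tensor_kron_power n1 n2 n3 T (length xs) (enc n1 xs) (enc n2 ys) (enc n3 zs)
    = (\<Prod>t<length xs. T (xs ! t) (ys ! t) (zs ! t))"
  using assms
proof (induction xs ys zs rule: list_induct3)
  case Nil
  then show ?case by (simp add: unit_tensor_def)
next
  case (Cons x xs y ys z zs)
  then show ?case
    by (simp add: tensor_kron_def prod.lessThan_Suc_shift mult.commute del: prod.lessThan_Suc)
qed

text \<open>Slices chosen along a matching leave a diagonal tensor, whose entries are scaled to 1 in
  the first factor. Distinctness of the chosen indices is contained in \<open>diag\<close>.\<close>

lemma has_subrank_diagonal:
  fixes T :: "'a::field tensor3"
  assumes fin: "finite D"
    and bnd: "\<And>p. p \<in> D \<Longrightarrow> x p < n1 \<and> y p < n2 \<and> z p < n3"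
    and diag: "\<And>p q s. p \<in> D \<Longrightarrow> q \<in> D \<Longrightarrow> s \<in> D \<Longrightarrow> T (x p) (y q) (z s) \<noteq> 0 \<longleftrightarrow> p = q \<and> q = s"
  shows "has_subrank n1 n2 n3 T (card D)"
proof -
  obtain h where h: "bij_betw h {..<card D} D"
    using ex_bij_betw_nat_finite[OF fin] by (auto simp: lessThan_atLeast0)
  have hD: "h a \<in> D" if "a < card D" for a using h that by (auto simp: bij_betw_def)
  have hinj: "h a = h b \<longleftrightarrow> a = b" if "a < card D" "b < card D" for a b
    using h that by (auto simp: bij_betw_def inj_on_def)
  show ?thesis
  proof (rule restrictsI[of _ _ _ _ _ _ _ _
        "\<lambda>a i. \<Sum>l<1. inverse (T (x (h a)) (y (h a)) (z (h a))) * of_bool (i = x (h a))"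
        "\<lambda>b j. of_bool (j = y (h b))" "\<lambda>c k. of_bool (k = z (h c))"])
    fix a b c assume abc: "a < card D" "b < card D" "c < card D"
    have "tri n1 n2 n3 T (\<lambda>i. \<Sum>l<1::nat. inverse (T (x (h a)) (y (h a)) (z (h a))) * of_bool (i = x (h a)))
          (\<lambda>j. of_bool (j = y (h b))) (\<lambda>k. of_bool (k = z (h c)))
        = inverse (T (x (h a)) (y (h a)) (z (h a))) * T (x (h a)) (y (h b)) (z (h c))"
      unfolding tri_sum1 using abc bnd hD by (simp add: tri_unit_vectors)
    also have "\<dots> = unit_tensor (card D) a b c"
      using diag[of "h a" "h b" "h c"] diag[of "h a" "h a" "h a"] hinj abc hD
      by (auto simp: unit_tensor_def)
    finally show "unit_tensor (card D) a b c
        = tri n1 n2 n3 T (\<lambda>i. \<Sum>l<1::nat. inverse (T (x (h a)) (y (h a)) (z (h a))) * of_bool (i = x (h a)))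
          (\<lambda>j. of_bool (j = y (h b))) (\<lambda>k. of_bool (k = z (h c)))" ..
  qed
qed

lemma pigeonhole_fiber:
  assumes "finite V" "finite W" "\<phi> ` W \<subseteq> V" "V \<noteq> {}"
  shows "\<exists>v\<in>V. card W \<le> card V * card {w\<in>W. \<phi> w = v}"
proof -
  define F where "F v = card {w\<in>W. \<phi> w = v}" for v
  have "Max (F ` V) \<in> F ` V" using assms by (intro Max_in) auto
  then obtain v where v: "v \<in> V" "F v = Max (F ` V)" by (metis imageE)
  have "card W = (\<Sum>v\<in>V. F v)"
    using sum.group[OF assms(2,1,3), of "\<lambda>_. 1::nat"] by (simp add: F_def)
  also have "\<dots> \<le> card V * F v"
    using sum_bounded_above[of V F "F v"] v(2) assms(1) by simp
  finally show ?thesis using v(1) unfolding F_def by blast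
qed

text \<open>
  The zero set of a nonnegative integer weight that splits over the three factors is a
  combinatorial degeneration of the support.  In a large power all level sets of the weights on the
  three factors are polynomially many, so one of them contains a proportion of the matching that
  does not matter for the growth rate.
\<close>

lemma asymptotic_subrank_ge_matching:
  fixes T :: "'a::field tensor3" and f g h :: "'b \<Rightarrow> int"
  assumes fin: "finite P" and ne: "P \<noteq> {}"
    and bnd: "\<And>p. p \<in> P \<Longrightarrow> x p < n1 \<and> y p < n2 \<and> z p < n3"
    and nz: "\<And>p. p \<in> P \<Longrightarrow> T (x p) (y p) (z p) \<noteq> 0"
    and zero: "\<And>p. p \<in> P \<Longrightarrow> f p + g p + h p = 0"
    and nonneg: "\<And>p q s. p \<in> P \<Longrightarrow> q \<in> P \<Longrightarrow> s \<in> P \<Longrightarrow> T (x p) (y q) (z s) \<noteq> 0 \<Longrightarrow> 0 \<le> f p + g q + h s"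
    and diag: "\<And>p q s. p \<in> P \<Longrightarrow> q \<in> P \<Longrightarrow> s \<in> P \<Longrightarrow> T (x p) (y q) (z s) \<noteq> 0 \<Longrightarrow> f p + g q + h s = 0 \<Longrightarrow> p = q \<and> q = s"
  shows "card P \<le> asymptotic_subrank n1 n2 n3 T"
proof -
  have nzo: "nonzero_on n1 n2 n3 T" using ne bnd nz unfolding nonzero_on_def by blast
  define B where "B = nat (Max ((\<lambda>p. max \<bar>f p\<bar> \<bar>g p\<bar>) ` P))"
  have B: "\<bar>f p\<bar> \<le> int B" "\<bar>g p\<bar> \<le> int B" if "p \<in> P" for p
  proof -
    have "max \<bar>f p\<bar> \<bar>g p\<bar> \<le> Max ((\<lambda>p. max \<bar>f p\<bar> \<bar>g p\<bar>) ` P)" using fin that by (intro Max_ge) auto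
    moreover from this have "0 \<le> Max ((\<lambda>p. max \<bar>f p\<bar> \<bar>g p\<bar>) ` P)" by linarith
    ultimately show "\<bar>f p\<bar> \<le> int B" "\<bar>g p\<bar> \<le> int B" by (simp_all add: B_def)
  qed
  have main: "card P ^ k \<le> ((2 * B + 1) * k)\<^sup>2 * subrank (n1 ^ k) (n2 ^ k) (n3 ^ k) (tensor_kron_power n1 n2 n3 T k)"
    if "k \<ge> 1" for k
  proof -
    define W where "W = {ps. set ps \<subseteq> P \<and> length ps = k}"
    have finW: "finite W" unfolding W_def using fin by (rule finite_lists_length_eq)
    have cardW: "card W = card P ^ k" unfolding W_def using fin by (rule card_lists_length_eq)
    define F where "F f ps = (\<Sum>t<k. f (ps ! t))" for f :: "'b \<Rightarrow> int" and ps
    have W: "ps ! t \<in> P" if "ps \<in> W" "t < k" for ps t using that by (auto simp: W_def)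
    \<comment> \<open>Only the sums of \<open>f\<close> and \<open>g\<close> along a word are
      recorded, because \<open>zero\<close> then determines the sum of \<open>h\<close>. The number
      of values is quadratic in \<open>k\<close>.\<close>
    define V where "V = {- int (k * B) .. int (k * B)} \<times> {- int (k * B) .. int (k * B)}"
    have Fb: "\<bar>F f ps\<bar> \<le> int (k * B)" if "ps \<in> W" "\<And>p. p \<in> P \<Longrightarrow> \<bar>f p\<bar> \<le> int B" for f ps
    proof -
      have "\<bar>F f ps\<bar> \<le> (\<Sum>t<k. \<bar>f (ps ! t)\<bar>)" unfolding F_def by (rule sum_abs)
      also have "\<dots> \<le> (\<Sum>t<k. int B)" using that W by (intro sum_mono) auto
      finally show ?thesis by simp
    qed
    have "(\<lambda>ps. (F f ps, F g ps)) ` W \<subseteq> V"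
    proof (intro subsetI, elim imageE)
      fix v ps assume v: "v = (F f ps, F g ps)" and ps: "ps \<in> W"
      have "\<bar>F f ps\<bar> \<le> int (k * B)" by (rule Fb[OF ps B(1)])
      moreover have "\<bar>F g ps\<bar> \<le> int (k * B)" by (rule Fb[OF ps B(2)])
      ultimately show "v \<in> V" unfolding V_def v by (simp add: abs_le_iff)
    qed
    moreover have "V \<noteq> {}" "finite V" by (auto simp: V_def)
    ultimately obtain v where "card W \<le> card V * card {ps\<in>W. (F f ps, F g ps) = v}"
      using pigeonhole_fiber[of V W "\<lambda>ps. (F f ps, F g ps)"] finW by blast
    moreover define D where "D = {ps\<in>W. (F f ps, F g ps) = v}"
    ultimately have card_le: "card P ^ k \<le> card V * card D" using cardW by simp
    have "card V = (2 * (k * B) + 1)\<^sup>2" by (simp add: V_def card_cartesian_product power2_eq_square nat_add_distrib nat_mult_distrib)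
    also have "\<dots> \<le> ((2 * B + 1) * k)\<^sup>2" using that by (intro power_mono) (auto simp: algebra_simps)
    finally have cardV: "card V \<le> ((2 * B + 1) * k)\<^sup>2" .
    have "has_subrank (n1 ^ k) (n2 ^ k) (n3 ^ k) (tensor_kron_power n1 n2 n3 T k) (card D)"
    proof (rule has_subrank_diagonal[of _ "\<lambda>ps. enc n1 (map x ps)" _ "\<lambda>ps. enc n2 (map y ps)" _ "\<lambda>ps. enc n3 (map z ps)"])
      show "finite D" using finW by (simp add: D_def)
      have sets: "set (map x ps) \<subseteq> {..<n1}" "set (map y ps) \<subseteq> {..<n2}" "set (map z ps) \<subseteq> {..<n3}" if "ps \<in> D" for ps
        using that bnd unfolding D_def W_def by auto
      have len: "length ps = k" if "ps \<in> D" for ps using that by (simp add: D_def W_def)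
      show "enc n1 (map x ps) < n1 ^ k \<and> enc n2 (map y ps) < n2 ^ k \<and> enc n3 (map z ps) < n3 ^ k" if "ps \<in> D" for ps
        using enc_less[OF sets(1)[OF that]] enc_less[OF sets(2)[OF that]] enc_less[OF sets(3)[OF that]] len[OF that] by simp
      fix ps qs ss assume D: "ps \<in> D" "qs \<in> D" "ss \<in> D"
      have "tensor_kron_power n1 n2 n3 T k (enc n1 (map x ps)) (enc n2 (map y qs)) (enc n3 (map z ss))
          = (\<Prod>t<k. T (x (ps ! t)) (y (qs ! t)) (z (ss ! t)))"
        using tensor_kron_power_enc[of "map x ps" "map y qs" "map z ss" n1 n2 n3 T] D sets len by simp
      moreover have "(\<Prod>t<k. T (x (ps ! t)) (y (qs ! t)) (z (ss ! t))) \<noteq> 0 \<longleftrightarrow> ps = qs \<and> qs = ss"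
      proof
        assume "(\<Prod>t<k. T (x (ps ! t)) (y (qs ! t)) (z (ss ! t))) \<noteq> 0"
        then have nzt: "T (x (ps ! t)) (y (qs ! t)) (z (ss ! t)) \<noteq> 0" if "t < k" for t using that by simp
        have P: "ps ! t \<in> P" "qs ! t \<in> P" "ss ! t \<in> P" if "t < k" for t
          using D W that by (auto simp: D_def)
        \<comment> \<open>Words of \<open>D\<close> share the sums of \<open>f\<close> and of
          \<open>g\<close>, so a mixed triple has total weight zero; its terms are nonnegative and
          hence vanish at every position.\<close>
        have "F h ss = - F f ss - F g ss"
        proof -
          have "h (ss ! t) = - f (ss ! t) - g (ss ! t)" if "t < k" for t
            using zero[OF P(3)[OF that]] by linarith
          then have "F h ss = (\<Sum>t<k. - f (ss ! t) - g (ss ! t))"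
            unfolding F_def by simp
          then show ?thesis by (simp add: F_def sum_subtractf sum_negf)
        qed
        then have "F f ps + F g qs + F h ss = 0" using D by (auto simp: D_def)
        then have "(\<Sum>t<k. f (ps ! t) + g (qs ! t) + h (ss ! t)) = 0" by (simp add: F_def sum.distrib)
        then have "\<forall>t\<in>{..<k}. f (ps ! t) + g (qs ! t) + h (ss ! t) = 0"
          using nonneg P nzt by (subst (asm) sum_nonneg_eq_0_iff) auto
        then have eq: "ps ! t = qs ! t \<and> qs ! t = ss ! t" if "t < k" for t
          using diag[OF P[OF that] nzt[OF that]] that by simp
        then show "ps = qs \<and> qs = ss" using len D by (auto intro!: nth_equalityI)
      next
        assume "ps = qs \<and> qs = ss"
        then show "(\<Prod>t<k. T (x (ps ! t)) (y (qs ! t)) (z (ss ! t))) \<noteq> 0"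
          using D nz W by (auto simp: D_def)
      qed
      ultimately show "tensor_kron_power n1 n2 n3 T k (enc n1 (map x ps)) (enc n2 (map y qs)) (enc n3 (map z ss)) \<noteq> 0
          \<longleftrightarrow> ps = qs \<and> qs = ss" by simp
    qed
    then have "card D \<le> subrank (n1 ^ k) (n2 ^ k) (n3 ^ k) (tensor_kron_power n1 n2 n3 T k)" by (rule has_subrank_le)
    then show ?thesis using card_le cardV by (meson le_trans mult_le_mono)
  qed
  have "real (card P) \<le> (root k (2 * B + 1) * root k k)\<^sup>2 * asymptotic_subrank n1 n2 n3 T" if "k \<ge> 1" for k
  proof -
    define q where "q = subrank (n1 ^ k) (n2 ^ k) (n3 ^ k) (tensor_kron_power n1 n2 n3 T k)"
    have "real (card P) ^ k \<le> (real (2 * B + 1) * k)\<^sup>2 * q"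
      using main[OF that] unfolding q_def
      by (metis (no_types, opaque_lifting) of_nat_le_iff of_nat_mult of_nat_power)
    then have "root k (real (card P) ^ k) \<le> root k ((real (2 * B + 1) * k)\<^sup>2 * q)" using that by simp
    then have "real (card P) \<le> (root k (2 * B + 1) * root k k)\<^sup>2 * root k q"
      using that by (simp add: real_root_mult real_root_power real_root_power_cancel)
    also have "\<dots> \<le> (root k (2 * B + 1) * root k k)\<^sup>2 * asymptotic_subrank n1 n2 n3 T"
      unfolding q_def using asymptotic_subrank_ge_root[OF nzo that] by (intro mult_left_mono) auto
    finally show ?thesis .
  qed
  moreover have "(\<lambda>k. (root k (2 * B + 1) * root k k)\<^sup>2 * asymptotic_subrank n1 n2 n3 T)
      \<longlonglongrightarrow> (1 * 1)\<^sup>2 * asymptotic_subrank n1 n2 n3 T"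
    by (intro tendsto_intros LIMSEQ_root_const LIMSEQ_root) auto
  ultimately show ?thesis
    by (intro LIMSEQ_le_const[of "\<lambda>k. (root k (2 * B + 1) * root k k)\<^sup>2 * asymptotic_subrank n1 n2 n3 T"]) auto
qed

text \<open>The roots for the power are the \<open>N\<close>-th powers of the terms at multiples of
  \<open>N\<close> in the sequence for \<open>T\<close>. This brings a bound found in a large power
  back to \<open>T\<close>.\<close>

lemma asymptotic_subrank_power:
  fixes T :: "'a::field tensor3"
  assumes nz: "nonzero_on n1 n2 n3 T" and "N \<ge> 1"
  shows "asymptotic_subrank (n1 ^ N) (n2 ^ N) (n3 ^ N) (tensor_kron_power n1 n2 n3 T N)
       = asymptotic_subrank n1 n2 n3 T ^ N"
proof -
  define a where "a n = subrank (n1 ^ n) (n2 ^ n) (n3 ^ n) (tensor_kron_power n1 n2 n3 T n)" for n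
  have "nonzero_on 1 1 1 (unit_tensor (a N) :: 'a tensor3)"
    using subrank_power_pos[OF nz, of N] by (auto simp: nonzero_on_def unit_tensor_def a_def)
  then have "nonzero_on (a N) (a N) (a N) (unit_tensor (a N) :: 'a tensor3)"
    using subrank_power_pos[OF nz, of N] by (auto simp: nonzero_on_def unit_tensor_def a_def intro!: exI[of _ 0])
  then have nzN: "nonzero_on (n1 ^ N) (n2 ^ N) (n3 ^ N) (tensor_kron_power n1 n2 n3 T N)"
    using restricts_nonzero_on has_subrank_subrank unfolding a_def by blast
  have "(\<lambda>n. root n (a n)) \<longlonglongrightarrow> asymptotic_subrank n1 n2 n3 T"
    unfolding a_def by (rule asymptotic_subrank_tendsto[OF nz])
  from LIMSEQ_subseq_LIMSEQ[OF this, of "\<lambda>k. N * k"]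
  have "(\<lambda>k. root (N * k) (a (N * k))) \<longlonglongrightarrow> asymptotic_subrank n1 n2 n3 T"
    using \<open>N \<ge> 1\<close> by (auto simp: strict_mono_def o_def)
  then have "(\<lambda>k. root (N * k) (a (N * k)) ^ N) \<longlonglongrightarrow> asymptotic_subrank n1 n2 n3 T ^ N"
    by (intro tendsto_intros)
  moreover have "eventually (\<lambda>k. root (N * k) (a (N * k)) ^ N = root k (a (N * k))) sequentially"
    using eventually_ge_at_top[of 1]
  proof eventually_elim
    case (elim k)
    have "root (N * k) (a (N * k)) = root N (root k (a (N * k)))"
      by (rule real_root_mult_exp)
    then show ?case using \<open>N \<ge> 1\<close> elim by (simp add: real_root_pow_pos2)
  qed
  ultimately have "(\<lambda>k. root k (a (N * k))) \<longlonglongrightarrow> asymptotic_subrank n1 n2 n3 T ^ N"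
    by (rule Lim_transform_eventually)
  moreover have "(\<lambda>k. root k (a (N * k)))
     \<longlonglongrightarrow> asymptotic_subrank (n1 ^ N) (n2 ^ N) (n3 ^ N) (tensor_kron_power n1 n2 n3 T N)"
    using asymptotic_subrank_tendsto[OF nzN] unfolding a_def tensor_kron_power_mult power_mult .
  ultimately show ?thesis by (rule LIMSEQ_unique[rotated])
qed

section \<open>Random hashing\<close>

text \<open>Permuting positions maps the fibre over one word injectively into the fibre over any
  other word with the same letters, so all fibres have the same size.\<close>

lemma fiber_card_regular:
  assumes fin: "finite E"
    and closed: "\<And>\<pi> es. \<pi> permutes {..<size M} \<Longrightarrow> es \<in> E \<Longrightarrow> permute_list \<pi> es \<in> E"
    and E: "\<And>es. es \<in> E \<Longrightarrow> mset (map p es) = M"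
    and x: "mset x = M"
  shows "card {es\<in>E. map p es = x} * card (permutations_of_multiset M) = card E"
proof -
  have len: "length es = size M" if "es \<in> E" for es using E[OF that] by (metis length_map size_mset)
  have le: "card {es\<in>E. map p es = x} \<le> card {es\<in>E. map p es = y}" if "mset x = M" "mset y = M" for x y
  proof -
    have "mset y = mset x" using that by simp
    then obtain \<pi> where \<pi>: "\<pi> permutes {..<length x}" "permute_list \<pi> x = y"
      by (rule mset_eq_permutation)
    have lx: "length x = size M" using that by (metis size_mset)
    have nth: "permute_list \<pi> es ! i = es ! \<pi> i" if "es \<in> E" "i < size M" for es i
      using \<pi>(1) that len lx by (intro permute_list_nth) auto
    show ?thesis
    proof (rule card_inj_on_le[of "permute_list \<pi>"])
      show "inj_on (permute_list \<pi>) {es \<in> E. map p es = x}"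
      proof (rule inj_onI)
        fix es es' assume "es \<in> {es \<in> E. map p es = x}" "es' \<in> {es \<in> E. map p es = x}"
          and eq: "permute_list \<pi> es = permute_list \<pi> es'"
        then have es: "es \<in> E" "es' \<in> E" by auto
        show "es = es'"
        proof (rule nth_equalityI)
          show "length es = length es'" using es len by simp
          fix i assume "i < length es"
          then have "i \<in> {..<length x}" using es len lx by simp
          then obtain j where j: "j < length x" "i = \<pi> j"
            using permutes_image[OF \<pi>(1)] by (metis imageE lessThan_iff)
          then show "es ! i = es' ! i" using nth[OF es(1), of j] nth[OF es(2), of j] eq lx by simp
        qed
      qed
      show "permute_list \<pi> ` {es \<in> E. map p es = x} \<subseteq> {es \<in> E. map p es = y}"
        using closed \<pi> lx len by (auto simp: permute_list_map[symmetric])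
    qed (use fin in auto)
  qed
  have "map p ` E \<subseteq> permutations_of_multiset M" using E by (auto simp: permutations_of_multiset_def)
  then have "card E = (\<Sum>y\<in>permutations_of_multiset M. card {es\<in>E. map p es = y})"
    using sum.group[OF fin finite_permutations_of_multiset, of "map p" M "\<lambda>_. 1::nat"] by simp
  also have "\<dots> = (\<Sum>y\<in>permutations_of_multiset M. card {es\<in>E. map p es = x})"
    using le x by (intro sum.cong refl antisym) (auto simp: permutations_of_multiset_def)
  finally show ?thesis by simp
qed

text \<open>The hash is evaluated over the integers and not modulo a prime, so that one of its level
  sets can later be isolated by an integer weight.\<close>

definition dot :: "nat list \<Rightarrow> int list \<Rightarrow> int" where
  "dot ws ds = sum_list (map2 (\<lambda>w d. int w * d) ws ds)"

lemma dot_simps [simp]: "dot [] ds = 0" "dot ws [] = 0" "dot (w # ws) (d # ds) = int w * d + dot ws ds"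
  by (simp_all add: dot_def)

lemma dot_diff: "dot ws (map f es) - dot ws (map g es) = dot ws (map (\<lambda>e. f e - g e) es)"
proof (induction ws arbitrary: es)
  case (Cons w ws)
  then show ?case by (cases es) (auto simp: algebra_simps Cons[symmetric])
qed simp

lemma dot_add: "dot ws (map f es) + dot ws (map g es) = dot ws (map (\<lambda>e. f e + g e) es)"
proof (induction ws arbitrary: es)
  case (Cons w ws)
  then show ?case by (cases es) (auto simp: algebra_simps Cons[symmetric])
qed simp

lemma dot_zero: "\<forall>d\<in>set ds. d = 0 \<Longrightarrow> dot ws ds = 0"
proof (induction ws arbitrary: ds)
  case (Cons w ws)
  then show ?case by (cases ds) auto
qed simp

lemma dot_bound:
  fixes C :: nat
  assumes "set ws \<subseteq> {..<L}" "\<forall>d\<in>set ds. \<bar>d\<bar> \<le> int C"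
  shows "\<bar>dot ws ds\<bar> \<le> int (length ws * (L * C))"
  using assms
proof (induction ws arbitrary: ds)
  case (Cons w ws)
  show ?case
  proof (cases ds)
    case (Cons d ds')
    have "\<bar>int w * d\<bar> \<le> int L * int C" unfolding abs_mult
      using Cons Cons.prems by (intro mult_mono) auto
    moreover have "\<bar>dot ws ds'\<bar> \<le> int (length ws * (L * C))" using Cons Cons.prems by (intro Cons.IH) auto
    ultimately show ?thesis using Cons by (simp add: algebra_simps)
  qed simp
qed simp

text \<open>The variable at a nonzero coefficient is determined by the others, so at most one vector
  in \<open>L\<close> solves the equation.\<close>

lemma card_linear_solutions:
  assumes "\<exists>d\<in>set ds. d \<noteq> 0" "L \<ge> 1"
  shows "card {ws. set ws \<subseteq> {..<L} \<and> length ws = length ds \<and> dot ws ds = c} * L \<le> L ^ length ds"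
  using assms(1)
proof (induction ds arbitrary: c)
  case (Cons d ds)
  define S where "S ds c = {ws. set ws \<subseteq> {..<L} \<and> length ws = length ds \<and> dot ws ds = c}" for ds c
  have fin: "finite (S ds c)" for ds c
    by (rule finite_subset[OF _ finite_lists_length_eq[of "{..<L}" "length ds"]]) (auto simp: S_def)
  have "S (d # ds) c = (\<Union>w\<in>{..<L}. Cons w ` S ds (c - int w * d))"
  proof (intro equalityI subsetI)
    fix ws assume ws: "ws \<in> S (d # ds) c"
    then obtain w ws' where "ws = w # ws'" by (cases ws) (auto simp: S_def)
    then have "w < L" "ws' \<in> S ds (c - int w * d)" using ws by (auto simp: S_def)
    then show "ws \<in> (\<Union>w\<in>{..<L}. Cons w ` S ds (c - int w * d))"
      using \<open>ws = w # ws'\<close> by blast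
  qed (auto simp: S_def)
  then have "card (S (d # ds) c) \<le> (\<Sum>w<L. card (Cons w ` S ds (c - int w * d)))"
    by (simp add: card_UN_le)
  also have "\<dots> \<le> (\<Sum>w<L. card (S ds (c - int w * d)))"
    by (intro sum_mono card_image_le fin)
  finally have le: "card (S (d # ds) c) \<le> (\<Sum>w<L. card (S ds (c - int w * d)))" .
  have "card (S (d # ds) c) * L \<le> L ^ length (d # ds)"
  proof (cases "\<exists>d\<in>set ds. d \<noteq> 0")
    case True
    have "card (S (d # ds) c) * L \<le> (\<Sum>w<L. card (S ds (c - int w * d)) * L)"
      using le by (simp add: sum_distrib_right[symmetric])
    also have "\<dots> \<le> (\<Sum>w<L. L ^ length ds)"
      using Cons.IH[OF True] by (intro sum_mono) (simp add: S_def)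
    finally show ?thesis by simp
  next
    case False
    then have "d \<noteq> 0" using Cons.prems by auto
    have S0: "card (S ds c') \<le> (if c' = 0 then L ^ length ds else 0)" for c'
    proof -
      have "S ds c' \<subseteq> (if c' = 0 then {ws. set ws \<subseteq> {..<L} \<and> length ws = length ds} else {})"
        using False by (auto simp: S_def dot_zero)
      moreover have "finite {ws. set ws \<subseteq> {..<L} \<and> length ws = length ds}"
        by (rule finite_lists_length_eq) simp
      ultimately have "card (S ds c') \<le> card (if c' = 0 then {ws. set ws \<subseteq> {..<L} \<and> length ws = length ds} else {})"
        by (intro card_mono) auto
      then show ?thesis by (auto simp: card_lists_length_eq split: if_splits)
    qed
    have "(\<Sum>w<L. card (S ds (c - int w * d))) \<le> (\<Sum>w<L. if c - int w * d = 0 then L ^ length ds else 0)"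
      by (intro sum_mono S0)
    also have "\<dots> = card {w\<in>{..<L}. c - int w * d = 0} * L ^ length ds"
      by (simp add: sum.inter_filter[symmetric])
    also have "\<dots> \<le> 1 * L ^ length ds"
    proof (intro mult_right_mono)
      have "w = w'" if "c - int w * d = 0" "c - int w' * d = 0" for w w' using that \<open>d \<noteq> 0\<close> by simp
      then have "\<exists>w0. {w\<in>{..<L}. c - int w * d = 0} \<subseteq> {w0}" by blast
      then show "card {w\<in>{..<L}. c - int w * d = 0} \<le> 1"
        by (metis card.empty card_insert_le_m1 card_mono finite.emptyI finite_insert is_singletonI is_singleton_altdef)
    qed simp
    finally have "card (S (d # ds) c) \<le> L ^ length ds" using le by simp
    then show ?thesis by (simp add: mult.commute)
  qed
  then show ?case by (simp add: S_def)
qed simp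

abbreviation (input) pr1 :: "'x \<times> 'y \<times> 'z \<Rightarrow> 'x" where "pr1 \<equiv> fst"
abbreviation (input) pr2 :: "'x \<times> 'y \<times> 'z \<Rightarrow> 'y" where "pr2 \<equiv> \<lambda>e. fst (snd e)"
abbreviation (input) pr3 :: "'x \<times> 'y \<times> 'z \<Rightarrow> 'z" where "pr3 \<equiv> \<lambda>e. snd (snd e)"

text \<open>Averaging over all \<open>L ^ n\<close> hashes: each pair in \<open>Coll\<close> is
  identified by at most one hash in \<open>L\<close>, so some hash identifies at most
  \<open>card Coll / L\<close> pairs, and this is at most \<open>card E / 2\<close>.\<close>

lemma few_hash_collisions:
  fixes \<delta> :: "'e \<Rightarrow> int"
  assumes fin: "finite E" and len: "\<And>es. es \<in> E \<Longrightarrow> length es = n"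
    and Coll: "Coll \<subseteq> E \<times> E"
    and diff: "\<And>es es'. (es, es') \<in> Coll \<Longrightarrow> map \<delta> es \<noteq> map \<delta> es'"
    and L: "2 * card Coll \<le> L * card E" "L \<ge> 1"
  shows "\<exists>ws. set ws \<subseteq> {..<L} \<and> length ws = n
    \<and> 2 * card {c\<in>Coll. dot ws (map \<delta> (fst c)) = dot ws (map \<delta> (snd c))} \<le> card E"
proof (rule ccontr)
  assume none: "\<not> ?thesis"
  define \<Omega> where "\<Omega> = {ws. set ws \<subseteq> {..<L} \<and> length ws = n}"
  have fin\<Omega>: "finite \<Omega>" unfolding \<Omega>_def by (rule finite_lists_length_eq) simp
  have card\<Omega>: "card \<Omega> = L ^ n" unfolding \<Omega>_def by (simp add: card_lists_length_eq)
  have finC: "finite Coll" using Coll fin by (meson finite_SigmaI finite_subset)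
  define eq where "eq ws c \<longleftrightarrow> dot ws (map \<delta> (fst c)) = dot ws (map \<delta> (snd c))" for ws c
  have "(\<Sum>ws\<in>\<Omega>. card E) < (\<Sum>ws\<in>\<Omega>. 2 * card {c\<in>Coll. eq ws c})"
  proof (rule sum_strict_mono)
    show "\<Omega> \<noteq> {}" using card\<Omega> L(2) by (metis card.empty not_one_le_zero power_eq_0_iff)
    fix ws assume "ws \<in> \<Omega>"
    then show "card E < 2 * card {c\<in>Coll. eq ws c}"
      using none unfolding \<Omega>_def eq_def by (auto simp: not_le)
  qed (rule fin\<Omega>)
  also have "\<dots> = 2 * (\<Sum>ws\<in>\<Omega>. \<Sum>c\<in>Coll. if eq ws c then 1 else 0)"
    by (simp add: sum_distrib_left sum.inter_filter[OF finC, symmetric])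
  also have "\<dots> = 2 * (\<Sum>c\<in>Coll. \<Sum>ws\<in>\<Omega>. if eq ws c then 1 else 0)"
    by (subst sum.swap) (rule refl)
  also have "\<dots> = 2 * (\<Sum>c\<in>Coll. card {ws\<in>\<Omega>. eq ws c})"
    by (simp add: sum.inter_filter[OF fin\<Omega>, symmetric])
  finally have less: "L ^ n * card E < 2 * (\<Sum>c\<in>Coll. card {ws\<in>\<Omega>. eq ws c})" by (simp add: card\<Omega>)
  have one: "card {ws\<in>\<Omega>. eq ws c} * L \<le> L ^ n" if "c \<in> Coll" for c
  proof -
    obtain es es' where c: "c = (es, es')" by force
    have E: "es \<in> E" "es' \<in> E" using that Coll c by auto
    define ds where "ds = map (\<lambda>p. \<delta> (fst p) - \<delta> (snd p)) (zip es es')"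
    have len_ds: "length ds = n" using len E by (simp add: ds_def)
    have "\<exists>d\<in>set ds. d \<noteq> 0"
    proof (rule ccontr)
      assume "\<not> ?thesis"
      then have "ds ! t = 0" if "t < n" for t using that len_ds by (metis nth_mem)
      then have "map \<delta> es = map \<delta> es'"
        using len E by (intro nth_equalityI) (auto simp: ds_def)
      then show False using diff that c by simp
    qed
    from card_linear_solutions[OF this L(2), of 0]
    have "card {ws. set ws \<subseteq> {..<L} \<and> length ws = length ds \<and> dot ws ds = 0} * L \<le> L ^ n" by (simp add: len_ds)
    moreover have "{ws\<in>\<Omega>. eq ws c} = {ws. set ws \<subseteq> {..<L} \<and> length ws = length ds \<and> dot ws ds = 0}"
    proof -
      have "map \<delta> es = map (\<lambda>p. \<delta> (fst p)) (zip es es')" "map \<delta> es' = map (\<lambda>p. \<delta> (snd p)) (zip es es')"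
        using len E by (auto intro!: nth_equalityI)
      then have "dot ws (map \<delta> es) - dot ws (map \<delta> es') = dot ws ds" for ws
        by (simp add: dot_diff ds_def)
      then have "eq ws c \<longleftrightarrow> dot ws ds = 0" for ws
        unfolding eq_def c by (metis eq_iff_diff_eq_0 fst_conv snd_conv)
      then show ?thesis unfolding \<Omega>_def len_ds by auto
    qed
    ultimately show ?thesis by simp
  qed
  have "2 * (\<Sum>c\<in>Coll. card {ws\<in>\<Omega>. eq ws c}) * L \<le> 2 * (\<Sum>c\<in>Coll. L ^ n)"
    using one sum_mono[of Coll "\<lambda>c. card {ws\<in>\<Omega>. eq ws c} * L" "\<lambda>_. L ^ n"]
    by (simp add: sum_distrib_right)
  also have "\<dots> \<le> L ^ n * (L * card E)" using L(1) by (simp add: mult.left_commute[of _ "L ^ n"] del: mult_le_cancel1)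
  finally have "2 * (\<Sum>c\<in>Coll. card {ws\<in>\<Omega>. eq ws c}) * L \<le> (L ^ n * card E) * L" by (simp add: ac_simps)
  then show False using less L(2) by simp
qed

text \<open>
  Strassen's lower bound for a face \<open>\<Phi>\<close> of the support that is tight with respect to
  \<open>\<alpha>\<close>, \<open>\<beta>\<close>, \<open>\<gamma>\<close>.  After fixing the type of each factor, a random integer hash of
  \<open>\<alpha> - \<beta>\<close> isolates most triples; its level sets are cut out by the degeneration with weights
  \<open>2 (U - c)^2 + 2 V^2 - (U + V - c)^2 = (U - V - c)^2\<close>.
\<close>

lemma tight_lower_bound:
  fixes T :: "'a::field tensor3" and u v w \<alpha> \<beta> \<gamma> :: "nat \<Rightarrow> int" and C :: nat
  assumes fin: "finite \<Phi>" and bnd: "\<And>a b c. (a, b, c) \<in> \<Phi> \<Longrightarrow> a < n1 \<and> b < n2 \<and> c < n3 \<and> T a b c \<noteq> 0"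
    and face0: "\<And>a b c. (a, b, c) \<in> \<Phi> \<Longrightarrow> u a + v b + w c = 0"
    and face: "\<And>a b c. a < n1 \<Longrightarrow> b < n2 \<Longrightarrow> c < n3 \<Longrightarrow> T a b c \<noteq> 0 \<Longrightarrow>
      0 \<le> u a + v b + w c \<and> (u a + v b + w c = 0 \<longrightarrow> (a, b, c) \<in> \<Phi>)"
    and tight: "\<And>a b c. (a, b, c) \<in> \<Phi> \<Longrightarrow> \<alpha> a + \<beta> b + \<gamma> c = 0"
    and inj: "inj_on \<alpha> {..<n1}" "inj_on \<beta> {..<n2}" "inj_on \<gamma> {..<n3}"
    and C: "\<And>a b c. (a, b, c) \<in> \<Phi> \<Longrightarrow> \<bar>\<alpha> a - \<beta> b\<bar> \<le> int C" "C \<ge> 1"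
    and es0: "set es0 \<subseteq> \<Phi>" "es0 \<noteq> []"
    and m: "m \<le> card (permutations_of_multiset (mset (map pr1 es0)))"
       "m \<le> card (permutations_of_multiset (mset (map pr2 es0)))"
       "m \<le> card (permutations_of_multiset (mset (map pr3 es0)))"
  shows "real m \<le> 42 * length es0 * C * asymptotic_subrank n1 n2 n3 T ^ length es0"
proof (cases "m = 0")
  case True
  have "nonzero_on n1 n2 n3 T" using es0 bnd unfolding nonzero_on_def
    by (cases es0) (auto, meson)
  from asymptotic_subrank_ge_1[OF this] True show ?thesis by simp
next
  case False
  define n where "n = length es0"
  have n1: "n \<ge> 1" using es0 by (cases es0) (auto simp: n_def)
  have nzo: "nonzero_on n1 n2 n3 T" using es0 bnd unfolding nonzero_on_def
    by (cases es0) (auto, meson)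
  define M1 M2 M3 where M: "M1 = mset (map pr1 es0)" "M2 = mset (map pr2 es0)" "M3 = mset (map pr3 es0)"
  have sizeM: "size M1 = n" "size M2 = n" "size M3 = n" by (simp_all add: M n_def)
  define E where "E = {es. set es \<subseteq> \<Phi> \<and> mset (map pr1 es) = M1 \<and> mset (map pr2 es) = M2 \<and> mset (map pr3 es) = M3}"
  have len: "length es = n" if "es \<in> E" for es
    using that sizeM(1) unfolding E_def by (metis (mono_tags, lifting) length_map mem_Collect_eq size_mset)
  have finE: "finite E"
    by (rule finite_subset[OF _ finite_lists_length_eq[OF fin, of n]]) (use len in \<open>auto simp: E_def\<close>)
  have E\<Phi>: "set es \<subseteq> \<Phi>" if "es \<in> E" for es using that by (simp add: E_def)
  have nth\<Phi>: "es ! t \<in> \<Phi>" if "es \<in> E" "t < n" for es t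
    using E\<Phi>[OF that(1)] nth_mem[of t es] len[OF that(1)] that(2) by auto
  have es0E: "es0 \<in> E" using es0 by (simp add: E_def M)
  define N where "N = card E"
  have N1: "N \<ge> 1" using es0E finE unfolding N_def by (metis One_nat_def Suc_leI card_gt_0_iff empty_iff)
  have closed: "permute_list \<pi> es \<in> E" if "\<pi> permutes {..<n}" "es \<in> E" for \<pi> es
    using that len[OF that(2)] unfolding E_def by (simp add: permute_list_map[symmetric])
  have regular: "card {es\<in>E. map p es = map p es'} * card (permutations_of_multiset (mset (map p es0))) = N"
    if "\<And>es. es \<in> E \<Longrightarrow> mset (map p es) = mset (map p es0)" "es' \<in> E" for p :: "nat \<times> nat \<times> nat \<Rightarrow> nat" and es'
    unfolding N_def using that by (intro fiber_card_regular finE closed) (auto simp: n_def)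
  \<comment> \<open>Pairs of words that agree in one projection obstruct a matching.
    \<open>Share\<close> bounds their number: by regularity a fibre has size \<open>N\<close>
    divided by the number of words of the given type, hence at most \<open>N / m\<close>.\<close>
  define Coll where "Coll = {(es, es')\<in>E \<times> E. es \<noteq> es' \<and>
    (map pr1 es = map pr1 es' \<or> map pr2 es = map pr2 es' \<or> map pr3 es = map pr3 es')}"
  define Share where "Share p = (SIGMA es:E. {es'\<in>E. map p es' = map p es})" for p :: "nat \<times> nat \<times> nat \<Rightarrow> nat"
  have finS: "finite (Share p)" for p unfolding Share_def using finE by auto
  have share: "card (Share p) * m \<le> N * N"
    if "\<And>es. es \<in> E \<Longrightarrow> mset (map p es) = mset (map p es0)" "m \<le> card (permutations_of_multiset (mset (map p es0)))" for p
  proof -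
    have "card (Share p) = (\<Sum>es\<in>E. card {es'\<in>E. map p es' = map p es})"
      unfolding Share_def using finE by (intro card_SigmaI) auto
    then have "card (Share p) * m = (\<Sum>es\<in>E. card {es'\<in>E. map p es' = map p es} * m)"
      by (simp add: sum_distrib_right)
    also have "\<dots> \<le> (\<Sum>es\<in>E. N)"
    proof (intro sum_mono)
      fix es assume es: "es \<in> E"
      have "card {es'\<in>E. map p es' = map p es} * m
          \<le> card {es'\<in>E. map p es' = map p es} * card (permutations_of_multiset (mset (map p es0)))"
        using that(2) by simp
      also have "\<dots> = N" by (rule regular[OF that(1) es])
      finally show "card {es'\<in>E. map p es' = map p es} * m \<le> N" .
    qed
    also have "\<dots> = N * N" by (simp add: N_def)
    finally show ?thesis .
  qed
  have EM: "mset (map pr1 es) = mset (map pr1 es0)" "mset (map pr2 es) = mset (map pr2 es0)"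
    "mset (map pr3 es) = mset (map pr3 es0)" if "es \<in> E" for es using that by (simp_all only: E_def M mem_Collect_eq)
  have "card Coll * m \<le> 3 * (N * N)"
  proof -
    have "Coll \<subseteq> Share pr1 \<union> Share pr2 \<union> Share pr3" by (auto simp: Coll_def Share_def)
    then have "card Coll \<le> card (Share pr1 \<union> Share pr2 \<union> Share pr3)" by (intro card_mono finite_UnI finS)
    also have "\<dots> \<le> card (Share pr1) + card (Share pr2) + card (Share pr3)"
      by (meson add_le_mono1 card_Un_le le_trans)
    finally have "card Coll * m \<le> card (Share pr1) * m + card (Share pr2) * m + card (Share pr3) * m"
      by (metis add_mult_distrib mult_le_mono1)
    also have "\<dots> \<le> N * N + N * N + N * N" using m by (intro add_mono share EM)
    finally show ?thesis by simp
  qed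
  have mN: "m \<le> N"
  proof -
    have "card {es\<in>E. map pr1 es = map pr1 es0} \<noteq> 0" using es0E finE by auto
    then have "1 * card (permutations_of_multiset (mset (map pr1 es0)))
        \<le> card {es\<in>E. map pr1 es = map pr1 es0} * card (permutations_of_multiset (mset (map pr1 es0)))"
      by (intro mult_le_mono1) simp
    also have "\<dots> = N" by (rule regular[OF EM(1) es0E])
    finally have "card (permutations_of_multiset (mset (map pr1 es0))) \<le> N" by simp
    then show ?thesis using m(1) by simp
  qed
  \<comment> \<open>Large enough for \<open>2 * card Coll \<le> L * N\<close>, given
    \<open>card Coll * m \<le> 3 * (N * N)\<close>, and small enough that a level of the hash still
    holds about \<open>m\<close> words, up to factors linear in \<open>n\<close> and
    \<open>C\<close>.\<close>
  define L where "L = 6 * N div m + 1"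
  have L1: "L \<ge> 1" by (simp add: L_def)
  have Lm: "6 * N \<le> L * m"
    using mod_less_divisor[of m "6 * N"] div_mult_mod_eq[of "6 * N" m] False
    unfolding L_def add_mult_distrib by linarith
  have Lm': "L * m \<le> 7 * N"
    using div_times_less_eq_dividend[of "6 * N" m] mN unfolding L_def add_mult_distrib by linarith
  define \<delta> where "\<delta> e = \<alpha> (pr1 e) - \<beta> (pr2 e)" for e :: "nat \<times> nat \<times> nat"
  \<comment> \<open>A shared coordinate and an equal difference of \<open>\<alpha>\<close> and
    \<open>\<beta>\<close> determine all three values; if the third coordinate is shared, both the
    sum and the difference of \<open>\<alpha>\<close> and \<open>\<beta>\<close> agree.\<close>
  have eqI: "e = e'" if "e \<in> \<Phi>" "e' \<in> \<Phi>" "\<delta> e = \<delta> e'" "pr1 e = pr1 e' \<or> pr2 e = pr2 e' \<or> pr3 e = pr3 e'" for e e'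
  proof -
    obtain a b c a' b' c' where e: "e = (a, b, c)" "e' = (a', b', c')" by (metis prod_cases3)
    have t: "\<alpha> a + \<beta> b + \<gamma> c = 0" "\<alpha> a' + \<beta> b' + \<gamma> c' = 0" "\<alpha> a - \<beta> b = \<alpha> a' - \<beta> b'"
      using tight that e by (auto simp: \<delta>_def)
    have "a = a' \<or> b = b' \<or> c = c'" using that(4) e by simp
    then have "\<alpha> a = \<alpha> a' \<and> \<beta> b = \<beta> b' \<and> \<gamma> c = \<gamma> c'" using t by auto
    then show ?thesis using inj bnd that(1,2) e by (auto simp: inj_on_def)
  qed
  have collD: "map \<delta> es \<noteq> map \<delta> es'" if "(es, es') \<in> Coll" for es es'
  proof
    assume eq: "map \<delta> es = map \<delta> es'"
    have E: "es \<in> E" "es' \<in> E" and ne: "es \<noteq> es'" and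
      sh: "map pr1 es = map pr1 es' \<or> map pr2 es = map pr2 es' \<or> map pr3 es = map pr3 es'"
      using that by (auto simp: Coll_def)
    have "es ! t = es' ! t" if t: "t < n" for t
    proof (rule eqI)
      show "es ! t \<in> \<Phi>" "es' ! t \<in> \<Phi>" using E t by (auto intro: nth\<Phi>)
      show "\<delta> (es ! t) = \<delta> (es' ! t)" using eq t len E by (metis nth_map)
      show "pr1 (es ! t) = pr1 (es' ! t) \<or> pr2 (es ! t) = pr2 (es' ! t) \<or> pr3 (es ! t) = pr3 (es' ! t)"
        using sh t len E by (metis (no_types, lifting) nth_map)
    qed
    then show False using ne E len by (auto intro: nth_equalityI)
  qed
  have "2 * card Coll \<le> L * N"
  proof -
    have "2 * card Coll * m \<le> 6 * N * N" using \<open>card Coll * m \<le> 3 * (N * N)\<close> by linarith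
    also have "\<dots> \<le> (L * N) * m" using mult_le_mono1[OF Lm, of N] by (simp add: ac_simps)
    finally show ?thesis using False by simp
  qed
  then obtain ws where ws: "set ws \<subseteq> {..<L}" "length ws = n"
    "2 * card {c\<in>Coll. dot ws (map \<delta> (fst c)) = dot ws (map \<delta> (snd c))} \<le> N"
    using few_hash_collisions[OF finE len _ collD, of Coll L] L1 unfolding N_def
    by (auto simp: Coll_def)
  define H where "H es = dot ws (map \<delta> es)" for es
  define Cw where "Cw = {c\<in>Coll. H (fst c) = H (snd c)}"
  have finCw: "finite Cw" unfolding Cw_def Coll_def
    by (rule finite_subset[of _ "E \<times> E"]) (use finE in auto)
  \<comment> \<open>Words that the chosen hash identifies with no colliding word; at least half of
    \<open>E\<close> remains.\<close>
  define G where "G = E - fst ` Cw"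
  have "N \<le> card G + card Cw"
  proof -
    have "N \<le> card (G \<union> fst ` Cw)" unfolding N_def G_def using finE finCw by (intro card_mono) auto
    also have "\<dots> \<le> card G + card (fst ` Cw)" by (rule card_Un_le)
    also have "\<dots> \<le> card G + card Cw" using card_image_le[OF finCw] by simp
    finally show ?thesis .
  qed
  then have G2: "N \<le> 2 * card G" using ws(3) unfolding Cw_def H_def by linarith
  define V where "V = {- int (n * (L * C)) .. int (n * (L * C))}"
  have "H ` G \<subseteq> V"
  proof (intro subsetI, elim imageE)
    fix x es assume x: "x = H es" "es \<in> G"
    have "\<bar>H es\<bar> \<le> int (length ws * (L * C))" unfolding H_def
      using x(2) C(1) by (intro dot_bound ws(1)) (auto simp: G_def E_def \<delta>_def)
    then show "x \<in> V" using x ws(2) by (simp add: V_def abs_le_iff)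
  qed
  then obtain c where "card G \<le> card V * card {es\<in>G. H es = c}"
    using pigeonhole_fiber[of V G H] finE by (auto simp: V_def G_def)
  moreover define P where "P = {es\<in>G. H es = c}"
  ultimately have GP: "card G \<le> card V * card P" by simp
  have "card V = 2 * (n * (L * C)) + 1" by (simp add: V_def nat_add_distrib nat_mult_distrib)
  also have "\<dots> \<le> 3 * (n * (L * C))" using n1 L1 C(2) by simp
  finally have "card V * card P \<le> 3 * (n * (L * C)) * card P" by (rule mult_le_mono1)
  then have "N \<le> 6 * (n * (L * C)) * card P" using G2 GP by linarith
  then have "N * m \<le> 6 * (n * (L * C)) * card P * m" by simp
  \<comment> \<open>The constant 42 is 6 times 7: at least half of \<open>E\<close> is spread over
    at most \<open>3 * n * L * C\<close> hash values, and \<open>L * m \<le> 7 * N\<close>.\<close>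
  also have "\<dots> = 6 * n * C * card P * (L * m)" by (simp add: ac_simps)
  also have "\<dots> \<le> 6 * n * C * card P * (7 * N)" using Lm' by (rule mult_le_mono2)
  finally have "m \<le> 42 * n * C * card P" using N1 by (simp add: ac_simps)
  moreover have "card P \<le> asymptotic_subrank n1 n2 n3 T ^ n"
  proof (cases "P = {}")
    case True
    then show ?thesis using asymptotic_subrank_ge_1[OF nzo] by simp
  next
    case Pne: False
    define U where "U es = dot ws (map (\<lambda>e. \<alpha> (pr1 e)) es)" for es :: "(nat \<times> nat \<times> nat) list"
    define V where "V es = dot ws (map (\<lambda>e. \<beta> (pr2 e)) es)" for es :: "(nat \<times> nat \<times> nat) list"
    define W where "W es = dot ws (map (\<lambda>e. \<gamma> (pr3 e)) es)" for es :: "(nat \<times> nat \<times> nat) list"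
    have UV: "U es - V es = H es" for es unfolding U_def V_def H_def \<delta>_def by (rule dot_diff)
    have UVW: "U es + V es + W es = 0" if "es \<in> E" for es
      unfolding U_def V_def W_def dot_add
    proof (rule dot_zero, intro ballI)
      fix d assume "d \<in> set (map (\<lambda>e. \<alpha> (pr1 e) + \<beta> (pr2 e) + \<gamma> (pr3 e)) es)"
      then show "d = 0" using E\<Phi>[OF that] tight by auto
    qed
    have PE: "P \<subseteq> E" by (auto simp: P_def G_def)
    have sets: "set (map pr1 es) \<subseteq> {..<n1}" "set (map pr2 es) \<subseteq> {..<n2}" "set (map pr3 es) \<subseteq> {..<n3}" if "es \<in> E" for es
      using E\<Phi>[OF that] bnd by auto
    \<comment> \<open>All three types are those of \<open>es0\<close>, so a triple in the support of the power lies in the face.\<close>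
    have joint: "\<exists>es\<in>E. map pr1 es = map pr1 p \<and> map pr2 es = map pr2 q \<and> map pr3 es = map pr3 s"
      if E: "p \<in> E" "q \<in> E" "s \<in> E"
        and nz: "tensor_kron_power n1 n2 n3 T n (enc n1 (map pr1 p)) (enc n2 (map pr2 q)) (enc n3 (map pr3 s)) \<noteq> 0" for p q s
    proof -
      have "tensor_kron_power n1 n2 n3 T n (enc n1 (map pr1 p)) (enc n2 (map pr2 q)) (enc n3 (map pr3 s))
        = (\<Prod>t<n. T (pr1 (p ! t)) (pr2 (q ! t)) (pr3 (s ! t)))"
        using tensor_kron_power_enc[of "map pr1 p" "map pr2 q" "map pr3 s" n1 n2 n3 T] E sets len by simp
      then have nzt: "T (pr1 (p ! t)) (pr2 (q ! t)) (pr3 (s ! t)) \<noteq> 0" if "t < n" for t using nz that by simp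
      have lt: "pr1 (p ! t) < n1" "pr2 (q ! t) < n2" "pr3 (s ! t) < n3" if "t < n" for t
        using sets E len that by (auto simp: subset_iff)
      have sum_eq: "(\<Sum>t<n. f (p (es ! t))) = (\<Sum>t<n. f (p (es' ! t)))"
        if "mset (map p es) = mset (map p es')" "length es = n" "length es' = n"
        for f :: "nat \<Rightarrow> int" and p :: "nat \<times> nat \<times> nat \<Rightarrow> nat" and es es'
      proof -
        have "(\<Sum>t<n. f (p (es ! t))) = sum_mset (image_mset f (mset (map p es)))" if "length es = n" for es
        proof -
          have "sum_mset (image_mset f (mset (map p es))) = sum_list (map (\<lambda>e. f (p e)) es)"
            by (simp add: sum_mset_sum_list[symmetric] multiset.map_comp o_def del: sum_mset_sum_list)
          also have "\<dots> = (\<Sum>t<n. f (p (es ! t)))"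
            using that by (simp add: sum_list_sum_nth lessThan_atLeast0)
          finally show ?thesis ..
        qed
        then show ?thesis using that by metis
      qed
      have "(\<Sum>t<n. u (pr1 (p ! t)) + v (pr2 (q ! t)) + w (pr3 (s ! t)))
          = (\<Sum>t<n. u (pr1 (es0 ! t)) + v (pr2 (es0 ! t)) + w (pr3 (es0 ! t)))"
        unfolding sum.distrib
        using sum_eq[of pr1 p es0 u] sum_eq[of pr2 q es0 v] sum_eq[of pr3 s es0 w] EM E len es0E by metis
      also have "\<dots> = 0"
      proof (intro sum.neutral ballI)
        fix t assume "t \<in> {..<n}"
        then have "es0 ! t \<in> \<Phi>" using nth\<Phi>[OF es0E] by simp
        then show "u (pr1 (es0 ! t)) + v (pr2 (es0 ! t)) + w (pr3 (es0 ! t)) = 0"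
          using face0 by (metis prod.collapse)
      qed
      finally have "\<forall>t\<in>{..<n}. u (pr1 (p ! t)) + v (pr2 (q ! t)) + w (pr3 (s ! t)) = 0"
        using face[OF lt nzt] by (subst (asm) sum_nonneg_eq_0_iff) auto
      then have \<Phi>: "(pr1 (p ! t), pr2 (q ! t), pr3 (s ! t)) \<in> \<Phi>" if "t < n" for t
        using face[OF lt nzt] that by simp
      define es where "es = map (\<lambda>t. (pr1 (p ! t), pr2 (q ! t), pr3 (s ! t))) [0..<n]"
      have map_es: "map pr1 es = map pr1 p" "map pr2 es = map pr2 q" "map pr3 es = map pr3 s"
        using len E by (auto simp: es_def intro!: nth_equalityI)
      moreover have "es \<in> E" unfolding E_def mem_Collect_eq map_es
        using E \<Phi> by (auto simp: E_def es_def)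
      ultimately show ?thesis by blast
    qed
    have isolated: "es = p" if "es \<in> E" "p \<in> P" "H es = c"
      "map pr1 es = map pr1 p \<or> map pr2 es = map pr2 p \<or> map pr3 es = map pr3 p" for es p
    proof (rule ccontr)
      assume "es \<noteq> p"
      then have "(p, es) \<in> Coll" using that PE unfolding Coll_def by auto
      then have "(p, es) \<in> Cw" using that by (auto simp: Cw_def P_def)
      then have "p \<notin> G" unfolding G_def by force
      then show False using that by (simp add: P_def)
    qed
    have quad: "2 * (U p - c)\<^sup>2 + 2 * (V q)\<^sup>2 + - (W s + c)\<^sup>2 = (H es - c)\<^sup>2"
      if "es \<in> E" "map pr1 es = map pr1 p" "map pr2 es = map pr2 q" "map pr3 es = map pr3 s" for es p q s
    proof -
      have eq: "U p = U es" "V q = V es" "W s = W es"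
        using arg_cong[OF that(2), of "map \<alpha>"] arg_cong[OF that(3), of "map \<beta>"] arg_cong[OF that(4), of "map \<gamma>"]
        by (simp_all add: U_def V_def W_def o_def)
      have W: "W es = - U es - V es" using UVW[OF that(1)] by simp
      show ?thesis unfolding UV[symmetric] eq W by (simp add: power2_eq_square algebra_simps)
    qed
    \<comment> \<open>A triple in the support of the \<open>n\<close>-th power is made of the
      projections of one word \<open>es\<close>, and its weight is the square of
      \<open>H es - c\<close>. Weight zero therefore means hash value \<open>c\<close>, where the
      words of \<open>P\<close> are isolated.\<close>
    have "card P \<le> asymptotic_subrank (n1 ^ n) (n2 ^ n) (n3 ^ n) (tensor_kron_power n1 n2 n3 T n)"
    proof (rule asymptotic_subrank_ge_matching[of _ "\<lambda>es. enc n1 (map pr1 es)" _ "\<lambda>es. enc n2 (map pr2 es)" _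
          "\<lambda>es. enc n3 (map pr3 es)" _ _ "\<lambda>es. 2 * (U es - c)\<^sup>2" "\<lambda>es. 2 * (V es)\<^sup>2" "\<lambda>es. - (W es + c)\<^sup>2"])
      show "finite P" using PE finE by (rule finite_subset)
      show "P \<noteq> {}" by (rule Pne)
      fix p assume p: "p \<in> P"
      then have pE: "p \<in> E" using PE by auto
      show "enc n1 (map pr1 p) < n1 ^ n \<and> enc n2 (map pr2 p) < n2 ^ n \<and> enc n3 (map pr3 p) < n3 ^ n"
        using enc_less[OF sets(1)[OF pE]] enc_less[OF sets(2)[OF pE]] enc_less[OF sets(3)[OF pE]] len[OF pE] by simp
      have "T (pr1 (p ! t)) (pr2 (p ! t)) (pr3 (p ! t)) \<noteq> 0" if "t < n" for t
      proof -
        have "p ! t \<in> \<Phi>" using pE that by (rule nth\<Phi>)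
        then show ?thesis using bnd by (metis prod.collapse)
      qed
      then show "tensor_kron_power n1 n2 n3 T n (enc n1 (map pr1 p)) (enc n2 (map pr2 p)) (enc n3 (map pr3 p)) \<noteq> 0"
        using tensor_kron_power_enc[of "map pr1 p" "map pr2 p" "map pr3 p" n1 n2 n3 T] sets[OF pE] len[OF pE] by simp
      show "2 * (U p - c)\<^sup>2 + 2 * (V p)\<^sup>2 + - (W p + c)\<^sup>2 = 0"
        using quad[OF pE refl refl refl] p by (simp add: P_def)
      fix q s assume qs: "q \<in> P" "s \<in> P"
        and nz: "tensor_kron_power n1 n2 n3 T n (enc n1 (map pr1 p)) (enc n2 (map pr2 q)) (enc n3 (map pr3 s)) \<noteq> 0"
      obtain es where es: "es \<in> E" "map pr1 es = map pr1 p" "map pr2 es = map pr2 q" "map pr3 es = map pr3 s"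
        using joint[OF pE _ _ nz] qs PE by blast
      show "0 \<le> 2 * (U p - c)\<^sup>2 + 2 * (V q)\<^sup>2 + - (W s + c)\<^sup>2" unfolding quad[OF es] by simp
      assume "2 * (U p - c)\<^sup>2 + 2 * (V q)\<^sup>2 + - (W s + c)\<^sup>2 = 0"
      then have "H es = c" unfolding quad[OF es] by simp
      then show "p = q \<and> q = s" using isolated[OF es(1)] es p qs by metis
    qed
    then show ?thesis unfolding asymptotic_subrank_power[OF nzo n1] .
  qed
  ultimately have "real m \<le> 42 * n * C * card P" "card P \<le> asymptotic_subrank n1 n2 n3 T ^ n"
    using of_nat_mono[of m "42 * n * C * card P", where 'a = real] by simp_all
  then have "real m \<le> 42 * n * C * (asymptotic_subrank n1 n2 n3 T ^ n)"
    using mult_left_mono[of "real (card P)" "asymptotic_subrank n1 n2 n3 T ^ n" "42 * real n * real C"] by simp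
  then show ?thesis unfolding n_def by simp
qed

section \<open>Entropy estimates\<close>

text \<open>Divided by \<open>n ^ n\<close> these are the binomial probabilities with success rate
  \<open>k / n\<close>, whose mode is \<open>k\<close>. Consecutive terms are compared through the
  cross-multiplied ratio \<open>step\<close>.\<close>

lemma binomial_mode:
  fixes n k j :: nat
  assumes "k \<le> n" "j \<le> n"
  shows "(n choose j) * k ^ j * (n - k) ^ (n - j) \<le> (n choose k) * k ^ k * (n - k) ^ (n - k)"
proof -
  define t where "t j = (n choose j) * k ^ j * (n - k) ^ (n - j)" for j
  have step: "Suc j * (n - k) * t (Suc j) = (n - j) * k * t j" if "j < n" for j
  proof -
    obtain n' where n: "n = Suc n'" using \<open>j < n\<close> by (cases n) auto
    have "Suc j * (n choose Suc j) = n * (n' choose j)"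
      using Suc_times_binomial_eq[of n' j] unfolding n by (metis mult.commute)
    also have "\<dots> = (n - j) * (n choose j)" using binomial_absorb_comp[of n j] n by simp
    finally have 1: "Suc j * (n choose Suc j) = (n - j) * (n choose j)" .
    have 2: "(n - k) * (n - k) ^ (n - Suc j) = (n - k) ^ (n - j)"
      using that by (metis Suc_diff_Suc power_Suc)
    have "Suc j * (n - k) * t (Suc j)
        = (Suc j * (n choose Suc j)) * (k * k ^ j) * ((n - k) * (n - k) ^ (n - Suc j))"
      by (simp only: t_def power_Suc ac_simps)
    also have "\<dots> = (n - j) * k * t j" unfolding 1 2 by (simp only: t_def ac_simps)
    finally show ?thesis .
  qed
  have up: "t (Suc j) \<le> t j" if "k \<le> j" "j < n" for j
  proof -
    have "(n - j) * k \<le> Suc j * (n - k)"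
      unfolding mult.commute[of "Suc j"] using that by (intro mult_le_mono) auto
    then have "Suc j * (n - k) * t (Suc j) \<le> Suc j * (n - k) * t j"
      unfolding step[OF that(2)] by (rule mult_le_mono1)
    then show ?thesis using that by simp
  qed
  have down: "t j \<le> t (Suc j)" if "Suc j \<le> k" for j
  proof -
    have "Suc j * (n - k) \<le> (n - j) * k"
      unfolding mult.commute[of "Suc j"] using that by (intro mult_le_mono) auto
    then have "(n - j) * k * t j \<le> (n - j) * k * t (Suc j)"
      using step[of j] that assms mult_le_mono1[of "Suc j * (n - k)" "(n - j) * k" "t (Suc j)"] by simp
    then show ?thesis using that assms by simp
  qed
  show ?thesis
  proof (cases "k \<le> j")
    case True
    from this assms(2) have "t j \<le> t k"
      by (induction j rule: dec_induct) (auto intro: order_trans[OF up])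
    then show ?thesis by (simp add: t_def)
  next
    case False
    then have "j \<le> k" by simp
    then have "t j \<le> t k"
      by (induction j rule: inc_induct) (auto intro: order_trans[OF down])
    then show ?thesis by (simp add: t_def)
  qed
qed

text \<open>The expansion of \<open>(k + (n - k)) ^ n\<close> has \<open>n + 1\<close> terms, and
  the \<open>k\<close>-th is the largest.\<close>

lemma powr_entropy_le_binomial:
  assumes "0 < k" "k < n"
  shows "2 powr (n * binary_entropy (k / n)) \<le> (n + 1) * real (n choose k)"
proof -
  have "n ^ n = (\<Sum>j\<le>n. (n choose j) * k ^ j * (n - k) ^ (n - j))"
    using binomial[of k "n - k" n] assms by simp
  also have "\<dots> \<le> (\<Sum>j\<le>n. (n choose k) * k ^ k * (n - k) ^ (n - k))"
    using assms by (intro sum_mono binomial_mode) auto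
  finally have "n ^ n \<le> (n + 1) * (n choose k) * (k ^ k * (n - k) ^ (n - k))" by (simp add: algebra_simps)
  then have "real (n ^ n) \<le> real ((n + 1) * (n choose k) * (k ^ k * (n - k) ^ (n - k)))" by (rule of_nat_mono)
  then have le: "real n ^ n \<le> (n + 1) * real (n choose k) * (real k ^ k * real (n - k) ^ (n - k))"
    by (simp only: of_nat_mult of_nat_power of_nat_add of_nat_1)
  have p: "2 powr (- (real j * log 2 (j / n))) = real n ^ j / real j ^ j" if "0 < j" for j :: nat
  proof -
    have "2 powr (- (real j * log 2 (j / n))) = 2 powr (log 2 (n / j) * j)"
      using that assms by (simp add: log_divide algebra_simps)
    also have "\<dots> = (n / j) powr j" unfolding powr_powr[symmetric] using that assms by simp
    finally show ?thesis using that assms by (simp add: powr_realpow power_divide)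
  qed
  have "1 - real k / n = real (n - k) / n" using assms by (simp add: field_simps)
  then have "n * binary_entropy (k / n) = n * (- (k / n) * log 2 (k / n) - real (n - k) / n * log 2 (real (n - k) / n))"
    unfolding binary_entropy_def by simp
  also have "\<dots> = - (real k * log 2 (k / n)) + - (real (n - k) * log 2 (real (n - k) / n))"
    using assms by (simp only: right_diff_distrib) simp
  finally have "n * binary_entropy (k / n) = - (real k * log 2 (k / n)) + - (real (n - k) * log 2 (real (n - k) / n))" .
  then have "2 powr (n * binary_entropy (k / n))
      = real n ^ k / real k ^ k * (real n ^ (n - k) / real (n - k) ^ (n - k))"
    using assms by (simp only: powr_add p zero_less_diff)
  also have "\<dots> = real n ^ n / (real k ^ k * real (n - k) ^ (n - k))"
    using assms by (simp add: power_add[symmetric])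
  also have "\<dots> \<le> (n + 1) * real (n choose k)"
    using le assms by (subst pos_divide_le_eq) auto
  finally show ?thesis by (simp add: add.commute)
qed

lemma binary_entropy_half: "binary_entropy (1 / 2) = 1"
  by (simp add: binary_entropy_def log_divide)

text \<open>The multinomial coefficient is split into two binomials to fit the chain rule for
  entropies. A multiplicity may be zero, which covers words in two letters.\<close>

lemma card_permutations_three:
  assumes "x \<noteq> y" "y \<noteq> z" "x \<noteq> z"
  shows "card (permutations_of_multiset (replicate_mset a x + replicate_mset b y + replicate_mset c z))
    = (a + b + c choose (b + c)) * (b + c choose b)"
proof -
  define M where "M = replicate_mset a x + replicate_mset b y + replicate_mset c z"
  have "(\<Prod>i\<in>set_mset M. fact (count M i)) = (\<Prod>i\<in>{x, y, z}. fact (count M i) :: nat)"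
    by (rule prod.mono_neutral_left) (auto simp: M_def not_in_iff split: if_splits)
  also have "\<dots> = fact a * fact b * fact c" using assms by (simp add: M_def)
  finally have prod: "(\<Prod>i\<in>set_mset M. fact (count M i)) = (fact a * fact b * fact c :: nat)" .
  have "fact (a + b + c) = (fact (size M) :: nat)" by (simp add: M_def)
  also have "\<dots> = fact a * fact b * fact c * card (permutations_of_multiset M)"
    using card_permutations_of_multiset_aux[of M] unfolding prod by (simp only: mult.commute)
  finally have "fact (a + b + c) = fact a * fact b * fact c * card (permutations_of_multiset M)" .
  moreover have "fact (a + b + c) = fact (b + c) * fact a * (a + b + c choose (b + c))"
    using binomial_fact_lemma[of "b + c" "a + b + c"] by (simp add: add.assoc)
  moreover have "fact (b + c) = fact b * fact c * (b + c choose b)"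
    using binomial_fact_lemma[of b "b + c"] by simp
  ultimately have "fact a * fact b * fact c * card (permutations_of_multiset M)
      = fact a * fact b * fact c * ((a + b + c choose (b + c)) * (b + c choose b))"
    by (simp add: ac_simps)
  then show ?thesis unfolding M_def by simp
qed

text \<open>By the chain rule the exponent is \<open>n\<close> times the entropy of the distribution
  \<open>(1 - p/n, (p - q)/n, q/n)\<close>.\<close>

lemma powr_entropy_le_trinomial:
  assumes "0 < q" "q < p" "p < n"
  shows "2 powr (n * binary_entropy (p / n) + p * binary_entropy (q / p))
    \<le> (n + 1)\<^sup>2 * real ((n choose p) * (p choose q))"
proof -
  have "2 powr (n * binary_entropy (p / n) + p * binary_entropy (q / p))
      \<le> ((n + 1) * real (n choose p)) * ((p + 1) * real (p choose q))"
    unfolding powr_add using powr_entropy_le_binomial[of p n] powr_entropy_le_binomial[of q p] assms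
    by (intro mult_mono) (simp_all add: add.commute)
  also have "\<dots> \<le> ((n + 1) * real (n choose p)) * ((n + 1) * real (p choose q))"
    using assms by (intro mult_left_mono mult_right_mono) auto
  finally show ?thesis by (simp add: power2_eq_square ac_simps)
qed

text \<open>Logarithms divided by \<open>N k\<close> make the polynomial factors disappear. A
  convergent sequence \<open>e\<close> takes the place of a fixed exponent because the types of
  finite words only approximate a real distribution.\<close>

lemma entropy_lower_bound_limit:
  fixes N m :: "nat \<Rightarrow> nat" and e :: "nat \<Rightarrow> real" and Q l :: real and C :: nat
  assumes N: "filterlim N at_top sequentially" and e: "e \<longlonglongrightarrow> l"
    and Q: "Q \<ge> 1" and C: "C \<ge> 1"
    and ev: "eventually (\<lambda>k. 2 powr (N k * e k) \<le> (real (N k) + 1)\<^sup>2 * real (m k)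
      \<and> real (m k) \<le> real (42 * N k * C) * Q ^ N k) sequentially"
  shows "2 powr l \<le> Q"
proof -
  define err where "err n = (log 2 (42 * C) + 3 * log 2 (real n + 1)) / n" for n :: nat
  have "err \<longlonglongrightarrow> 0" unfolding err_def by real_asymp
  then have "(\<lambda>k. err (N k)) \<longlonglongrightarrow> 0" using N by (rule filterlim_compose)
  then have t: "(\<lambda>k. log 2 Q + err (N k)) \<longlonglongrightarrow> log 2 Q + 0" by (intro tendsto_intros)
  have "eventually (\<lambda>k. e k \<le> log 2 Q + err (N k)) sequentially"
    using ev filterlim_at_top[THEN iffD1, OF N, rule_format, of 1]
  proof eventually_elim
    case (elim k)
    define n where "n = N k"
    have n: "n \<ge> 1" using elim by (simp add: n_def)
    have "2 powr (n * e k) \<le> (real n + 1)\<^sup>2 * real (m k)" "real (m k) \<le> 42 * n * C * Q ^ n"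
      using elim(1) by (simp_all add: n_def add.commute)
    then have "2 powr (n * e k) \<le> (real n + 1)\<^sup>2 * (42 * n * C * Q ^ n)"
      by (meson mult_left_mono order_trans zero_le_power2)
    also have "\<dots> \<le> (real n + 1)\<^sup>2 * ((real n + 1) * (42 * C) * Q ^ n)"
      using Q by (intro mult_left_mono mult_right_mono) (auto simp: algebra_simps)
    also have "\<dots> = (real n + 1) ^ 3 * (42 * C) * Q ^ n" by (simp add: power3_eq_cube power2_eq_square ac_simps)
    finally have "log 2 (2 powr (n * e k)) \<le> log 2 ((real n + 1) ^ 3 * (42 * C) * Q ^ n)"
      using Q C by (subst log_le_cancel_iff) auto
    then have "n * e k \<le> 3 * log 2 (real n + 1) + log 2 (42 * C) + n * log 2 Q"
      using Q C by (simp add: log_mult log_nat_power)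
    then have "e k \<le> (3 * log 2 (real n + 1) + log 2 (42 * C) + n * log 2 Q) / n"
      using n by (simp add: pos_le_divide_eq mult.commute)
    also have "\<dots> = log 2 Q + err n" using n by (simp add: err_def field_simps)
    finally show ?case by (simp add: n_def)
  qed
  then have "l \<le> log 2 Q + 0" by (rule tendsto_le[OF sequentially_bot t e])
  then have "2 powr l \<le> 2 powr (log 2 Q)" by (intro powr_mono) auto
  then show ?thesis using Q by simp
qed

section \<open>Support patterns\<close>

lemma filterlim_mult_const: "0 < c \<Longrightarrow> filterlim (\<lambda>k. c * k) at_top sequentially" for c :: nat
  by (rule filterlim_at_top_mono[OF filterlim_ident]) auto

text \<open>The uniform distribution on the three points has all marginals
  \<open>(2/3, 1/3)\<close>. With weight zero the whole support is the face, and it is tight because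
  every point has two indices 0 and one index 1: \<open>1 + 1 - 2 = 0\<close>.\<close>

lemma W_pattern_lower_bound:
  fixes T :: "'a::field tensor3"
  assumes "\<And>i j k. i < 2 \<Longrightarrow> j < 2 \<Longrightarrow> k < 2 \<Longrightarrow> T i j k \<noteq> 0 \<longleftrightarrow> (i, j, k) \<in> {(1, 0, 0), (0, 1, 0), (0, 0, 1)}"
  shows "2 powr binary_entropy (1 / 3) \<le> asymptotic_subrank 2 2 2 T"
proof -
  define \<Phi> :: "(nat \<times> nat \<times> nat) set" where "\<Phi> = {(1, 0, 0), (0, 1, 0), (0, 0, 1)}"
  define \<alpha> :: "nat \<Rightarrow> int" where "\<alpha> i = (if i = 0 then 1 else - 2)" for i
  define u :: "nat \<Rightarrow> int" where "u i = 0" for i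
  have supp: "T i j k \<noteq> 0 \<longleftrightarrow> (i, j, k) \<in> \<Phi>" if "i < 2" "j < 2" "k < 2" for i j k
    using assms that unfolding \<Phi>_def by blast
  have nz: "nonzero_on 2 2 2 T" unfolding nonzero_on_def
    using supp[of 1 0 0] by (intro exI[of _ 1] conjI exI[of _ 0]) (auto simp: \<Phi>_def)
  have bound: "real (3 * k choose k) \<le> 42 * (3 * k) * 3 * asymptotic_subrank 2 2 2 T ^ (3 * k)" if "k \<ge> 1" for k
  proof -
    define es0 :: "(nat \<times> nat \<times> nat) list" where
      "es0 = replicate k (1, 0, 0) @ replicate k (0, 1, 0) @ replicate k (0, 0, 1)"
    have types: "mset (map fst es0) = replicate_mset (2 * k) 0 + replicate_mset k 1 + replicate_mset 0 2"
      "mset (map (\<lambda>e. fst (snd e)) es0) = replicate_mset (2 * k) 0 + replicate_mset k 1 + replicate_mset 0 2"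
      "mset (map (\<lambda>e. snd (snd e)) es0) = replicate_mset (2 * k) 0 + replicate_mset k 1 + replicate_mset 0 2"
      by (rule multiset_eqI; simp add: es0_def)+
    have card: "card (permutations_of_multiset (replicate_mset (2 * k) (0::nat) + replicate_mset k 1 + replicate_mset 0 2))
        = 3 * k choose k"
      by (subst card_permutations_three) auto
    have perms: "3 * k choose k \<le> card (permutations_of_multiset (mset (map fst es0)))"
      "3 * k choose k \<le> card (permutations_of_multiset (mset (map (\<lambda>e. fst (snd e)) es0)))"
      "3 * k choose k \<le> card (permutations_of_multiset (mset (map (\<lambda>e. snd (snd e)) es0)))"
      unfolding types card by simp_all
    have inj: "inj_on \<alpha> {..<2}" by (auto simp: inj_on_def \<alpha>_def split: if_splits)
    have fin: "finite \<Phi>" by (simp add: \<Phi>_def)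
    have bnd: "a < 2 \<and> b < 2 \<and> c < 2 \<and> T a b c \<noteq> 0" if "(a, b, c) \<in> \<Phi>" for a b c
    proof -
      have "a < 2" "b < 2" "c < 2" using that by (auto simp: \<Phi>_def)
      then show ?thesis using supp that by blast
    qed
    have face0: "u a + u b + u c = 0" if "(a, b, c) \<in> \<Phi>" for a b c
      by (simp add: u_def)
    have face: "0 \<le> u a + u b + u c \<and> (u a + u b + u c = 0 \<longrightarrow> (a, b, c) \<in> \<Phi>)"
      if "a < 2" "b < 2" "c < 2" "T a b c \<noteq> 0" for a b c
      using supp that by (simp add: u_def)
    have tight: "\<alpha> a + \<alpha> b + \<alpha> c = 0" "\<bar>\<alpha> a - \<alpha> b\<bar> \<le> int 3" if "(a, b, c) \<in> \<Phi>" for a b c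
      using that by (auto simp: \<Phi>_def \<alpha>_def)
    have es0: "set es0 \<subseteq> \<Phi>" "es0 \<noteq> []" using that by (auto simp: es0_def \<Phi>_def)
    have "real (3 * k choose k) \<le> 42 * length es0 * 3 * asymptotic_subrank 2 2 2 T ^ length es0"
      by (rule tight_lower_bound[OF fin bnd face0 face tight(1) inj inj inj tight(2) _ es0 perms]) simp_all
    moreover have "length es0 = 3 * k" by (simp add: es0_def)
    ultimately show ?thesis by (simp only:)
  qed
  show ?thesis
  proof (rule entropy_lower_bound_limit[where N = "\<lambda>k. 3 * k" and m = "\<lambda>k. 3 * k choose k" and C = 3 and e = "\<lambda>_. binary_entropy (1 / 3)"])
    show "eventually (\<lambda>k. 2 powr (real (3 * k) * binary_entropy (1 / 3)) \<le> (real (3 * k) + 1)\<^sup>2 * real (3 * k choose k)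
      \<and> real (3 * k choose k) \<le> real (42 * (3 * k) * 3) * asymptotic_subrank 2 2 2 T ^ (3 * k)) sequentially"
      using eventually_ge_at_top[of 1]
    proof eventually_elim
      case (elim k)
      have "2 powr (real (3 * k) * binary_entropy (k / real (3 * k))) \<le> (real (3 * k) + 1) * real (3 * k choose k)"
        using elim powr_entropy_le_binomial[of k "3 * k"] by simp
      also have "\<dots> \<le> (real (3 * k) + 1)\<^sup>2 * real (3 * k choose k)"
        by (intro mult_right_mono) (auto simp: power2_eq_square)
      finally show ?case using elim bound[OF elim] by simp
    qed
  qed (use asymptotic_subrank_ge_1[OF nz] in \<open>auto intro: filterlim_mult_const\<close>)
qed

text \<open>The weight \<open>1 - [j > 0] - [k > 0]\<close> puts the entries with
  \<open>j = k = 0\<close> above the face and singles out four points. Taken with probability 1/4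
  each, they give every marginal the probabilities 1/2, 1/4, 1/4, of entropy 3/2.\<close>

lemma V_pattern_lower_bound:
  fixes T :: "'a::field tensor3"
  assumes "T 1 0 1 \<noteq> 0" "T 1 1 0 \<noteq> 0" "T 2 0 2 \<noteq> 0" "T 0 2 0 \<noteq> 0"
    and "T 1 0 2 = 0" "T 1 2 0 = 0" "T 2 0 1 = 0" "T 2 1 0 = 0" "T 2 2 0 = 0" "T 0 0 1 = 0" "T 0 0 2 = 0" "T 0 1 0 = 0"
    and "\<And>i j k. i < 3 \<Longrightarrow> j \<in> {1, 2} \<Longrightarrow> k \<in> {1, 2} \<Longrightarrow> T i j k = 0"
  shows "2 powr (3 / 2) \<le> asymptotic_subrank 3 3 3 T"
proof -
  define \<Phi> :: "(nat \<times> nat \<times> nat) set" where "\<Phi> = {(1, 0, 1), (1, 1, 0), (2, 0, 2), (0, 2, 0)}"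
  define u :: "nat \<Rightarrow> int" where "u i = 1" for i
  define v :: "nat \<Rightarrow> int" where "v i = (if i = 0 then 0 else - 1)" for i
  define \<alpha> :: "nat \<Rightarrow> int" where "\<alpha> i = int i + 1" for i
  define \<beta> :: "nat \<Rightarrow> int" where "\<beta> i = (if i = 0 then 0 else if i = 1 then - 2 else - 1)" for i
  define \<gamma> :: "nat \<Rightarrow> int" where "\<gamma> i = (if i = 0 then 0 else - int i - 1)" for i
  have lt3: "i < 3 \<longleftrightarrow> i = 0 \<or> i = 1 \<or> i = 2" for i :: nat by auto
  have face: "0 \<le> u i + v j + v k \<and> (u i + v j + v k = 0 \<longrightarrow> (i, j, k) \<in> \<Phi>)"
    if "i < 3" "j < 3" "k < 3" "T i j k \<noteq> 0" for i j k
    using that assms unfolding lt3 \<Phi>_def u_def v_def by (elim disjE; simp)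
  have nz: "nonzero_on 3 3 3 T" unfolding nonzero_on_def
    using assms by (intro exI[of _ 1] conjI exI[of _ 0]) auto
  have bound: "real ((4 * k choose (2 * k)) * (2 * k choose k)) \<le> 42 * (4 * k) * 5 * asymptotic_subrank 3 3 3 T ^ (4 * k)"
    if "k \<ge> 1" for k
  proof -
    define es0 :: "(nat \<times> nat \<times> nat) list" where
      "es0 = replicate k (1, 0, 1) @ replicate k (1, 1, 0) @ replicate k (2, 0, 2) @ replicate k (0, 2, 0)"
    have types: "mset (map fst es0) = replicate_mset (2 * k) 1 + replicate_mset k 0 + replicate_mset k 2"
      "mset (map (\<lambda>e. fst (snd e)) es0) = replicate_mset (2 * k) 0 + replicate_mset k 1 + replicate_mset k 2"
      "mset (map (\<lambda>e. snd (snd e)) es0) = replicate_mset (2 * k) 0 + replicate_mset k 1 + replicate_mset k 2"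
      by (rule multiset_eqI; simp add: es0_def)+
    have card: "card (permutations_of_multiset (replicate_mset (2 * k) x + replicate_mset k y + replicate_mset k z))
        = (4 * k choose (2 * k)) * (2 * k choose k)" if "x \<noteq> y" "y \<noteq> z" "x \<noteq> z" for x y z :: nat
    proof -
      have "2 * k + k + k = 4 * k" "k + k = 2 * k" by simp_all
      then show ?thesis using card_permutations_three[OF that, of "2 * k" k k] by (simp only:)
    qed
    have perms: "(4 * k choose (2 * k)) * (2 * k choose k) \<le> card (permutations_of_multiset (mset (map fst es0)))"
      "(4 * k choose (2 * k)) * (2 * k choose k) \<le> card (permutations_of_multiset (mset (map (\<lambda>e. fst (snd e)) es0)))"
      "(4 * k choose (2 * k)) * (2 * k choose k) \<le> card (permutations_of_multiset (mset (map (\<lambda>e. snd (snd e)) es0)))"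
      unfolding types by (simp_all add: card del: One_nat_def)
    have inj: "inj_on \<alpha> {..<3}" "inj_on \<beta> {..<3}" "inj_on \<gamma> {..<3}" by (auto simp: inj_on_def \<alpha>_def \<beta>_def \<gamma>_def split: if_splits)
    have fin: "finite \<Phi>" by (simp add: \<Phi>_def)
    have bnd: "a < 3 \<and> b < 3 \<and> c < 3 \<and> T a b c \<noteq> 0" if "(a, b, c) \<in> \<Phi>" for a b c
      using that assms by (auto simp: \<Phi>_def)
    have face0: "u a + v b + v c = 0" if "(a, b, c) \<in> \<Phi>" for a b c
      using that by (auto simp: \<Phi>_def u_def v_def \<alpha>_def \<beta>_def \<gamma>_def)
    have tight: "\<alpha> a + \<beta> b + \<gamma> c = 0" "\<bar>\<alpha> a - \<beta> b\<bar> \<le> int 5" if "(a, b, c) \<in> \<Phi>" for a b c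
      using that by (auto simp: \<Phi>_def u_def v_def \<alpha>_def \<beta>_def \<gamma>_def)
    have es0: "set es0 \<subseteq> \<Phi>" "es0 \<noteq> []" using that by (auto simp: es0_def \<Phi>_def)
    have "real ((4 * k choose (2 * k)) * (2 * k choose k)) \<le> 42 * length es0 * 5 * asymptotic_subrank 3 3 3 T ^ length es0"
      by (rule tight_lower_bound[OF fin bnd face0 face tight(1) inj tight(2) _ es0 perms]) simp_all
    moreover have "length es0 = 4 * k" by (simp add: es0_def)
    ultimately show ?thesis by (simp only:)
  qed
  show ?thesis
  proof (rule entropy_lower_bound_limit[where N = "\<lambda>k. 4 * k" and m = "\<lambda>k. (4 * k choose (2 * k)) * (2 * k choose k)" and C = 5 and e = "\<lambda>_. 3 / 2"])
    show "eventually (\<lambda>k. 2 powr (real (4 * k) * (3 / 2)) \<le> (real (4 * k) + 1)\<^sup>2 * real ((4 * k choose (2 * k)) * (2 * k choose k))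
      \<and> real ((4 * k choose (2 * k)) * (2 * k choose k)) \<le> real (42 * (4 * k) * 5) * asymptotic_subrank 3 3 3 T ^ (4 * k)) sequentially"
      using eventually_ge_at_top[of 1]
    proof eventually_elim
      case (elim k)
      have half: "real (2 * k) / real (4 * k) = 1 / 2" "real k / real (2 * k) = 1 / 2" using elim by simp_all
      have "2 powr (real (4 * k) * binary_entropy (1 / 2) + real (2 * k) * binary_entropy (1 / 2))
          \<le> (real (4 * k) + 1)\<^sup>2 * real ((4 * k choose (2 * k)) * (2 * k choose k))"
        using elim powr_entropy_le_trinomial[of k "2 * k" "4 * k"] unfolding half by simp
      then show ?case using bound[OF elim] by (simp add: binary_entropy_half)
    qed
  qed (use asymptotic_subrank_ge_1[OF nz] in \<open>auto intro: filterlim_mult_const\<close>)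
qed

text \<open>The weight is \<open>[i > 0] - [j = 2] - [k = 2]\<close>, so entries with
  \<open>i > 0\<close> and \<open>j, k < 2\<close> lie above the face. Each index occurs twice in
  each factor of the six points, so the marginals are uniform; the exponent is
  \<open>log 2 3\<close>, in the form that the trinomial estimate produces.\<close>

lemma determinant_pattern_lower_bound:
  fixes T :: "'a::field tensor3"
  assumes "T 0 0 0 \<noteq> 0" "T 0 1 1 \<noteq> 0" "T 1 2 0 \<noteq> 0" "T 2 2 1 \<noteq> 0" "T 2 0 2 \<noteq> 0" "T 1 1 2 \<noteq> 0"
    and "T 0 0 1 = 0" "T 0 1 0 = 0" "T 0 2 0 = 0" "T 0 2 1 = 0" "T 0 0 2 = 0" "T 0 1 2 = 0"
    and "T 1 2 1 = 0" "T 2 2 0 = 0" "T 1 0 2 = 0" "T 2 1 2 = 0"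
    and "\<And>i. i < 3 \<Longrightarrow> T i 2 2 = 0"
  shows "2 powr (binary_entropy (1 / 3) + 2 / 3) \<le> asymptotic_subrank 3 3 3 T"
proof -
  define \<Phi> :: "(nat \<times> nat \<times> nat) set"
    where "\<Phi> = {(0, 0, 0), (0, 1, 1), (1, 2, 0), (2, 2, 1), (2, 0, 2), (1, 1, 2)}"
  define u :: "nat \<Rightarrow> int" where "u i = (if i = 0 then 0 else 1)" for i
  define v :: "nat \<Rightarrow> int" where "v i = (if i = 2 then - 1 else 0)" for i
  define \<alpha> :: "nat \<Rightarrow> int" where "\<alpha> i = int i - 1" for i
  define \<beta> :: "nat \<Rightarrow> int" where "\<beta> i = (if i = 2 then - 1 else int i)" for i
  define \<gamma> :: "nat \<Rightarrow> int" where "\<gamma> i = 1 - int i" for i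
  have lt3: "i < 3 \<longleftrightarrow> i = 0 \<or> i = 1 \<or> i = 2" for i :: nat by auto
  have face: "0 \<le> u i + v j + v k \<and> (u i + v j + v k = 0 \<longrightarrow> (i, j, k) \<in> \<Phi>)"
    if "i < 3" "j < 3" "k < 3" "T i j k \<noteq> 0" for i j k
    using that assms unfolding lt3 \<Phi>_def u_def v_def by (elim disjE; simp)
  have nz: "nonzero_on 3 3 3 T" unfolding nonzero_on_def
    using assms by (intro exI[of _ 0] conjI) auto
  have bound: "real ((6 * k choose (4 * k)) * (4 * k choose (2 * k))) \<le> 42 * (6 * k) * 2 * asymptotic_subrank 3 3 3 T ^ (6 * k)"
    if "k \<ge> 1" for k
  proof -
    define es0 :: "(nat \<times> nat \<times> nat) list" where
      "es0 = replicate k (0, 0, 0) @ replicate k (0, 1, 1) @ replicate k (1, 2, 0)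
        @ replicate k (2, 2, 1) @ replicate k (2, 0, 2) @ replicate k (1, 1, 2)"
    have types: "mset (map fst es0) = replicate_mset (2 * k) 0 + replicate_mset (2 * k) 1 + replicate_mset (2 * k) 2"
      "mset (map (\<lambda>e. fst (snd e)) es0) = replicate_mset (2 * k) 0 + replicate_mset (2 * k) 1 + replicate_mset (2 * k) 2"
      "mset (map (\<lambda>e. snd (snd e)) es0) = replicate_mset (2 * k) 0 + replicate_mset (2 * k) 1 + replicate_mset (2 * k) 2"
      by (rule multiset_eqI; simp add: es0_def)+
    have card: "card (permutations_of_multiset (replicate_mset (2 * k) (0::nat) + replicate_mset (2 * k) 1 + replicate_mset (2 * k) 2))
        = (6 * k choose (4 * k)) * (4 * k choose (2 * k))"
    proof -
      have "2 * k + 2 * k + 2 * k = 6 * k" "2 * k + 2 * k = 4 * k" by simp_all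
      then show ?thesis using card_permutations_three[of "0::nat" 1 2 "2 * k" "2 * k" "2 * k"] by (simp del: One_nat_def)
    qed
    have perms: "(6 * k choose (4 * k)) * (4 * k choose (2 * k)) \<le> card (permutations_of_multiset (mset (map fst es0)))"
      "(6 * k choose (4 * k)) * (4 * k choose (2 * k)) \<le> card (permutations_of_multiset (mset (map (\<lambda>e. fst (snd e)) es0)))"
      "(6 * k choose (4 * k)) * (4 * k choose (2 * k)) \<le> card (permutations_of_multiset (mset (map (\<lambda>e. snd (snd e)) es0)))"
      unfolding types by (simp_all add: card del: One_nat_def)
    have inj: "inj_on \<alpha> {..<3}" "inj_on \<beta> {..<3}" "inj_on \<gamma> {..<3}" by (auto simp: inj_on_def \<alpha>_def \<beta>_def \<gamma>_def split: if_splits)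
    have fin: "finite \<Phi>" by (simp add: \<Phi>_def)
    have bnd: "a < 3 \<and> b < 3 \<and> c < 3 \<and> T a b c \<noteq> 0" if "(a, b, c) \<in> \<Phi>" for a b c
      using that assms by (auto simp: \<Phi>_def)
    have face0: "u a + v b + v c = 0" if "(a, b, c) \<in> \<Phi>" for a b c
      using that by (auto simp: \<Phi>_def u_def v_def \<alpha>_def \<beta>_def \<gamma>_def)
    have tight: "\<alpha> a + \<beta> b + \<gamma> c = 0" "\<bar>\<alpha> a - \<beta> b\<bar> \<le> int 2" if "(a, b, c) \<in> \<Phi>" for a b c
      using that by (auto simp: \<Phi>_def u_def v_def \<alpha>_def \<beta>_def \<gamma>_def)
    have es0: "set es0 \<subseteq> \<Phi>" "es0 \<noteq> []" using that by (auto simp: es0_def \<Phi>_def)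
    have "real ((6 * k choose (4 * k)) * (4 * k choose (2 * k))) \<le> 42 * length es0 * 2 * asymptotic_subrank 3 3 3 T ^ length es0"
      by (rule tight_lower_bound[OF fin bnd face0 face tight(1) inj tight(2) _ es0 perms]) simp_all
    moreover have "length es0 = 6 * k" by (simp add: es0_def)
    ultimately show ?thesis by (simp only:)
  qed
  show ?thesis
  proof (rule entropy_lower_bound_limit[where N = "\<lambda>k. 6 * k" and m = "\<lambda>k. (6 * k choose (4 * k)) * (4 * k choose (2 * k))" and C = 2 and e = "\<lambda>_. binary_entropy (1 / 3) + 2 / 3"])
    show "eventually (\<lambda>k. 2 powr (real (6 * k) * (binary_entropy (1 / 3) + 2 / 3)) \<le> (real (6 * k) + 1)\<^sup>2 * real ((6 * k choose (4 * k)) * (4 * k choose (2 * k)))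
      \<and> real ((6 * k choose (4 * k)) * (4 * k choose (2 * k))) \<le> real (42 * (6 * k) * 2) * asymptotic_subrank 3 3 3 T ^ (6 * k)) sequentially"
      using eventually_ge_at_top[of 1]
    proof eventually_elim
      case (elim k)
      have frac: "real (4 * k) / real (6 * k) = 2 / 3" "real (2 * k) / real (4 * k) = 1 / 2" using elim by simp_all
      have "binary_entropy (2 / 3) = binary_entropy (1 / 3)" by (simp add: binary_entropy_def)
      moreover have "2 powr (real (6 * k) * binary_entropy (2 / 3) + real (4 * k) * binary_entropy (1 / 2))
          \<le> (real (6 * k) + 1)\<^sup>2 * real ((6 * k choose (4 * k)) * (4 * k choose (2 * k)))"
        using elim powr_entropy_le_trinomial[of "2 * k" "4 * k" "6 * k"] unfolding frac by simp
      ultimately show ?case using bound[OF elim] by (simp add: binary_entropy_half algebra_simps)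
    qed
  qed (use asymptotic_subrank_ge_1[OF nz] in \<open>auto intro: filterlim_mult_const\<close>)
qed

text \<open>The weight is \<open>[j > 0] + [k > 0] - [i > 0]\<close>, negative only at
  \<open>(1, 0, 0)\<close> and \<open>(2, 0, 0)\<close>. Above the face lie all entries with
  \<open>j, k > 0\<close> and, apart from \<open>(0, 0, 0)\<close>, all entries with
  \<open>i = 0\<close>.\<close>

lemma null_algebra_pattern_lower_bound:
  fixes T :: "'a::field tensor3" and \<tau> :: real
  assumes "T 0 0 0 \<noteq> 0" "T 1 1 0 \<noteq> 0" "T 1 0 1 \<noteq> 0" "T 2 2 0 \<noteq> 0" "T 2 0 2 \<noteq> 0"
    and "T 1 0 0 = 0" "T 2 0 0 = 0" "T 1 2 0 = 0" "T 2 1 0 = 0" "T 1 0 2 = 0" "T 2 0 1 = 0"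
    and \<tau>: "0 < \<tau>" "\<tau> < 1 / 2" "binary_entropy (2 * \<tau>) - binary_entropy \<tau> + \<tau> = 0"
  shows "2 powr (\<tau> + binary_entropy \<tau>) \<le> asymptotic_subrank 3 3 3 T"
proof -
  define \<Phi> :: "(nat \<times> nat \<times> nat) set"
    where "\<Phi> = {(0, 0, 0), (1, 1, 0), (1, 0, 1), (2, 2, 0), (2, 0, 2)}"
  define u :: "nat \<Rightarrow> int" where "u i = (if i = 0 then 0 else - 1)" for i
  define v :: "nat \<Rightarrow> int" where "v i = (if i = 0 then 0 else 1)" for i
  have lt3: "i < 3 \<longleftrightarrow> i = 0 \<or> i = 1 \<or> i = 2" for i :: nat by auto
  have face: "0 \<le> u i + v j + v k \<and> (u i + v j + v k = 0 \<longrightarrow> (i, j, k) \<in> \<Phi>)"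
    if "i < 3" "j < 3" "k < 3" "T i j k \<noteq> 0" for i j k
    using that assms unfolding lt3 \<Phi>_def u_def v_def by (elim disjE; simp)
  have nz: "nonzero_on 3 3 3 T" unfolding nonzero_on_def
    using assms by (intro exI[of _ 0] conjI) auto
  \<comment> \<open>The type in the first factor differs from the common type in the other two; the
    smaller of the two counts limits the bound.\<close>
  define m where "m n s = min ((n choose (4 * s)) * (4 * s choose (2 * s))) ((n choose (2 * s)) * (2 * s choose s))" for n s :: nat
  have bound: "real (m n s) \<le> 42 * n * 4 * asymptotic_subrank 3 3 3 T ^ n"
    if "s \<ge> 1" "4 * s < n" for n s
  proof -
    define r where "r = n - 4 * s"
    have n: "n = r + 4 * s" using that by (simp add: r_def)
    define es0 :: "(nat \<times> nat \<times> nat) list" where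
      "es0 = replicate r (0, 0, 0) @ replicate s (1, 1, 0) @ replicate s (1, 0, 1)
        @ replicate s (2, 2, 0) @ replicate s (2, 0, 2)"
    have types: "mset (map fst es0) = replicate_mset r 0 + replicate_mset (2 * s) 1 + replicate_mset (2 * s) 2"
      "mset (map (\<lambda>e. fst (snd e)) es0) = replicate_mset (r + 2 * s) 0 + replicate_mset s 1 + replicate_mset s 2"
      "mset (map (\<lambda>e. snd (snd e)) es0) = replicate_mset (r + 2 * s) 0 + replicate_mset s 1 + replicate_mset s 2"
      by (rule multiset_eqI; simp add: es0_def)+
    have card: "card (permutations_of_multiset (replicate_mset r (0::nat) + replicate_mset (2 * s) 1 + replicate_mset (2 * s) 2))
        = (n choose (4 * s)) * (4 * s choose (2 * s))"
      "card (permutations_of_multiset (replicate_mset (r + 2 * s) (0::nat) + replicate_mset s 1 + replicate_mset s 2))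
        = (n choose (2 * s)) * (2 * s choose s)"
    proof -
      have eq: "r + 2 * s + 2 * s = n" "2 * s + 2 * s = 4 * s" "r + 2 * s + s + s = n" "s + s = 2 * s" by (simp_all add: n)
      show "card (permutations_of_multiset (replicate_mset r (0::nat) + replicate_mset (2 * s) 1 + replicate_mset (2 * s) 2))
        = (n choose (4 * s)) * (4 * s choose (2 * s))"
        using card_permutations_three[of "0::nat" 1 2 r "2 * s" "2 * s"] unfolding eq by simp
      show "card (permutations_of_multiset (replicate_mset (r + 2 * s) (0::nat) + replicate_mset s 1 + replicate_mset s 2))
        = (n choose (2 * s)) * (2 * s choose s)"
        using card_permutations_three[of "0::nat" 1 2 "r + 2 * s" s s] unfolding eq by simp
    qed
    have perms: "m n s \<le> card (permutations_of_multiset (mset (map fst es0)))"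
      "m n s \<le> card (permutations_of_multiset (mset (map (\<lambda>e. fst (snd e)) es0)))"
      "m n s \<le> card (permutations_of_multiset (mset (map (\<lambda>e. snd (snd e)) es0)))"
      unfolding types by (simp_all add: card m_def del: One_nat_def)
    have inj: "inj_on (\<lambda>i. - int i) {..<3}" "inj_on int {..<3}" by (auto simp: inj_on_def split: if_splits)
    have fin: "finite \<Phi>" by (simp add: \<Phi>_def)
    have bnd: "a < 3 \<and> b < 3 \<and> c < 3 \<and> T a b c \<noteq> 0" if "(a, b, c) \<in> \<Phi>" for a b c
      using that assms by (auto simp: \<Phi>_def)
    have face0: "u a + v b + v c = 0" if "(a, b, c) \<in> \<Phi>" for a b c
      using that by (auto simp: \<Phi>_def u_def v_def)
    have tight: "(\<lambda>i. - int i) a + int b + int c = 0" "\<bar>(\<lambda>i. - int i) a - int b\<bar> \<le> int 4" if "(a, b, c) \<in> \<Phi>" for a b c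
      using that by (auto simp: \<Phi>_def u_def v_def)
    have es0: "set es0 \<subseteq> \<Phi>" "es0 \<noteq> []" using that(1) by (simp_all add: es0_def \<Phi>_def set_replicate_conv_if)
    have "real (m n s) \<le> 42 * length es0 * 4 * asymptotic_subrank 3 3 3 T ^ length es0"
      by (rule tight_lower_bound[OF fin bnd face0 face tight(1) inj(1,2,2) tight(2) _ es0 perms]) simp_all
    moreover have "length es0 = n" by (simp add: es0_def n)
    ultimately show ?thesis by (simp only:)
  qed
  \<comment> \<open>Each of the four points other than \<open>(0, 0, 0)\<close> receives the
    proportion \<open>\<tau> / 2\<close>, rounded down.\<close>
  define s where "s n = nat \<lfloor>real n * (\<tau> / 2)\<rfloor>" for n
  have s_eq: "real (s n) = of_int \<lfloor>real n * (\<tau> / 2)\<rfloor>" for n using \<tau> by (simp add: s_def)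
  have s_le: "s n \<le> real n * (\<tau> / 2)" for n unfolding s_eq by (rule of_int_floor_le)
  have lim: "(\<lambda>n. s n / n) \<longlonglongrightarrow> \<tau> / 2"
  proof (rule tendsto_sandwich)
    show "eventually (\<lambda>n. \<tau> / 2 - 1 / n \<le> s n / n) sequentially"
      using eventually_gt_at_top[of 0]
    proof eventually_elim
      case (elim n)
      have "real n * (\<tau> / 2) - 1 \<le> s n" unfolding s_eq by linarith
      then have "(real n * (\<tau> / 2) - 1) / n \<le> s n / n" by (intro divide_right_mono) auto
      then show ?case using elim by (simp add: diff_divide_distrib)
    qed
    show "eventually (\<lambda>n. s n / n \<le> \<tau> / 2) sequentially"
      using eventually_gt_at_top[of 0] by eventually_elim (use s_le in \<open>simp add: field_simps\<close>)
    show "(\<lambda>n. \<tau> / 2 - 1 / real n) \<longlonglongrightarrow> \<tau> / 2" by real_asymp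
  qed auto
  define e1 where "e1 n = binary_entropy (4 * (s n / n)) + 4 * (s n / n)" for n
  define e2 where "e2 n = binary_entropy (2 * (s n / n)) + 2 * (s n / n)" for n
  have cont: "((\<lambda>n. binary_entropy (f n)) \<longlonglongrightarrow> binary_entropy x)"
    if "f \<longlonglongrightarrow> x" "0 < x" "x < 1" for f :: "nat \<Rightarrow> real" and x
    unfolding binary_entropy_def using that by (intro tendsto_intros) auto
  \<comment> \<open>The equation for \<open>\<tau>\<close> enters here:
    \<open>h(2 * \<tau>) + 2 * \<tau>\<close> equals \<open>h(\<tau>) + \<tau>\<close>, which is the
    limit for the other type.\<close>
  have "e1 \<longlonglongrightarrow> binary_entropy (4 * (\<tau> / 2)) + 4 * (\<tau> / 2)"
    unfolding e1_def using \<tau> by (intro tendsto_intros cont lim) auto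
  moreover have "binary_entropy (4 * (\<tau> / 2)) + 4 * (\<tau> / 2) = \<tau> + binary_entropy \<tau>" using \<tau>(3) by simp
  ultimately have e1: "e1 \<longlonglongrightarrow> \<tau> + binary_entropy \<tau>" by (simp only:)
  have lim2: "(\<lambda>n. 2 * (s n / n)) \<longlonglongrightarrow> 2 * (\<tau> / 2)" by (intro tendsto_intros lim)
  have "(\<lambda>n. binary_entropy (2 * (s n / n))) \<longlonglongrightarrow> binary_entropy (2 * (\<tau> / 2))"
    by (rule cont[OF lim2]) (use \<tau> in simp_all)
  from tendsto_add[OF this lim2]
  have "e2 \<longlonglongrightarrow> binary_entropy (2 * (\<tau> / 2)) + 2 * (\<tau> / 2)" unfolding e2_def .
  moreover have "binary_entropy (2 * (\<tau> / 2)) + 2 * (\<tau> / 2) = \<tau> + binary_entropy \<tau>" by simp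
  ultimately have e2: "e2 \<longlonglongrightarrow> \<tau> + binary_entropy \<tau>" by (simp only:)
  have e: "(\<lambda>n. min (e1 n) (e2 n)) \<longlonglongrightarrow> \<tau> + binary_entropy \<tau>" using tendsto_min[OF e1 e2] by simp
  have s1: "eventually (\<lambda>n. 0 < s n / n) sequentially" using order_tendstoD(1)[OF lim, of 0] \<tau> by simp
  show ?thesis
  proof (rule entropy_lower_bound_limit[where N = id and m = "\<lambda>n. m n (s n)" and C = 4 and e = "\<lambda>n. min (e1 n) (e2 n)"])
    show "eventually (\<lambda>n. 2 powr (real (id n) * min (e1 n) (e2 n)) \<le> (real (id n) + 1)\<^sup>2 * real (m n (s n))
      \<and> real (m n (s n)) \<le> real (42 * id n * 4) * asymptotic_subrank 3 3 3 T ^ id n) sequentially"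
      using s1 eventually_gt_at_top[of 0]
    proof eventually_elim
      case (elim n)
      have s: "s n \<ge> 1" using elim by (cases "s n") auto
      have "4 * real (s n) \<le> real n * (2 * \<tau>)" using s_le[of n] by (simp add: algebra_simps)
      also have "\<dots> < real n * 1" using elim \<tau> by (intro mult_strict_left_mono) auto
      finally have sn: "4 * s n < n" by simp
      have half: "real (2 * s n) / real (4 * s n) = 1 / 2" "real (s n) / real (2 * s n) = 1 / 2" using s by simp_all
      have "2 powr (n * min (e1 n) (e2 n)) \<le> 2 powr (n * e1 n)" by (intro powr_mono mult_left_mono) auto
      also have "n * e1 n = n * binary_entropy (real (4 * s n) / n) + real (4 * s n) * binary_entropy (1 / 2)"
        using elim by (simp add: e1_def binary_entropy_half distrib_left)
      also have "2 powr \<dots> \<le> (real n + 1)\<^sup>2 * real ((n choose (4 * s n)) * (4 * s n choose (2 * s n)))"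
        using powr_entropy_le_trinomial[of "2 * s n" "4 * s n" n] s sn unfolding half by (simp add: add.commute)
      finally have 1: "2 powr (n * min (e1 n) (e2 n)) \<le> (real n + 1)\<^sup>2 * real ((n choose (4 * s n)) * (4 * s n choose (2 * s n)))" .
      have "2 powr (n * min (e1 n) (e2 n)) \<le> 2 powr (n * e2 n)" by (intro powr_mono mult_left_mono) auto
      also have "n * e2 n = n * binary_entropy (real (2 * s n) / n) + real (2 * s n) * binary_entropy (1 / 2)"
        using elim by (simp add: e2_def binary_entropy_half distrib_left)
      also have "2 powr \<dots> \<le> (real n + 1)\<^sup>2 * real ((n choose (2 * s n)) * (2 * s n choose s n))"
        using powr_entropy_le_trinomial[of "s n" "2 * s n" n] s sn unfolding half by (simp add: add.commute)
      finally have 2: "2 powr (n * min (e1 n) (e2 n)) \<le> (real n + 1)\<^sup>2 * real ((n choose (2 * s n)) * (2 * s n choose s n))" .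
      have "2 powr (n * min (e1 n) (e2 n)) \<le> (real n + 1)\<^sup>2 * real (m n (s n))"
        using 1 2 unfolding m_def by (metis min_def)
      then show ?case using bound[OF s sn] by simp
    qed
  qed (use asymptotic_subrank_ge_1[OF nz] e in \<open>auto simp: filterlim_ident id_def\<close>)
qed

section \<open>The upper bound for the W-tensor\<close>

text \<open>For an index of the \<open>n\<close>-th power of format 2 this counts the factors in
  which the index is 1.\<close>

primrec ones :: "nat \<Rightarrow> nat \<Rightarrow> nat" where
  "ones 0 a = 0"
| "ones (Suc n) a = ones n (a div 2) + a mod 2"

lemma sum_power_ones: "(\<Sum>a<2 ^ n. x ^ ones n a) = (1 + x) ^ n" for x :: real
proof (induction n)
  case (Suc n)
  have "(\<Sum>a<2 ^ Suc n. x ^ ones (Suc n) a) = (\<Sum>a<2 ^ n * 2. x ^ ones n (a div 2) * x ^ (a mod 2))"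
    by (simp add: power_add mult.commute)
  also have "\<dots> = (\<Sum>a<2 ^ n. x ^ ones n a) * (\<Sum>a<2. x ^ a)" by (rule sum_div_mod)
  also have "(\<Sum>a<2. x ^ a) = 1 + x" by (simp add: numeral_2_eq_2)
  finally show ?case by (simp only: Suc power_Suc mult.commute)
qed simp

lemma binary_entropy_third: "binary_entropy (1 / 3) = log 2 3 - 2 / 3"
proof -
  have "1 - 1 / 3 = (2 / 3 :: real)" by simp
  then show ?thesis unfolding binary_entropy_def by (simp only: log_divide) (simp add: log_divide field_simps)
qed

lemma powr_entropy_third: "2 powr binary_entropy (1 / 3) = 3 / 2 * 2 powr (1 / 3)"
proof -
  have "2 powr binary_entropy (1 / 3) = 2 powr (log 2 3 + - 1 + 1 / 3)" by (simp add: binary_entropy_third)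
  also have "\<dots> = 3 / 2 * 2 powr (1 / 3)" unfolding powr_add by (simp add: powr_minus)
  finally show ?thesis .
qed

text \<open>Chernoff's bound: each \<open>a\<close> is weighted by \<open>x ^ ones n a\<close> with
  \<open>x = 1/2\<close>, the minimizer of \<open>(1 + x) / x powr (1/3)\<close>, where this
  quotient equals \<open>2 powr h(1/3)\<close>.\<close>

lemma card_few_ones:
  "real (card {a\<in>{..<2 ^ n}. 3 * ones n a \<le> n}) \<le> (2 powr binary_entropy (1 / 3)) ^ n"
proof -
  define I where "I = {a\<in>{..<2 ^ n}. 3 * ones n a \<le> n}"
  have "card I * (2 powr (- (1 / 3))) ^ n = (\<Sum>a\<in>I. (2 powr (- (1 / 3))) ^ n)" by simp
  also have "\<dots> \<le> (\<Sum>a\<in>I. (1 / 2) ^ ones n a)"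
  proof (intro sum_mono)
    fix a assume "a \<in> I"
    then have "3 * real (ones n a) \<le> real n" unfolding I_def by simp
    then have "2 powr (- (real n / 3)) \<le> 2 powr (- real (ones n a))" by (intro powr_mono) auto
    moreover have "(2 powr (- (1 / 3))) ^ n = (2 powr (- (real n / 3)) :: real)"
      by (simp add: powr_realpow[symmetric] powr_powr)
    moreover have "(1 / 2) ^ ones n a = (2 powr (- real (ones n a)) :: real)"
      by (simp add: powr_minus powr_realpow power_one_over inverse_eq_divide)
    ultimately show "(2 powr (- (1 / 3))) ^ n \<le> ((1 / 2) ^ ones n a :: real)" by simp
  qed
  also have "\<dots> \<le> (\<Sum>a<2 ^ n. (1 / 2) ^ ones n a)" by (intro sum_mono2) (auto simp: I_def)
  also have "\<dots> = (3 / 2) ^ n" by (simp add: sum_power_ones)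
  also have "(3 / 2 :: real) = 2 powr binary_entropy (1 / 3) * 2 powr (- (1 / 3))"
    by (simp add: powr_entropy_third powr_minus)
  finally have "card I * (2 powr (- (1 / 3))) ^ n \<le> (2 powr binary_entropy (1 / 3)) ^ n * (2 powr (- (1 / 3))) ^ n"
    by (simp only: power_mult_distrib)
  then have "card I \<le> (2 powr binary_entropy (1 / 3)) ^ n" by (rule mult_right_le_imp_le) simp
  then show ?thesis unfolding I_def .
qed

text \<open>Every factor of the power contributes exactly one index 1. Hence one of the three
  indices has at most \<open>n / 3\<close> ones, and the slices of such indices in the three
  directions cover the support.\<close>

lemma W_power_support:
  assumes supp: "\<And>i j k. i < 2 \<Longrightarrow> j < 2 \<Longrightarrow> k < 2 \<Longrightarrow> T i j k \<noteq> 0 \<Longrightarrow> (i, j, k) \<in> {(1, 0, 0), (0, 1, 0), (0, 0, 1)}"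
    and "a < 2 ^ n" "b < 2 ^ n" "c < 2 ^ n" "tensor_kron_power 2 2 2 T n a b c \<noteq> 0"
  shows "ones n a + ones n b + ones n c = n"
  using assms(2-)
proof (induction n arbitrary: a b c)
  case (Suc n)
  have nz: "tensor_kron_power 2 2 2 T n (a div 2) (b div 2) (c div 2) \<noteq> 0" "T (a mod 2) (b mod 2) (c mod 2) \<noteq> 0"
    using Suc.prems(4) by (auto simp: tensor_kron_def)
  have "ones n (a div 2) + ones n (b div 2) + ones n (c div 2) = n"
    using Suc.prems nz by (intro Suc.IH) auto
  moreover have "(a mod 2, b mod 2, c mod 2) \<in> {(1, 0, 0), (0, 1, 0), (0, 0, 1)}"
    by (rule supp[OF _ _ _ nz(2)]) simp_all
  ultimately show ?case by auto
qed simp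

lemma W_pattern_upper_bound:
  fixes T :: "'a::field tensor3"
  assumes supp: "\<And>i j k. i < 2 \<Longrightarrow> j < 2 \<Longrightarrow> k < 2 \<Longrightarrow> T i j k \<noteq> 0 \<Longrightarrow> (i, j, k) \<in> {(1, 0, 0), (0, 1, 0), (0, 0, 1)}"
    and nz: "nonzero_on 2 2 2 T"
  shows "asymptotic_subrank 2 2 2 T \<le> 2 powr binary_entropy (1 / 3)"
proof (rule asymptotic_subrank_upper[OF nz, of _ 3])
  fix n :: nat
  define I where "I = {a\<in>{..<2 ^ n}. 3 * ones n a \<le> n}"
  have "subrank (2 ^ n) (2 ^ n) (2 ^ n) (tensor_kron_power 2 2 2 T n) \<le> card I + card I + card I"
  proof (rule has_subrank_le_slices[OF has_subrank_subrank])
    fix a b c :: nat assume abc: "a < 2 ^ n" "b < 2 ^ n" "c < 2 ^ n" "tensor_kron_power 2 2 2 T n a b c \<noteq> 0"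
    have "ones n a + ones n b + ones n c = n" by (rule W_power_support[OF supp abc])
    then show "a \<in> I \<or> b \<in> I \<or> c \<in> I" using abc(1-3) unfolding I_def by auto
  qed (auto simp: I_def)
  then have "real (subrank (2 ^ n) (2 ^ n) (2 ^ n) (tensor_kron_power 2 2 2 T n)) \<le> 3 * real (card I)" by linarith
  also have "\<dots> \<le> 3 * (2 powr binary_entropy (1 / 3)) ^ n"
    unfolding I_def using card_few_ones by (intro mult_left_mono) auto
  finally show "real (subrank (2 ^ n) (2 ^ n) (2 ^ n) (tensor_kron_power 2 2 2 T n)) \<le> 3 * (2 powr binary_entropy (1 / 3)) ^ n" .
qed auto

section \<open>Concise tensors\<close>

lemma restricts_swap13:
  "restricts n3 n2 n1 (\<lambda>i j k. T k j i) m3 m2 m1 (\<lambda>i j k. S k j i) \<longleftrightarrow> restricts n1 n2 n3 T m1 m2 m3 S"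
  using restricts_swap12[of n3 n2 n1 "\<lambda>i j k. T k i j" m3 m2 m1 "\<lambda>i j k. S k i j"]
    restricts_swap23[of n2 n3 n1 "\<lambda>i j k. T j i k" m2 m3 m1 "\<lambda>i j k. S j i k"]
    restricts_swap12[of n2 n1 n3 T m2 m1 m3 S]
  by (simp only:)

definition concise1 :: "nat \<Rightarrow> nat \<Rightarrow> nat \<Rightarrow> 'a::field tensor3 \<Rightarrow> bool" where
  "concise1 n1 n2 n3 T \<longleftrightarrow>
    (\<forall>x. (\<forall>j<n2. \<forall>k<n3. (\<Sum>i<n1. x i * T i j k) = 0) \<longrightarrow> (\<forall>i<n1. x i = 0))"

definition concise :: "nat \<Rightarrow> nat \<Rightarrow> nat \<Rightarrow> 'a::field tensor3 \<Rightarrow> bool" where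
  "concise n1 n2 n3 T \<longleftrightarrow> concise1 n1 n2 n3 T \<and> concise1 n2 n1 n3 (\<lambda>i j k. T j i k) \<and> concise1 n3 n2 n1 (\<lambda>i j k. T k j i)"

lemma concise1_swap23: "concise1 n1 n3 n2 (\<lambda>i j k. T i k j) \<longleftrightarrow> concise1 n1 n2 n3 T"
  unfolding concise1_def by blast

lemma concise_swap12: "concise n2 n1 n3 (\<lambda>i j k. T j i k) \<longleftrightarrow> concise n1 n2 n3 T"
  unfolding concise_def
  using concise1_swap23[of n3 n1 n2 "\<lambda>i j k. T k j i"] by blast

lemma concise_swap23: "concise n1 n3 n2 (\<lambda>i j k. T i k j) \<longleftrightarrow> concise n1 n2 n3 T"
  unfolding concise_def
  using concise1_swap23[of n1 n3 n2 T] concise1_swap23[of n2 n3 n1 "\<lambda>i j k. T j i k"]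
    concise1_swap23[of n3 n1 n2 "\<lambda>i j k. T k j i"] by blast

definition equivalent ::
  "nat \<Rightarrow> nat \<Rightarrow> nat \<Rightarrow> 'a::field tensor3 \<Rightarrow> nat \<Rightarrow> nat \<Rightarrow> nat \<Rightarrow> 'a tensor3 \<Rightarrow> bool" where
  "equivalent n1 n2 n3 T m1 m2 m3 S \<longleftrightarrow> restricts n1 n2 n3 T m1 m2 m3 S \<and> restricts m1 m2 m3 S n1 n2 n3 T"

lemma equivalent_trans:
  "equivalent n1 n2 n3 T m1 m2 m3 S \<Longrightarrow> equivalent m1 m2 m3 S l1 l2 l3 R \<Longrightarrow> equivalent n1 n2 n3 T l1 l2 l3 R"
  unfolding equivalent_def using restricts_trans by blast

lemma tri_cong:
  assumes "\<And>i. i < n1 \<Longrightarrow> x i = x' i" "\<And>i. i < n2 \<Longrightarrow> y i = y' i" "\<And>i. i < n3 \<Longrightarrow> z i = z' i"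
  shows "tri n1 n2 n3 T x y z = tri n1 n2 n3 T x' y' z'"
  unfolding tri_def using assms by simp

lemma expand_unit_vectors: "i < n \<Longrightarrow> x i = (\<Sum>l<n. x l * of_bool (i = l))" for x :: "nat \<Rightarrow> 'a::field"
  by (simp add: if_distrib of_bool_def cong: if_cong)

lemma tri_unit23:
  assumes "b < n2" "c < n3"
  shows "tri n1 n2 n3 T x (\<lambda>j. of_bool (j = b)) (\<lambda>k. of_bool (k = c)) = (\<Sum>i<n1. x i * T i b c)"
proof -
  have "tri n1 n2 n3 T x (\<lambda>j. of_bool (j = b)) (\<lambda>k. of_bool (k = c))
     = tri n1 n2 n3 T (\<lambda>i. \<Sum>l<n1. x l * of_bool (i = l)) (\<lambda>j. of_bool (j = b)) (\<lambda>k. of_bool (k = c))"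
    by (rule tri_cong) (simp_all add: expand_unit_vectors[symmetric])
  then show ?thesis unfolding tri_sum1 using assms by (simp add: tri_unit_vectors)
qed

lemma tri_eq_0_if_slices:
  assumes "\<forall>j<n2. \<forall>k<n3. (\<Sum>i<n1. x i * T i j k) = 0"
  shows "tri n1 n2 n3 T x y z = 0"
proof -
  have "tri n1 n2 n3 T x y z = tri n1 n2 n3 T x (\<lambda>j. \<Sum>l<n2. y l * of_bool (j = l)) (\<lambda>k. \<Sum>l<n3. z l * of_bool (k = l))"
    by (rule tri_cong) (simp_all add: expand_unit_vectors[symmetric])
  also have "\<dots> = (\<Sum>a<n2. y a * (\<Sum>b<n3. z b * (\<Sum>i<n1. x i * T i a b)))"
    unfolding tri_sum2 unfolding tri_sum3 by (simp add: tri_unit23)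
  also have "\<dots> = 0" using assms by simp
  finally show ?thesis .
qed

text \<open>More than \<open>m1\<close> vectors in a space of dimension \<open>m1\<close> are
  dependent, and a dependency among the \<open>X a\<close> is one among the slices of
  \<open>T\<close>.\<close>

lemma concise1_le:
  fixes T S :: "'a::field tensor3"
  assumes "concise1 n1 n2 n3 T" "restricts m1 m2 m3 S n1 n2 n3 T"
  shows "n1 \<le> m1"
proof (rule ccontr)
  assume "\<not> n1 \<le> m1"
  obtain X Y Z where
    T: "\<And>a b c. a < n1 \<Longrightarrow> b < n2 \<Longrightarrow> c < n3 \<Longrightarrow> T a b c = tri m1 m2 m3 S (X a) (Y b) (Z c)"
    using assms(2) unfolding restricts_def by blast
  obtain v where v: "\<exists>a\<in>{..<n1}. v a \<noteq> 0" "\<And>i. i < m1 \<Longrightarrow> (\<Sum>a<n1. v a * X a i) = 0"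
    using homogeneous_system[of "{..<m1}" "{..<n1}" "\<lambda>i a. X a i"] \<open>\<not> n1 \<le> m1\<close> by auto
  have "(\<Sum>a<n1. v a * T a b c) = 0" if "b < n2" "c < n3" for b c
  proof -
    have "(\<Sum>a<n1. v a * T a b c) = (\<Sum>a<n1. v a * tri m1 m2 m3 S (X a) (Y b) (Z c))"
      using T that by simp
    also have "\<dots> = tri m1 m2 m3 S (\<lambda>i. \<Sum>a<n1. v a * X a i) (Y b) (Z c)" by (rule tri_sum1[symmetric])
    also have "\<dots> = tri m1 m2 m3 S (\<lambda>i. 0) (Y b) (Z c)" by (rule tri_cong) (use v in auto)
    also have "\<dots> = 0" by (simp add: tri_def)
    finally show ?thesis .
  qed
  then show False using assms(1) v(1) unfolding concise1_def by blast
qed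

text \<open>A dependency with nonzero coefficient at \<open>i0\<close> recovers that slice from the
  others, so deleting it can be undone by a restriction; \<open>f\<close> enumerates the remaining
  indices.\<close>

lemma drop_slice:
  fixes T :: "'a::field tensor3"
  assumes "\<not> concise1 n1 n2 n3 T"
  shows "n1 \<ge> 1 \<and> (\<exists>S. equivalent n1 n2 n3 T (n1 - 1) n2 n3 S)"
proof -
  obtain x i0 where x: "\<And>j k. j < n2 \<Longrightarrow> k < n3 \<Longrightarrow> (\<Sum>i<n1. x i * T i j k) = 0" and i0: "i0 < n1" "x i0 \<noteq> 0"
    using assms unfolding concise1_def by blast
  define f where "f a = (if a < i0 then a else Suc a)" for a :: nat
  have f_lt: "f a < n1" if "a < n1 - 1" for a using that by (auto simp: f_def)
  have bij: "bij_betw f {..<n1 - 1} ({..<n1} - {i0})"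
    by (rule bij_betw_byWitness[of _ "\<lambda>b. if b < i0 then b else b - 1"]) (use i0 in \<open>auto simp: f_def\<close>)
  define S where "S a b c = T (f a) b c" for a b c
  have "restricts n1 n2 n3 T (n1 - 1) n2 n3 S"
    by (rule restricts_select[of _ f _ _ id _ _ id]) (auto simp: S_def f_lt)
  moreover have "restricts (n1 - 1) n2 n3 S n1 n2 n3 T"
  proof (rule restrictsI[of _ _ _ _ _ _ _ _
        "\<lambda>a i. if a = i0 then - x (f i) / x i0 else of_bool (f i = a)" "\<lambda>b j. of_bool (j = b)" "\<lambda>c k. of_bool (k = c)"])
    fix a b c assume abc: "a < n1" "b < n2" "c < n3"
    define g where "g i = (if a = i0 then - x i / x i0 else of_bool (i = a))" for i
    have "tri (n1 - 1) n2 n3 S (\<lambda>i. if a = i0 then - x (f i) / x i0 else of_bool (f i = a)) (\<lambda>j. of_bool (j = b)) (\<lambda>k. of_bool (k = c))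
        = (\<Sum>i<n1 - 1. g (f i) * T (f i) b c)"
      using abc by (subst tri_unit23) (auto simp: S_def g_def)
    also have "\<dots> = (\<Sum>i\<in>{..<n1} - {i0}. g i * T i b c)"
      by (rule sum.reindex_bij_betw[OF bij, of "\<lambda>i. g i * T i b c"])
    also have "\<dots> = T a b c"
    proof (cases "a = i0")
      case True
      have "0 = x i0 * T i0 b c + (\<Sum>i\<in>{..<n1} - {i0}. x i * T i b c)"
        using x[OF abc(2,3)] i0 by (simp add: sum.remove[of "{..<n1}" i0])
      then have "(\<Sum>i\<in>{..<n1} - {i0}. x i * T i b c) = - (x i0 * T i0 b c)"
        by (simp add: eq_neg_iff_add_eq_0 add.commute)
      moreover have "(\<Sum>i\<in>{..<n1} - {i0}. g i * T i b c) = - (1 / x i0) * (\<Sum>i\<in>{..<n1} - {i0}. x i * T i b c)"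
        using True by (simp add: g_def sum_distrib_left sum_negf[symmetric] sum_divide_distrib)
      ultimately show ?thesis using i0 True by simp
    next
      case False
      have "(\<Sum>i\<in>{..<n1} - {i0}. g i * T i b c) = (\<Sum>i\<in>{..<n1} - {i0}. if i = a then T i b c else 0)"
        using False by (intro sum.cong) (auto simp: g_def)
      then show ?thesis using False abc by simp
    qed
    finally show "T a b c = tri (n1 - 1) n2 n3 S (\<lambda>i. if a = i0 then - x (f i) / x i0 else of_bool (f i = a))
       (\<lambda>j. of_bool (j = b)) (\<lambda>k. of_bool (k = c))" ..
  qed
  ultimately show ?thesis using i0 unfolding equivalent_def by (intro conjI exI[of _ S]) auto
qed

text \<open>Otherwise a slice of \<open>S\<close> could be dropped, and \<open>T\<close> would be a
  restriction of a tensor of smaller first dimension, against \<open>concise1_le\<close>.\<close>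

lemma concise1_transfer:
  assumes "concise1 n1 n2 n3 T" "restricts n1 m2 m3 S n1 n2 n3 T"
  shows "concise1 n1 m2 m3 S"
proof (rule ccontr)
  assume "\<not> ?thesis"
  from drop_slice[OF this] obtain R where "n1 \<ge> 1" "restricts (n1 - 1) m2 m3 R n1 m2 m3 S"
    unfolding equivalent_def by blast
  then have "restricts (n1 - 1) m2 m3 R n1 n2 n3 T" using assms(2) restricts_trans by blast
  from concise1_le[OF assms(1) this] \<open>n1 \<ge> 1\<close> show False by simp
qed

lemma concise_transfer:
  assumes "concise n1 n2 n3 T" "restricts n1 n2 n3 S n1 n2 n3 T"
  shows "concise n1 n2 n3 S"
  using assms concise1_transfer[of n1 n2 n3 T n2 n3 S]
    concise1_transfer[of n2 n1 n3 "\<lambda>i j k. T j i k" n1 n3 "\<lambda>i j k. S j i k"] restricts_swap12[of n2 n1 n3 S n2 n1 n3 T]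
    concise1_transfer[of n3 n2 n1 "\<lambda>i j k. T k j i" n2 n1 "\<lambda>i j k. S k j i"] restricts_swap13[of n3 n2 n1 S n3 n2 n1 T]
  unfolding concise_def by blast

lemma exists_equivalent_concise:
  fixes T :: "'a::field tensor3"
  shows "\<exists>m1 m2 m3 S. equivalent n1 n2 n3 T m1 m2 m3 S \<and> concise m1 m2 m3 S"
proof (induction "n1 + n2 + n3" arbitrary: n1 n2 n3 T rule: less_induct)
  case less
  show ?case
  proof (cases "concise n1 n2 n3 T")
    case True
    then show ?thesis using restricts_refl unfolding equivalent_def by blast
  next
    case False
    have step: ?thesis if "equivalent n1 n2 n3 T l1 l2 l3 R" "l1 + l2 + l3 < n1 + n2 + n3" for l1 l2 l3 R
      using less[OF that(2), of R] equivalent_trans[OF that(1)] by blast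
    from False consider "\<not> concise1 n1 n2 n3 T" | "\<not> concise1 n2 n1 n3 (\<lambda>i j k. T j i k)" | "\<not> concise1 n3 n2 n1 (\<lambda>i j k. T k j i)"
      unfolding concise_def by blast
    then show ?thesis
    proof cases
      case 1
      from drop_slice[OF this] show ?thesis using step by fastforce
    next
      case 2
      from drop_slice[OF this] obtain R where R: "n2 \<ge> 1" "equivalent n2 n1 n3 (\<lambda>i j k. T j i k) (n2 - 1) n1 n3 R" by blast
      have "equivalent n1 n2 n3 T n1 (n2 - 1) n3 (\<lambda>i j k. R j i k)"
        using R(2) restricts_swap12[of n2 n1 n3 T "n2 - 1" n1 n3 "\<lambda>i j k. R j i k"]
          restricts_swap12[of "n2 - 1" n1 n3 "\<lambda>i j k. R j i k" n2 n1 n3 T]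
        unfolding equivalent_def by (simp only:)
      then show ?thesis by (rule step) (use R in auto)
    next
      case 3
      from drop_slice[OF this] obtain R where R: "n3 \<ge> 1" "equivalent n3 n2 n1 (\<lambda>i j k. T k j i) (n3 - 1) n2 n1 R" by blast
      have "equivalent n1 n2 n3 T n1 n2 (n3 - 1) (\<lambda>i j k. R k j i)"
        using R(2) restricts_swap13[of n3 n2 n1 T "n3 - 1" n2 n1 "\<lambda>i j k. R k j i"]
          restricts_swap13[of "n3 - 1" n2 n1 "\<lambda>i j k. R k j i" n3 n2 n1 T]
        unfolding equivalent_def by (simp only:)
      then show ?thesis by (rule step) (use R in auto)
    qed
  qed
qed

lemma asymptotic_subrank_equivalent:
  assumes "equivalent n1 n2 n3 T m1 m2 m3 S" "nonzero_on n1 n2 n3 T"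
  shows "asymptotic_subrank n1 n2 n3 T = asymptotic_subrank m1 m2 m3 S" "nonzero_on m1 m2 m3 S"
proof -
  show "nonzero_on m1 m2 m3 S" using assms restricts_nonzero_on unfolding equivalent_def by blast
  then show "asymptotic_subrank n1 n2 n3 T = asymptotic_subrank m1 m2 m3 S"
    using assms asymptotic_subrank_mono unfolding equivalent_def by (intro antisym) blast+
qed

section \<open>Independent families and changes of basis\<close>

definition indep_family :: "nat \<Rightarrow> (nat \<Rightarrow> nat \<Rightarrow> 'a::field) \<Rightarrow> bool" where
  "indep_family n X \<longleftrightarrow> (\<forall>c. (\<forall>i<n. (\<Sum>a<n. c a * X a i) = 0) \<longrightarrow> (\<forall>a<n. c a = 0))"

text \<open>The \<open>n + 1\<close> vectors consisting of the family and \<open>v\<close> are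
  dependent, and the coefficient of \<open>v\<close>, which carries the index \<open>n\<close>,
  cannot vanish.\<close>

lemma indep_family_span:
  assumes "indep_family n X"
  shows "\<exists>c. \<forall>i<n. v i = (\<Sum>a<n. c a * X a i)"
proof -
  obtain w where w: "\<exists>s\<in>{..n}. w s \<noteq> 0" "\<And>i. i < n \<Longrightarrow> (\<Sum>s\<le>n. w s * (if s = n then v i else X s i)) = 0"
    using homogeneous_system[of "{..<n}" "{..n}" "\<lambda>i s. if s = n then v i else X s i"] by auto
  have eq: "(\<Sum>a<n. w a * X a i) + w n * v i = 0" if "i < n" for i
    using w(2)[OF that] by (simp add: lessThan_Suc_atMost[symmetric])
  have "w n \<noteq> 0"
  proof
    assume "w n = 0"
    then have "\<forall>a<n. w a = 0" using eq assms unfolding indep_family_def by simp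
    then show False using w(1) \<open>w n = 0\<close> by (metis atMost_iff le_neq_implies_less)
  qed
  have "v i = (\<Sum>a<n. - w a / w n * X a i)" if "i < n" for i
  proof -
    have "(\<Sum>a<n. - w a / w n * X a i) = (\<Sum>a<n. (- 1 / w n) * (w a * X a i))"
      by (intro sum.cong) simp_all
    also have "\<dots> = (- 1 / w n) * (\<Sum>a<n. w a * X a i)" by (rule sum_distrib_left[symmetric])
    also have "(\<Sum>a<n. w a * X a i) = - (w n * v i)" using eq[OF that] by (simp add: eq_neg_iff_add_eq_0)
    also have "(- 1 / w n) * - (w n * v i) = v i" using \<open>w n \<noteq> 0\<close> by simp
    finally show ?thesis ..
  qed
  then show ?thesis by (intro exI[of _ "\<lambda>a. - w a / w n"]) blast
qed

text \<open>Expanding the unit vectors in the three families gives the matrices of the inverse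
  restriction.\<close>

lemma restricts_basis_change:
  assumes S: "\<And>a b c. a < n1 \<Longrightarrow> b < n2 \<Longrightarrow> c < n3 \<Longrightarrow> S a b c = tri n1 n2 n3 T (X a) (Y b) (Z c)"
    and ind: "indep_family n1 X" "indep_family n2 Y" "indep_family n3 Z"
  shows "equivalent n1 n2 n3 T n1 n2 n3 S"
proof -
  obtain C1 where C1: "\<And>a i. i < n1 \<Longrightarrow> of_bool (i = a) = (\<Sum>l<n1. C1 a l * X l i)"
    using indep_family_span[OF ind(1), of "\<lambda>i. of_bool (i = _)"] by metis
  obtain C2 where C2: "\<And>a i. i < n2 \<Longrightarrow> of_bool (i = a) = (\<Sum>l<n2. C2 a l * Y l i)"
    using indep_family_span[OF ind(2), of "\<lambda>i. of_bool (i = _)"] by metis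
  obtain C3 where C3: "\<And>a i. i < n3 \<Longrightarrow> of_bool (i = a) = (\<Sum>l<n3. C3 a l * Z l i)"
    using indep_family_span[OF ind(3), of "\<lambda>i. of_bool (i = _)"] by metis
  have "restricts n1 n2 n3 S n1 n2 n3 T"
  proof (rule restrictsI[of _ _ _ _ _ _ _ _ C1 C2 C3])
    fix a b c assume "a < n1" "b < n2" "c < n3"
    then have "T a b c = tri n1 n2 n3 T (\<lambda>i. of_bool (i = a)) (\<lambda>j. of_bool (j = b)) (\<lambda>k. of_bool (k = c))"
      by (simp add: tri_unit_vectors)
    also have "\<dots> = tri n1 n2 n3 T (\<lambda>i. \<Sum>l<n1. C1 a l * X l i) (\<lambda>i. \<Sum>l<n2. C2 b l * Y l i) (\<lambda>i. \<Sum>l<n3. C3 c l * Z l i)"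
      by (rule tri_cong) (simp_all only: C1 C2 C3)
    also have "\<dots> = tri n1 n2 n3 S (C1 a) (C2 b) (C3 c)" by (rule tri_compose[symmetric]) (rule S)
    finally show "T a b c = tri n1 n2 n3 S (C1 a) (C2 b) (C3 c)" .
  qed
  moreover have "restricts n1 n2 n3 T n1 n2 n3 S" by (rule restrictsI) (rule S)
  ultimately show ?thesis unfolding equivalent_def by blast
qed

section \<open>Spaces of matrices of rank at most one\<close>

text \<open>The hypotheses are the coefficients of the 2 x 2 minors of a general combination of the
  matrices \<open>F v\<close>. A nonzero member is a product of \<open>u\<close> and
  \<open>r\<close>; the polarized minors through its pivot write each member as
  \<open>u A + B r\<close>, and the remaining ones allow a nonzero \<open>B\<close> only if every
  \<open>A\<close> is a multiple of \<open>r\<close>.\<close>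

lemma rank_one_space:
  fixes F :: "nat \<Rightarrow> nat \<Rightarrow> nat \<Rightarrow> 'a::field"
  assumes minor: "\<And>v j j' k k'. v < n \<Longrightarrow> j < m \<Longrightarrow> j' < m \<Longrightarrow> k < l \<Longrightarrow> k' < l \<Longrightarrow>
      F v j k * F v j' k' = F v j k' * F v j' k"
    and polar: "\<And>v w j j' k k'. v < n \<Longrightarrow> w < n \<Longrightarrow> j < m \<Longrightarrow> j' < m \<Longrightarrow> k < l \<Longrightarrow> k' < l \<Longrightarrow>
      F v j k * F w j' k' + F w j k * F v j' k' = F v j k' * F w j' k + F w j k' * F v j' k"
  shows "(\<exists>u r. \<forall>v<n. \<forall>j<m. \<forall>k<l. F v j k = u j * r v k) \<or> (\<exists>u r. \<forall>v<n. \<forall>j<m. \<forall>k<l. F v j k = u v j * r k)"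
proof (cases "\<forall>v<n. \<forall>j<m. \<forall>k<l. F v j k = 0")
  case True
  then show ?thesis by (intro disjI1 exI[of _ "\<lambda>_. 0"]) auto
next
  case False
  then obtain v0 j0 k0 where 0: "v0 < n" "j0 < m" "k0 < l" and c0: "F v0 j0 k0 \<noteq> 0" by blast
  define c where "c = F v0 j0 k0"
  have c: "c \<noteq> 0" using c0 by (simp add: c_def)
  define u where "u j = F v0 j k0" for j
  define r where "r k = F v0 j0 k / c" for k
  define A where "A v k = F v j0 k / c" for v k
  define B where "B v j = F v j k0 - u j * F v j0 k0 / c" for v j
  have ur: "F v0 j k = u j * r k" if "j < m" "k < l" for j k
    using minor[OF 0(1) that(1) 0(2) that(2) 0(3)] c by (simp add: u_def r_def c_def field_simps)
  have F: "F v j k = u j * A v k + r k * B v j" if v: "v < n" and jk: "j < m" "k < l" for v j k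
  proof -
    have "F v0 j k * F v j0 k0 + F v j k * c = u j * F v j0 k + F v j k0 * (c * r k)"
      using polar[OF 0(1) v jk(1) 0(2) jk(2) 0(3)] c by (simp add: u_def r_def c_def)
    then have "F v j k * c = u j * F v j0 k + F v j k0 * (c * r k) - u j * r k * F v j0 k0"
      unfolding ur[OF jk] by (simp add: algebra_simps)
    also have "\<dots> = (u j * A v k + r k * B v j) * c"
      unfolding A_def B_def using c by (simp add: field_simps)
    finally have "F v j k * c = (u j * A v k + r k * B v j) * c" .
    then show ?thesis using c by simp
  qed
  have Fj0: "F v j0 k = c * A v k" for v k using c by (simp add: A_def)
  have Fk0: "F v j k0 = u j * A v k0 + B v j" for v j using c by (simp add: A_def B_def)
  have BA: "B v j * (A w k - r k * A w k0) + B w j * (A v k - r k * A v k0) = 0"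
    if v: "v < n" "w < n" and jk: "j < m" "k < l" for v w j k
  proof -
    have "c * (B v j * (A w k - r k * A w k0) + B w j * (A v k - r k * A v k0)) = 0"
      using polar[OF v jk(1) 0(2) jk(2) 0(3)]
      unfolding Fj0 unfolding Fk0 F[OF v(1) jk] F[OF v(2) jk] by (simp add: algebra_simps)
    then show ?thesis using c by simp
  qed
  have BA1: "B v j * (A v k - r k * A v k0) = 0" if v: "v < n" and jk: "j < m" "k < l" for v j k
  proof -
    have "c * (B v j * (A v k - r k * A v k0)) = 0"
      using minor[OF v jk(1) 0(2) jk(2) 0(3)]
      unfolding Fj0 unfolding Fk0 F[OF v jk] by (auto simp: algebra_simps)
    then show ?thesis using c by simp
  qed
  show ?thesis
  proof (cases "\<forall>v<n. \<forall>j<m. B v j = 0")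
    case True
    then show ?thesis using F by (intro disjI1 exI[of _ u] exI[of _ A]) simp
  next
    case False
    then obtain v1 j1 where 1: "v1 < n" "j1 < m" "B v1 j1 \<noteq> 0" by blast
    then have A1: "A v1 k - r k * A v1 k0 = 0" if "k < l" for k using BA1[of v1 j1 k] that by simp
    have "A w k - r k * A w k0 = 0" if "w < n" "k < l" for w k
      using BA[OF 1(1) that(1) 1(2) that(2)] A1[OF that(2)] 1(3) by simp
    then have "F w j k = (u j * A w k0 + B w j) * r k" if "w < n" "j < m" "k < l" for w j k
      using F[OF that] that by (simp add: algebra_simps)
    then show ?thesis by (intro disjI2 exI[of _ "\<lambda>w j. u j * A w k0 + B w j"] exI[of _ r]) simp
  qed
qed

text \<open>Otherwise all combinations of slices share a column or a row direction by
  \<open>rank_one_space\<close>, and a vector orthogonal to it contradicts conciseness in the second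
  or the third factor.\<close>

lemma exists_rank_two_slice:
  fixes T :: "'a::field tensor3"
  assumes con: "concise n1 n2 n3 T" and n: "n2 \<ge> 2" "n3 \<ge> 2"
  shows "\<exists>x j j' k k'. j < n2 \<and> j' < n2 \<and> k < n3 \<and> k' < n3 \<and>
    (\<Sum>i<n1. x i * T i j k) * (\<Sum>i<n1. x i * T i j' k') \<noteq> (\<Sum>i<n1. x i * T i j k') * (\<Sum>i<n1. x i * T i j' k)"
proof (rule ccontr)
  assume "\<not> ?thesis"
  then have all: "(\<Sum>i<n1. x i * T i j k) * (\<Sum>i<n1. x i * T i j' k') = (\<Sum>i<n1. x i * T i j k') * (\<Sum>i<n1. x i * T i j' k)"
    if "j < n2" "j' < n2" "k < n3" "k' < n3" for x j j' k k'
    using that by blast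
  have unit: "(\<Sum>i<n1. of_bool (i = v) * T i j k) = T v j k" if "v < n1" for v j k
  proof -
    have "(\<Sum>i<n1. of_bool (i = v) * T i j k) = (\<Sum>i<n1. if i = v then T i j k else 0)" by (intro sum.cong) auto
    then show ?thesis using that by simp
  qed
  have minor: "T v j k * T v j' k' = T v j k' * T v j' k"
    if "v < n1" "j < n2" "j' < n2" "k < n3" "k' < n3" for v j j' k k'
    using all[OF that(2-5), of "\<lambda>i. of_bool (i = v)"] unfolding unit[OF that(1)] .
  have polar: "T v j k * T w j' k' + T w j k * T v j' k' = T v j k' * T w j' k + T w j k' * T v j' k"
    if "v < n1" "w < n1" "j < n2" "j' < n2" "k < n3" "k' < n3" for v w j j' k k'
  proof -
    have sum: "(\<Sum>i<n1. (of_bool (i = v) + of_bool (i = w)) * T i j k) = T v j k + T w j k" for j k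
      by (simp add: distrib_right sum.distrib unit that)
    have "(T v j k + T w j k) * (T v j' k' + T w j' k') = (T v j k' + T w j k') * (T v j' k + T w j' k)"
      using all[OF that(3-6), of "\<lambda>i. of_bool (i = v) + of_bool (i = w)"] unfolding sum .
    then show ?thesis using minor[OF that(1,3-6)] minor[OF that(2-6)] by (simp add: algebra_simps)
  qed
  have kernel: "\<exists>y. (\<exists>s<n. y s \<noteq> 0) \<and> (\<Sum>s<n. y s * u s) = 0" if "n \<ge> 2" for n and u :: "nat \<Rightarrow> 'a"
    using homogeneous_system[of "{()}" "{..<n}" "\<lambda>_ s. u s"] that by auto
  have "(\<exists>u r. \<forall>v<n1. \<forall>j<n2. \<forall>k<n3. T v j k = u j * r v k) \<or> (\<exists>u r. \<forall>v<n1. \<forall>j<n2. \<forall>k<n3. T v j k = u v j * r k)"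
    by (rule rank_one_space[of n1 n2 n3 T]; (rule minor | rule polar); assumption)
  then show False
  proof (elim disjE exE)
    fix u r assume F: "\<forall>v<n1. \<forall>j<n2. \<forall>k<n3. T v j k = u j * r v k"
    obtain y where y: "\<exists>s<n2. y s \<noteq> 0" "(\<Sum>s<n2. y s * u s) = 0" using kernel[OF n(1)] by blast
    have "(\<Sum>s<n2. y s * T v s k) = 0" if "v < n1" "k < n3" for v k
    proof -
      have "(\<Sum>s<n2. y s * T v s k) = (\<Sum>s<n2. y s * u s) * r v k"
        using F that by (simp add: sum_distrib_right mult.assoc)
      then show ?thesis using y by simp
    qed
    then show False using con y(1) unfolding concise_def concise1_def by blast
  next
    fix u r assume F: "\<forall>v<n1. \<forall>j<n2. \<forall>k<n3. T v j k = u v j * r k"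
    obtain y where y: "\<exists>s<n3. y s \<noteq> 0" "(\<Sum>s<n3. y s * r s) = 0" using kernel[OF n(2)] by blast
    have "(\<Sum>s<n3. y s * T v j s) = 0" if "v < n1" "j < n2" for v j
    proof -
      have "(\<Sum>s<n3. y s * T v j s) = (\<Sum>s<n3. y s * r s) * u v j"
        using F that by (simp add: sum_distrib_left sum_distrib_right ac_simps)
      then show ?thesis using y by simp
    qed
    then show False using con y(1) unfolding concise_def concise1_def by blast
  qed
qed

section \<open>Concise tensors with a factor of dimension two\<close>

lemma tri_nested: "tri n1 n2 n3 T x y z = (\<Sum>i<n1. x i * (\<Sum>j<n2. y j * (\<Sum>k<n3. z k * T i j k)))"
  unfolding tri_def by (simp add: sum_distrib_left mult.assoc)

lemma tri_nested_mid: "tri n1 n2 n3 T x y z = (\<Sum>i<n1. x i * (\<Sum>k<n3. z k * (\<Sum>j<n2. y j * T i j k)))"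
  using tri_nested[of n1 n3 n2 "\<lambda>i j k. T i k j" x z y] tri_swap23[of n1 n3 n2 T x z y] by simp

lemma nonzero_onI: "i < n1 \<Longrightarrow> j < n2 \<Longrightarrow> k < n3 \<Longrightarrow> T i j k \<noteq> 0 \<Longrightarrow> nonzero_on n1 n2 n3 T"
  unfolding nonzero_on_def by blast

lemma concise1D:
  "concise1 n1 n2 n3 T \<Longrightarrow> (\<And>j k. j < n2 \<Longrightarrow> k < n3 \<Longrightarrow> (\<Sum>i<n1. x i * T i j k) = 0) \<Longrightarrow> i < n1 \<Longrightarrow> x i = 0"
  unfolding concise1_def by blast

lemma sum_less_2: "(\<Sum>i<2::nat. f i) = f 0 + f 1" for f :: "nat \<Rightarrow> 'a::comm_monoid_add"
  by (simp add: numeral_2_eq_2)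

lemma sum_unit: "l < n \<Longrightarrow> (\<Sum>i<n. of_bool (i = l) * f i) = f l" for f :: "nat \<Rightarrow> 'a::field"
proof -
  assume "l < n"
  have "(\<Sum>i<n. of_bool (i = l) * f i) = (\<Sum>i<n. if i = l then f i else 0)" by (intro sum.cong) auto
  then show ?thesis using \<open>l < n\<close> by simp
qed

text \<open>The weight is the second index minus the third, so \<open>S 0 1 0\<close> and
  \<open>S 1 1 0\<close> have positive weight and may be arbitrary.\<close>

lemma diagonal_pattern_lower_bound:
  fixes S :: "'a::field tensor3"
  assumes "S 0 0 0 \<noteq> 0" "S 1 1 1 \<noteq> 0" "S 1 0 0 = 0" "S 0 1 1 = 0" "S 0 0 1 = 0" "S 1 0 1 = 0"
  shows "2 \<le> asymptotic_subrank 2 2 2 S"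
proof -
  have "card {0, 1::nat} \<le> asymptotic_subrank 2 2 2 S"
    by (rule asymptotic_subrank_ge_matching[of "{0, 1}" "\<lambda>p. p" _ "\<lambda>p. p" _ "\<lambda>p. p" _ _ "\<lambda>_. 0" int "\<lambda>s. - int s"])
      (use assms in auto)
  then show ?thesis by simp
qed

text \<open>In terms of the indices the weight is \<open>(1 - i) - 2 * j + (1 - k)\<close>. It is
  positive at \<open>S 0 0 0\<close>, \<open>S 1 0 0\<close> and \<open>S 0 0 1\<close>, which may
  be arbitrary.\<close>

lemma antidiagonal_pattern_lower_bound:
  fixes S :: "'a::field tensor3"
  assumes "S 0 1 0 \<noteq> 0" "S 1 0 1 \<noteq> 0" "S 0 1 1 = 0" "S 1 1 0 = 0" "S 1 1 1 = 0"
  shows "2 \<le> asymptotic_subrank 2 2 2 S"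
proof -
  have "card {0, 1::nat} \<le> asymptotic_subrank 2 2 2 S"
    by (rule asymptotic_subrank_ge_matching[of "{0, 1}" "\<lambda>p. p" _ "\<lambda>p. 1 - p" _ "\<lambda>p. p" _ _
          "\<lambda>p. 1 - int p" "\<lambda>p. 2 * int p - 2" "\<lambda>p. 1 - int p"])
      (use assms in auto)
  then show ?thesis by simp
qed

text \<open>A rank-two slice \<open>M\<close> has two rows and at least three columns, hence a
  kernel vector \<open>z\<close>. By conciseness \<open>z\<close> is not killed by all slices; a
  slice \<open>j1\<close> on which it gives a nonzero column \<open>p\<close> supplies the second
  diagonal entry, while \<open>M\<close> supplies the first.\<close>

lemma concise_two_lower_bound:
  fixes T :: "'a::field tensor3"
  assumes con: "concise 2 n2 n3 T" and n: "n2 \<ge> 2" "n3 \<ge> 3"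
  shows "2 \<le> asymptotic_subrank 2 n2 n3 T"
proof -
  have con': "concise n2 2 n3 (\<lambda>i j k. T j i k)" using con concise_swap12[of n2 2 n3 T] by blast
  obtain x j j' k k' where jk: "j < 2" "j' < 2" "k < n3" "k' < n3" and
    minor: "(\<Sum>i<n2. x i * T j i k) * (\<Sum>i<n2. x i * T j' i k') \<noteq> (\<Sum>i<n2. x i * T j i k') * (\<Sum>i<n2. x i * T j' i k)"
    using exists_rank_two_slice[OF con'] n by auto
  define M where "M i k = (\<Sum>j<n2. x j * T i j k)" for i k
  have M: "M 0 k * M 1 k' \<noteq> M 0 k' * M 1 k"
  proof -
    have "j = 0 \<and> j' = 1 \<or> j = 1 \<and> j' = 0 \<or> j = j'" using jk by auto
    then show ?thesis using minor unfolding M_def[symmetric] by (auto simp: mult.commute)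
  qed
  obtain z where z: "\<exists>k\<in>{..<n3}. z k \<noteq> 0" "\<And>i. i < 2 \<Longrightarrow> (\<Sum>k<n3. z k * M i k) = 0"
    using homogeneous_system[of "{..<2}" "{..<n3}" "\<lambda>i k. M i k"] n by auto
  obtain i1 j1 where ij1: "i1 < 2" "j1 < n2" "(\<Sum>k<n3. z k * T i1 j1 k) \<noteq> 0"
    using con z(1) unfolding concise_def concise1_def by blast
  define p where "p i = (\<Sum>k<n3. z k * T i j1 k)" for i
  have p: "p 0 \<noteq> 0 \<or> p 1 \<noteq> 0" using ij1 by (auto simp: p_def less_2_cases_iff)
  \<comment> \<open>Columns \<open>k\<close> and \<open>k'\<close> of \<open>M\<close> are
    independent, so they are not both parallel to \<open>p\<close>.\<close>
  have "\<exists>k1<n3. p 0 * M 1 k1 \<noteq> p 1 * M 0 k1"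
  proof (rule ccontr)
    assume "\<not> ?thesis"
    then have e: "p 0 * M 1 k = p 1 * M 0 k" "p 0 * M 1 k' = p 1 * M 0 k'" using jk by auto
    have "p 0 * (M 0 k * M 1 k' - M 0 k' * M 1 k) = M 0 k * (p 0 * M 1 k') - M 0 k' * (p 0 * M 1 k)"
      by (simp add: algebra_simps)
    also have "\<dots> = 0" unfolding e by (simp add: algebra_simps)
    finally have "p 0 * (M 0 k * M 1 k' - M 0 k' * M 1 k) = 0" .
    moreover have "p 1 * (M 0 k * M 1 k' - M 0 k' * M 1 k) = (p 1 * M 0 k) * M 1 k' - (p 1 * M 0 k') * M 1 k"
      by (simp add: algebra_simps)
    then have "p 1 * (M 0 k * M 1 k' - M 0 k' * M 1 k) = 0" unfolding e[symmetric] by (simp add: algebra_simps)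
    ultimately show False using p M by simp
  qed
  then obtain k1 where k1: "k1 < n3" "p 0 * M 1 k1 \<noteq> p 1 * M 0 k1" by blast
  \<comment> \<open>\<open>X 0\<close> annihilates \<open>p\<close>, and \<open>X 1\<close>
    annihilates column \<open>k1\<close> of \<open>M\<close>.\<close>
  define X where "X a i = (if a = 0 then (if i = 0 then - p 1 else p 0) else (if i = 0 then - M 1 k1 else M 0 k1))" for a i :: nat
  define Y where "Y b j = (if b = 0 then x j else of_bool (j = j1))" for b j :: nat
  define Z where "Z c k = (if c = 0 then of_bool (k = k1) else z k)" for c k :: nat
  define S where "S a b c = tri 2 n2 n3 T (X a) (Y b) (Z c)" for a b c
  have R00: "(\<Sum>k<n3. Z 0 k * (\<Sum>j<n2. Y 0 j * T i j k)) = M i k1" for i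
    using sum_unit[OF k1(1), of "M i"] by (simp add: Z_def Y_def M_def)
  have R01: "(\<Sum>k<n3. Z 1 k * (\<Sum>j<n2. Y 0 j * T 0 j k)) = 0" "(\<Sum>k<n3. Z 1 k * (\<Sum>j<n2. Y 0 j * T 1 j k)) = 0"
    using z(2)[of 0] z(2)[of 1] by (simp_all add: Z_def Y_def M_def)
  have R11: "(\<Sum>k<n3. Z 1 k * (\<Sum>j<n2. Y 1 j * T i j k)) = p i" for i
    using ij1(2) by (simp add: Z_def Y_def p_def sum_unit)
  have "S 0 0 0 \<noteq> 0" "S 1 0 0 = 0" "S 0 0 1 = 0" "S 1 0 1 = 0" "S 0 1 1 = 0" "S 1 1 1 \<noteq> 0"
    using k1(2) unfolding S_def tri_nested_mid sum_less_2 R00 R11 R01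
    by (auto simp: X_def algebra_simps)
  then have "2 \<le> asymptotic_subrank 2 2 2 S" and nz: "S 0 0 0 \<noteq> 0"
    by (blast intro!: diagonal_pattern_lower_bound)+
  moreover from nz have "nonzero_on 2 2 2 S" by (intro nonzero_onI[of 0 _ 0 _ 0]) simp_all
  moreover have "restricts 2 n2 n3 T 2 2 2 S" by (rule restrictsI) (simp add: S_def)
  ultimately show ?thesis using asymptotic_subrank_mono by fastforce
qed

lemma indep_family_2:
  assumes "X 0 0 * X 1 1 \<noteq> X 0 1 * X 1 (0::nat)"
  shows "indep_family 2 X"
  unfolding indep_family_def
proof (intro allI impI)
  fix c a assume "\<forall>i<2. (\<Sum>a<2. c a * X a i) = 0" "a < (2::nat)"
  then have e: "c 0 * X 0 0 + c 1 * X 1 0 = 0" "c 0 * X 0 1 + c 1 * X 1 1 = 0" by (auto simp: sum_less_2)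
  have "c 0 * (X 0 0 * X 1 1 - X 0 1 * X 1 0) = (c 0 * X 0 0 + c 1 * X 1 0) * X 1 1 - (c 0 * X 0 1 + c 1 * X 1 1) * X 1 0"
    "c 1 * (X 0 0 * X 1 1 - X 0 1 * X 1 0) = (c 0 * X 0 1 + c 1 * X 1 1) * X 0 0 - (c 0 * X 0 0 + c 1 * X 1 0) * X 0 1"
    by (simp_all add: algebra_simps)
  then have "c 0 = 0" "c 1 = 0" using assms e by auto
  then show "c a = 0" using \<open>a < 2\<close> by (auto simp: less_2_cases_iff)
qed

text \<open>In coordinates adapted to a singular, hence rank-one, member of the pencil, the slice
  with middle index 1 has the single entry \<open>S 0 1 0\<close>, and the other slice can be given
  \<open>S 0 0 0 = 0\<close>. If \<open>S 1 0 1\<close> is nonzero the antidiagonal pattern appears;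
  if it is zero, conciseness leaves exactly the support of the W-tensor.\<close>

lemma concise_two_two_two:
  fixes T :: "'a::alg_closed_field tensor3"
  assumes con: "concise 2 2 2 T"
  shows "2 \<le> asymptotic_subrank 2 2 2 T \<or> asymptotic_subrank 2 2 2 T = 2 powr binary_entropy (1 / 3)"
proof -
  have con': "concise 2 2 2 (\<lambda>i j k. T j i k)" using con concise_swap12[of 2 2 2 T] by blast
  obtain x j j' k k' where jk: "j < 2" "j' < 2" "k < 2" "k' < 2" and
    minor: "(\<Sum>i<2. x i * T j i k) * (\<Sum>i<2. x i * T j' i k') \<noteq> (\<Sum>i<2. x i * T j i k') * (\<Sum>i<2. x i * T j' i k)"
    using exists_rank_two_slice[OF con'] by auto
  define M where "M i k = (\<Sum>j<2. x j * T i j k)" for i k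
  have M: "M 0 0 * M 1 1 - M 0 1 * M 1 0 \<noteq> 0"
  proof -
    have "j = 0 \<or> j = 1" "j' = 0 \<or> j' = 1" "k = 0 \<or> k = 1" "k' = 0 \<or> k' = 1" using jk by auto
    then show ?thesis using minor unfolding M_def[symmetric] by (auto simp: mult.commute)
  qed
  have "x 0 \<noteq> 0 \<or> x 1 \<noteq> 0" using M by (auto simp: M_def sum_less_2)
  \<comment> \<open>\<open>e\<close> completes \<open>x\<close> to a basis of the second factor, so
    \<open>M\<close> and \<open>N\<close> span the pencil.\<close>
  then obtain e where e: "x 0 * e 1 \<noteq> x 1 * e (0::nat)"
  proof
    assume "x 0 \<noteq> 0"
    then show ?thesis by (intro that[of "\<lambda>i. of_bool (i = 1)"]) auto
  next
    assume "x 1 \<noteq> 0"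
    then show ?thesis by (intro that[of "\<lambda>i. of_bool (i = 0)"]) auto
  qed
  define N where "N i k = (\<Sum>j<2. e j * T i j k)" for i k
  \<comment> \<open>The pencil spanned by the two slices has a singular member.\<close>
  obtain l where l: "(N 0 0 - l * M 0 0) * (N 1 1 - l * M 1 1) - (N 0 1 - l * M 0 1) * (N 1 0 - l * M 1 0) = 0"
  proof -
    define f where "f k = (if k = 0 then N 0 0 * N 1 1 - N 0 1 * N 1 0
      else if k = 1 then N 0 1 * M 1 0 + M 0 1 * N 1 0 - N 0 0 * M 1 1 - M 0 0 * N 1 1
      else M 0 0 * M 1 1 - M 0 1 * M 1 0)" for k :: nat
    obtain l where "(\<Sum>k\<le>2. f k * l ^ k) = 0"
      using alg_closed[of 2 f] M by (auto simp: f_def)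
    then have "f 0 + f 1 * l + f 2 * (l * l) = 0" by (simp add: numeral_2_eq_2)
    then show ?thesis by (intro that[of l]) (simp add: f_def algebra_simps)
  qed
  define y1 where "y1 j = e j - l * x j" for j
  define P where "P i k = (\<Sum>j<2. y1 j * T i j k)" for i k
  have P_eq: "P i k = N i k - l * M i k" for i k
    by (simp add: P_def N_def M_def y1_def sum_less_2 algebra_simps)
  have detP: "P 0 0 * P 1 1 = P 0 1 * P 1 0" using l unfolding P_eq by simp
  have "y1 0 \<noteq> 0 \<or> y1 1 \<noteq> 0"
  proof (rule ccontr)
    assume "\<not> ?thesis"
    then have "e 0 = l * x 0" "e 1 = l * x 1" by (simp_all add: y1_def)
    then show False using e by simp
  qed
  moreover have "\<forall>j<2. y1 j = 0" if "\<forall>i<2. \<forall>k<2. P i k = 0"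
    using con that unfolding concise_def concise1_def P_def by blast
  moreover have "y1 0 = 0" "y1 1 = 0" if "\<forall>j<2. y1 j = 0" using that by simp_all
  ultimately have "\<not> (\<forall>i<2. \<forall>k<2. P i k = 0)" by blast
  then obtain i0 k0 where ik0: "i0 < 2" "k0 < 2" "P i0 k0 \<noteq> 0" by blast
  have ik0': "i0 = 0 \<or> i0 = 1" "k0 = 0 \<or> k0 = 1" using ik0 by auto
  define X where "X a i = (if a = 0 then of_bool (i = i0) else if i = 0 then - P 1 k0 else P 0 k0)" for a i :: nat
  define Z where "Z c k = (if c = 0 then of_bool (k = k0) else if k = 0 then - P i0 1 else P i0 0)" for c k :: nat
  \<comment> \<open>Subtracting this multiple of the singular slice from the other one makes
    \<open>S 0 0 0\<close> vanish.\<close>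
  define g where "g = M i0 k0 / P i0 k0"
  define Y where "Y b j = (if b = 0 then x j - g * y1 j else y1 j)" for b j :: nat
  define S where "S a b c = tri 2 2 2 T (X a) (Y b) (Z c)" for a b c
  have "indep_family 2 X" by (rule indep_family_2) (use ik0' ik0(3) in \<open>auto simp: X_def\<close>)
  moreover have "indep_family 2 Z" by (rule indep_family_2) (use ik0' ik0(3) in \<open>auto simp: Z_def\<close>)
  moreover have "indep_family 2 Y"
  proof (rule indep_family_2)
    have "Y 0 0 * Y 1 1 - Y 0 1 * Y 1 0 = x 0 * e 1 - x 1 * e 0"
      by (simp add: Y_def y1_def algebra_simps)
    then show "Y 0 0 * Y 1 1 \<noteq> Y 0 1 * Y 1 0" using e by auto
  qed
  ultimately have equiv: "equivalent 2 2 2 T 2 2 2 S"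
    by (intro restricts_basis_change[of 2 2 2 S T X Y Z]) (simp_all add: S_def)
  have R1: "(\<Sum>j<2. Y 1 j * T i j k) = P i k" for i k by (simp add: Y_def P_def)
  have R0: "(\<Sum>j<2. Y 0 j * T i j k) = M i k - g * P i k" for i k
    by (simp add: Y_def P_def M_def sum_less_2 algebra_simps)
  have S1: "S a 1 c = (\<Sum>i<2. X a i * (\<Sum>k<2. Z c k * P i k))" for a c
    unfolding S_def tri_nested_mid R1 ..
  have S0: "S a 0 c = (\<Sum>i<2. X a i * (\<Sum>k<2. Z c k * (M i k - g * P i k)))" for a c
    unfolding S_def tri_nested_mid R0 ..
  have ent1: "S 0 1 0 \<noteq> 0" "S 0 1 1 = 0" "S 1 1 0 = 0" "S 1 1 1 = 0"
    using ik0' ik0(3) detP unfolding S1 sum_less_2 by (auto simp: X_def Z_def algebra_simps)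
  have "M i0 k0 - g * P i0 k0 = 0" using ik0(3) by (simp add: g_def)
  then have ent0: "S 0 0 0 = 0"
    using ik0' unfolding S0 sum_less_2 by (auto simp: X_def Z_def)
  have conS: "concise 2 2 2 S" using concise_transfer[OF con] equiv unfolding equivalent_def by blast
  have nzS: "nonzero_on 2 2 2 S" using ent1 unfolding nonzero_on_def by (intro exI[of _ 0] conjI exI[of _ 1]) auto
  have nzT: "nonzero_on 2 2 2 T" using restricts_nonzero_on nzS equiv unfolding equivalent_def by blast
  note eqS = asymptotic_subrank_equivalent(1)[OF equiv nzT]
  show ?thesis
  proof (cases "S 1 0 1 = 0")
    case False
    then show ?thesis using antidiagonal_pattern_lower_bound[of S] ent1 unfolding eqS by blast
  next
    case True
    have "S 1 0 0 \<noteq> 0"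
    proof
      assume zero: "S 1 0 0 = 0"
      have "(\<Sum>i<2. of_bool (i = 1) * S i j k) = 0" if "j < 2" "k < 2" for j k
      proof -
        have "j = 0 \<or> j = 1" "k = 0 \<or> k = 1" using that by auto
        then show ?thesis using True ent1 zero by (elim disjE) (simp_all add: sum_less_2)
      qed
      then show False using conS[unfolded concise_def] concise1D[of 2 2 2 "\<lambda>i j k. S i j k" "\<lambda>i. of_bool (i = 1)" 1] by simp
    qed
    moreover have "S 0 0 1 \<noteq> 0"
    proof
      assume zero: "S 0 0 1 = 0"
      have "(\<Sum>i<2. of_bool (i = 1) * S k j i) = 0" if "j < 2" "k < 2" for j k
      proof -
        have "j = 0 \<or> j = 1" "k = 0 \<or> k = 1" using that by auto
        then show ?thesis using True ent1 zero by (elim disjE) (simp_all add: sum_less_2)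
      qed
      then show False using conS[unfolded concise_def] concise1D[of 2 2 2 "\<lambda>i j k. S k j i" "\<lambda>i. of_bool (i = 1)" 1] by simp
    qed
    ultimately have supp: "S i j k \<noteq> 0 \<longleftrightarrow> (i, j, k) \<in> {(1, 0, 0), (0, 1, 0), (0, 0, 1)}"
      if "i < 2" "j < 2" "k < 2" for i j k
      using that True ent0 ent1 unfolding less_2_cases_iff by (elim disjE) simp_all
    have "asymptotic_subrank 2 2 2 S \<le> 2 powr binary_entropy (1 / 3)"
      by (rule W_pattern_upper_bound[OF _ nzS]) (use supp in blast)
    moreover have "2 powr binary_entropy (1 / 3) \<le> asymptotic_subrank 2 2 2 S"
      by (rule W_pattern_lower_bound) (use supp in blast)
    ultimately show ?thesis unfolding eqS by simp
  qed
qed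

lemma concise_two:
  fixes T :: "'a::alg_closed_field tensor3"
  assumes con: "concise 2 n2 n3 T" and n: "n2 \<ge> 2" "n3 \<ge> 2" and nz: "nonzero_on 2 n2 n3 T"
  shows "asymptotic_subrank 2 n2 n3 T = 2 \<or> asymptotic_subrank 2 n2 n3 T = 2 powr binary_entropy (1 / 3)"
proof -
  have le: "asymptotic_subrank 2 n2 n3 T \<le> 2" using asymptotic_subrank_le_dim[OF nz] by simp
  consider "n3 \<ge> 3" | "n2 \<ge> 3" | "n2 = 2" "n3 = 2" using n by linarith
  then show ?thesis
  proof cases
    case 1
    then show ?thesis using concise_two_lower_bound[OF con] n le by simp
  next
    case 2
    have "concise 2 n3 n2 (\<lambda>i j k. T i k j)" using con concise_swap23[of 2 n3 n2 T] by simp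
    from concise_two_lower_bound[OF this] 2 n have "2 \<le> asymptotic_subrank 2 n2 n3 T"
      using asymptotic_subrank_swap23[of 2 n3 n2 T] by simp
    then show ?thesis using le by simp
  next
    case 3
    then show ?thesis using concise_two_two_two[of T] con le by auto
  qed
qed

section \<open>The constants\<close>

lemma entropy_conv_ln: "binary_entropy p * ln 2 = - p * ln p - (1 - p) * ln (1 - p)"
  by (simp add: binary_entropy_def log_def field_simps)

lemma DERIV_x_ln_x:
  assumes "0 < c * x + d"
  shows "((\<lambda>x::real. (c * x + d) * ln (c * x + d)) has_real_derivative c * (ln (c * x + d) + 1)) (at x)"
proof -
  have f: "((\<lambda>x. c * x + d) has_real_derivative c) (at x)" by (auto intro!: derivative_eq_intros)
  have "((\<lambda>x. ln (c * x + d)) has_real_derivative 1 / (c * x + d) * c) (at x)"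
    using assms by (intro DERIV_chain2[OF DERIV_ln_divide f])
  note D = DERIV_mult[OF f this]
  have eq: "1 / (c * x + d) * c * (c * x + d) = c" using assms by simp
  show ?thesis using D unfolding eq by (simp only: distrib_left mult_1_right)
qed

lemma entropy_mono:
  assumes "0 < p" "p \<le> q" "q \<le> 1 / 2"
  shows "binary_entropy p \<le> binary_entropy q"
proof -
  define g where "g p = - ((1 * p + 0) * ln (1 * p + 0)) - (- 1 * p + 1) * ln (- 1 * p + 1)" for p :: real
  have g: "binary_entropy p * ln 2 = g p" for p unfolding entropy_conv_ln g_def by simp
  have "g p \<le> g q"
  proof (rule DERIV_nonneg_imp_nondecreasing[OF assms(2)])
    fix x assume x: "p \<le> x" "x \<le> q"
    have "(g has_real_derivative - (1 * (ln (1 * x + 0) + 1)) - - 1 * (ln (- 1 * x + 1) + 1)) (at x)"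
      unfolding g_def using x assms by (intro DERIV_diff DERIV_minus DERIV_x_ln_x) auto
    moreover have "0 \<le> - (1 * (ln (1 * x + 0) + 1)) - - 1 * (ln (- 1 * x + 1) + 1)" using x assms by simp
    ultimately show "\<exists>y. (g has_real_derivative y) (at x) \<and> 0 \<le> y" by blast
  qed
  then have "binary_entropy p * ln 2 \<le> binary_entropy q * ln 2" unfolding g .
  then show ?thesis by simp
qed

lemma entropy_reflect: "binary_entropy (1 - p) = binary_entropy p"
  by (simp add: binary_entropy_def algebra_simps)

text \<open>For \<open>t \<le> 1/3\<close> both \<open>2 * t\<close> and \<open>1 - 2 * t\<close>
  are at least \<open>t\<close>, so the entropy at \<open>2 * t\<close> is at least that at
  \<open>t\<close> and no solution occurs. Two solutions would give, by Rolle's theorem, a point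
  \<open>z\<close> between them with \<open>6 * (z * (1 - z)) = 1\<close>, impossible for
  \<open>1/3 < z < 1/2\<close>.\<close>

lemma exists_unique_tau: "\<exists>!t. 0 < t \<and> t < 1 / 2 \<and> binary_entropy (2 * t) - binary_entropy t + t = 0"
  and tau_gt_third: "0 < t \<Longrightarrow> t < 1 / 2 \<Longrightarrow> binary_entropy (2 * t) - binary_entropy t + t = 0 \<Longrightarrow> 1 / 3 < t"
proof -
  \<comment> \<open>The function multiplied by \<open>ln 2\<close>, with every logarithm taken of an
    affine term so that \<open>DERIV_x_ln_x\<close> applies.\<close>
  define g where "g t = - ((2 * t + 0) * ln (2 * t + 0)) - (- 2 * t + 1) * ln (- 2 * t + 1)
    + (1 * t + 0) * ln (1 * t + 0) + (- 1 * t + 1) * ln (- 1 * t + 1) + t * ln 2" for t :: real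
  have g: "(binary_entropy (2 * t) - binary_entropy t + t) * ln 2 = g t" for t
    unfolding g_def distrib_right left_diff_distrib entropy_conv_ln by simp
  have zero_iff: "binary_entropy (2 * t) - binary_entropy t + t = 0 \<longleftrightarrow> g t = 0" for t
    unfolding g[symmetric] by simp
  have deriv: "(g has_real_derivative (2 * ln (1 - 2 * t) - ln 2 - ln t - ln (1 - t))) (at t)"
    if "0 < t" "t < 1 / 2" for t
  proof (rule DERIV_cong)
    show "(g has_real_derivative - (2 * (ln (2 * t + 0) + 1)) - - 2 * (ln (- 2 * t + 1) + 1)
        + 1 * (ln (1 * t + 0) + 1) + - 1 * (ln (- 1 * t + 1) + 1) + ln 2) (at t)"
      unfolding g_def using that
      by (intro DERIV_add DERIV_diff DERIV_minus DERIV_x_ln_x DERIV_cmult_right[OF DERIV_ident, of "ln 2", simplified]) auto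
    show "- (2 * (ln (2 * t + 0) + 1)) - - 2 * (ln (- 2 * t + 1) + 1)
        + 1 * (ln (1 * t + 0) + 1) + - 1 * (ln (- 1 * t + 1) + 1) + ln 2
        = 2 * ln (1 - 2 * t) - ln 2 - ln t - ln (1 - t)"
      using that by (simp add: ln_mult)
  qed
  have third: "1 / 3 < t" if t: "0 < t" "t < 1 / 2" "binary_entropy (2 * t) - binary_entropy t + t = 0" for t
  proof (rule ccontr)
    assume "\<not> 1 / 3 < t"
    have "binary_entropy t \<le> binary_entropy (2 * t)"
    proof (cases "2 * t \<le> 1 / 2")
      case True then show ?thesis using t by (intro entropy_mono) auto
    next
      case False
      then have "binary_entropy t \<le> binary_entropy (1 - 2 * t)"
        using t \<open>\<not> 1 / 3 < t\<close> by (intro entropy_mono) auto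
      then show ?thesis by (simp add: entropy_reflect)
    qed
    then show False using t by simp
  qed
  show "0 < t \<Longrightarrow> t < 1 / 2 \<Longrightarrow> binary_entropy (2 * t) - binary_entropy t + t = 0 \<Longrightarrow> 1 / 3 < t"
    by (rule third)
  \<comment> \<open>At 1/3 the two entropies coincide and the value is positive. At 15/32 only
    logarithms of 2, 15 and 17 remain, and the claim becomes
    \<open>17 ^ 17 \<le> 15 ^ 15 * 2 ^ 17\<close>.\<close>
  have "\<exists>t. 1 / 3 \<le> t \<and> t \<le> 15 / 32 \<and> g t = 0"
  proof (rule IVT2)
    have "binary_entropy (2 * (1 / 3)) = binary_entropy (1 / 3)"
      using entropy_reflect[of "1 / 3"] by simp
    then have "g (1 / 3) = 1 / 3 * ln 2" unfolding g[symmetric] by simp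
    then show "0 \<le> g (1 / 3)" using ln_gt_zero[of "2::real"] by linarith
    have l: "ln (15 / 16) = ln 15 - 4 * ln (2::real)" "ln (1 / 16) = - 4 * ln (2::real)"
      "ln (15 / 32) = ln 15 - 5 * ln (2::real)" "ln (17 / 32) = ln 17 - 5 * ln (2::real)"
      using ln_realpow[of 2 4] ln_realpow[of 2 5] by (simp_all add: ln_div)
    have "32 * g (15 / 32) = 17 * ln 17 - 15 * ln 15 - 17 * ln 2"
      unfolding g_def by (simp add: l algebra_simps)
    also have "\<dots> \<le> 0"
    proof -
      have p: "17 * ln 17 = ln (17 ^ 17 :: real)" "15 * ln 15 = ln (15 ^ 15 :: real)" "17 * ln 2 = ln (2 ^ 17 :: real)"
        by (subst ln_realpow; simp)+
      have "ln (17 ^ 17 :: real) \<le> ln (15 ^ 15 * 2 ^ 17)" by (subst ln_le_cancel_iff) auto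
      also have "\<dots> = ln (15 ^ 15) + ln (2 ^ 17)" by (subst ln_mult) simp_all
      finally show ?thesis unfolding p by linarith
    qed
    finally show "g (15 / 32) \<le> 0" by simp
    show "\<forall>x. 1 / 3 \<le> x \<and> x \<le> 15 / 32 \<longrightarrow> isCont g x"
      using DERIV_isCont[OF deriv] by auto
  qed simp
  then obtain t where "1 / 3 \<le> t" "t \<le> 15 / 32" and gt: "g t = 0" by blast
  then have t: "0 < t" "t < 1 / 2" "g t = 0" by simp_all
  have less: False if ab: "a < b" "0 < a" "b < 1 / 2" "g a = 0" "g b = 0" for a b
  proof -
    have "1 / 3 < a" using third[of a] zero_iff ab by simp
    have "\<exists>z. a < z \<and> z < b \<and> (g has_real_derivative 0) (at z)"
    proof (rule Rolle)
      show "continuous_on {a..b} g"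
      proof (intro continuous_at_imp_continuous_on ballI)
        fix x assume "x \<in> {a..b}"
        then show "isCont g x" using ab by (intro DERIV_isCont[OF deriv]) auto
      qed
      show "g differentiable (at x)" if "a < x" "x < b" for x
        using deriv[of x] that ab unfolding real_differentiable_def by auto
    qed (use ab in auto)
    then obtain z where z: "a < z" "z < b" "(g has_real_derivative 0) (at z)" by blast
    have "2 * ln (1 - 2 * z) - ln 2 - ln z - ln (1 - z) = 0"
      using DERIV_unique[OF deriv z(3)] z ab by simp
    then have "ln ((1 - 2 * z)\<^sup>2) = ln (2 * z * (1 - z))"
      using z ab by (simp add: ln_mult ln_realpow)
    then have "(1 - 2 * z)\<^sup>2 = 2 * z * (1 - z)" using z ab by (subst (asm) ln_inj_iff) auto
    then have "6 * (z * (1 - z)) = 1" by (simp add: power2_eq_square algebra_simps)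
    moreover have "1 / 3 * (1 / 2) < z * (1 - z)"
      using z ab \<open>1 / 3 < a\<close> by (intro mult_strict_mono) auto
    ultimately show False by simp
  qed
  show "\<exists>!t. 0 < t \<and> t < 1 / 2 \<and> binary_entropy (2 * t) - binary_entropy t + t = 0"
    unfolding zero_iff
  proof (rule ex1I[of _ t])
    show "0 < t \<and> t < 1 / 2 \<and> g t = 0" using t by simp
    fix s assume "0 < s \<and> s < 1 / 2 \<and> g s = 0"
    then show "s = t" using less[of s t] less[of t s] t by (cases s t rule: linorder_cases) auto
  qed
qed

text \<open>The lower bound separates alternative (d) from the value 2; the upper bound lets the two
  other patterns qualify for (d). For the former, \<open>- ln t > ln 2\<close> and
  \<open>- ln (1 - t) \<ge> ln 2 / 2\<close>, so the entropy exceeds \<open>t + (1 - t) / 2\<close>,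
  which is at least \<open>1 - t\<close>.\<close>

lemma tau_exponent_bounds:
  assumes "1 / 3 < t" "t < 1 / 2"
  shows "1 < t + binary_entropy t" "t + binary_entropy t \<le> 3 / 2"
proof -
  have ln32: "ln 2 / 2 \<le> ln (3 / 2 :: real)"
  proof -
    have "ln 2 \<le> ln ((3 / 2)\<^sup>2 :: real)" by (subst ln_le_cancel_iff) (auto simp: power2_eq_square)
    then show ?thesis by (simp add: ln_realpow)
  qed
  have "ln t < ln (1 / 2)" using assms by (subst ln_less_cancel_iff) auto
  then have "t * ln t < t * - ln 2" using assms by (intro mult_strict_left_mono) (simp_all add: ln_div)
  then have 1: "t * ln 2 < - t * ln t" by simp
  have "ln (1 - t) \<le> ln (2 / 3)" using assms by (subst ln_le_cancel_iff) auto
  also have "ln (2 / 3) = - ln (3 / 2 :: real)" by (simp add: ln_div)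
  finally have "ln 2 / 2 \<le> - ln (1 - t)" using ln32 by linarith
  then have "(1 - t) * (ln 2 / 2) \<le> (1 - t) * - ln (1 - t)" using assms by (intro mult_left_mono) auto
  then have "t * ln 2 + (1 - t) * (ln 2 / 2) < binary_entropy t * ln 2"
    using 1 unfolding entropy_conv_ln by simp
  moreover have "(1 - t) * ln 2 \<le> t * ln 2 + (1 - t) * (ln 2 / 2)"
  proof -
    have "1 - t \<le> t + (1 - t) / 2" using assms(1) by (simp add: field_simps)
    then have "(1 - t) * ln 2 \<le> (t + (1 - t) / 2) * ln 2" by (rule mult_right_mono) simp
    then show ?thesis by (simp add: algebra_simps)
  qed
  ultimately have "(1 - t) * ln 2 < binary_entropy t * ln 2" by linarith
  then show "1 < t + binary_entropy t" by simp
  have "binary_entropy t \<le> binary_entropy (1 / 2)" using assms by (intro entropy_mono) auto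
  then show "t + binary_entropy t \<le> 3 / 2" using assms by (simp add: binary_entropy_half)
qed

text \<open>From \<open>8 < 9\<close> comes \<open>log 2 3 \<ge> 3/2\<close>, which puts the
  determinant pattern above exponent 3/2; from \<open>27 < 32\<close> comes
  \<open>log 2 3 < 5/3\<close>.\<close>

lemma entropy_third_bounds: "5 / 6 \<le> binary_entropy (1 / 3)" "binary_entropy (1 / 3) < 1"
proof -
  have "3 / 2 = log 2 (2 powr (3 / 2))" by simp
  also have "\<dots> \<le> log 2 3"
  proof -
    have "(2 powr (3 / 2))\<^sup>2 = (8 :: real)" by (simp add: powr_realpow[symmetric] powr_powr)
    then have "(2 powr (3 / 2))\<^sup>2 \<le> (3::real)\<^sup>2" by simp
    then have "2 powr (3 / 2) \<le> (3::real)" by (rule power2_le_imp_le) simp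
    then show ?thesis by (subst log_le_cancel_iff) auto
  qed
  finally show "5 / 6 \<le> binary_entropy (1 / 3)" by (simp add: binary_entropy_third)
  have "3 * log 2 3 = log 2 (3 ^ 3)" by (subst log_nat_power) auto
  also have "\<dots> < log 2 (2 ^ 5)" by (subst log_less_cancel_iff) auto
  also have "\<dots> = 5" by (subst log_nat_power) auto
  finally show "binary_entropy (1 / 3) < 1" by (simp add: binary_entropy_third)
qed

section \<open>Restriction to format three\<close>

text \<open>In a finite field the product of all \<open>X - a\<close>, plus 1, has no root.\<close>

lemma infinite_alg_closed_field: "infinite (UNIV :: 'a::alg_closed_field set)"
proof
  assume fin: "finite (UNIV :: 'a set)"
  define p where "p = (\<Prod>a\<in>UNIV. [:- a, 1 :: 'a:]) + 1"
  have "degree (\<Prod>a\<in>UNIV. [:- a, 1 :: 'a:]) = (\<Sum>a\<in>(UNIV :: 'a set). degree [:- a, 1:])"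
    by (intro degree_prod_eq_sum_degree) auto
  also have "\<dots> = card (UNIV :: 'a set)" by simp
  finally have deg: "degree (\<Prod>a\<in>UNIV. [:- a, 1 :: 'a:]) = card (UNIV :: 'a set)" .
  moreover have "card (UNIV :: 'a set) > 0" using fin by (simp add: card_gt_0_iff)
  ultimately have "degree p = card (UNIV :: 'a set)" unfolding p_def by (subst degree_add_eq_left) auto
  then obtain x where x: "poly p x = 0"
    using alg_closed_imp_poly_has_root[of p] \<open>card (UNIV :: 'a set) > 0\<close> by auto
  have "poly p x = (\<Prod>a\<in>UNIV. x - a) + 1" by (simp add: p_def poly_prod)
  also have "(\<Prod>a\<in>UNIV. x - a) = 0" using fin by (intro prod_zero) auto
  finally show False using x by simp
qed

text \<open>A vector that avoids the earlier hyperplanes is moved along a unit vector on which the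
  new functional is nonzero; only finitely many multiples are bad.\<close>

lemma avoid_hyperplanes:
  fixes fs :: "(nat \<Rightarrow> 'a::alg_closed_field) list"
  assumes "\<And>f. f \<in> set fs \<Longrightarrow> \<exists>i<n. f i \<noteq> 0"
  shows "\<exists>x. \<forall>f\<in>set fs. (\<Sum>i<n. x i * f i) \<noteq> 0"
  using assms
proof (induction fs)
  case (Cons f fs)
  then obtain x where x: "\<And>g. g \<in> set fs \<Longrightarrow> (\<Sum>i<n. x i * g i) \<noteq> 0" by auto
  obtain i where i: "i < n" "f i \<noteq> 0" using Cons.prems[of f] by auto
  define u where "u l = (of_bool (l = i) :: 'a)" for l
  have u: "(\<Sum>l<n. u l * g l) = g i" for g :: "nat \<Rightarrow> 'a" unfolding u_def by (rule sum_unit[OF i(1)])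
  define bad where "bad = insert (- (\<Sum>l<n. x l * f l) / f i) ((\<lambda>g. - (\<Sum>l<n. x l * g l) / g i) ` set fs)"
  have "finite bad" by (simp add: bad_def)
  then obtain t where t: "t \<notin> bad" using infinite_alg_closed_field ex_new_if_finite by blast
  have sum: "(\<Sum>l<n. (x l + t * u l) * g l) = (\<Sum>l<n. x l * g l) + t * g i" for g
    by (simp add: distrib_right sum.distrib mult.assoc sum_distrib_left[symmetric] u)
  have "(\<Sum>l<n. (x l + t * u l) * g l) \<noteq> 0" if "g \<in> set (f # fs)" for g
  proof
    assume 0: "(\<Sum>l<n. (x l + t * u l) * g l) = 0"
    show False
    proof (cases "g i = 0")
      case True
      then have "g \<in> set fs" using that i by auto
      then show False using 0 x True unfolding sum by simp
    next
      case False
      then have "t = - (\<Sum>l<n. x l * g l) / g i"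
        using 0 unfolding sum by (simp add: field_simps eq_neg_iff_add_eq_0)
      then have "t \<in> bad" using that unfolding bad_def by auto
      then show False using t by simp
    qed
  qed
  then show ?case by (intro exI[of _ "\<lambda>l. x l + t * u l"]) blast
qed simp

lemma tri_as_functional: "tri n1 n2 n3 T x y z = (\<Sum>i<n1. x i * tri n1 n2 n3 T (\<lambda>l. of_bool (l = i)) y z)"
proof -
  have "tri n1 n2 n3 T x y z = tri n1 n2 n3 T (\<lambda>l. \<Sum>i<n1. x i * of_bool (l = i)) y z"
    by (rule tri_cong) (simp_all add: expand_unit_vectors[symmetric])
  then show ?thesis unfolding tri_sum1 .
qed

lemma concise1_tri:
  assumes "concise1 n1 n2 n3 T" "i < n1" "x i \<noteq> 0"
  shows "\<exists>y z. tri n1 n2 n3 T x y z \<noteq> 0"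
proof (rule ccontr)
  assume "\<not> ?thesis"
  then have "(\<Sum>i<n1. x i * T i j k) = 0" if "j < n2" "k < n3" for j k
    using tri_unit23[OF that, of n1 T x] by auto
  from concise1D[OF assms(1) this assms(2)] assms(3) show False by simp
qed

lemma concise2_tri:
  assumes "concise n1 n2 n3 T" "j < n2" "y j \<noteq> 0"
  shows "\<exists>x z. tri n1 n2 n3 T x y z \<noteq> 0"
  using concise1_tri[of n2 n1 n3 "\<lambda>i j k. T j i k" j y] assms tri_swap12[of n2 n1 n3 T y _ _]
  unfolding concise_def by simp

section \<open>Generic slices of large rank in the other two factors\<close>

definition killed ::
  "nat \<Rightarrow> nat \<Rightarrow> nat \<Rightarrow> 'a::field tensor3 \<Rightarrow> (nat \<Rightarrow> nat \<Rightarrow> 'a) \<Rightarrow> nat \<Rightarrow> (nat \<Rightarrow> 'a) \<Rightarrow> bool" where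
  "killed n1 n2 n3 T X a y \<longleftrightarrow> (\<forall>b<a. \<forall>z. tri n1 n2 n3 T (X b) y z = 0)"

text \<open>
  A certificate that the slices \<open>X 0\<close>, \<dots>, \<open>X (a - 1)\<close> together have rank at least
  \<open>min a n2\<close> in the second factor: either the common kernels form a strictly decreasing
  chain or the last one is trivial.
\<close>

definition rank_cert :: "nat \<Rightarrow> nat \<Rightarrow> nat \<Rightarrow> 'a::field tensor3 \<Rightarrow> (nat \<Rightarrow> nat \<Rightarrow> 'a) \<Rightarrow> nat \<Rightarrow> bool" where
  "rank_cert n1 n2 n3 T X a \<longleftrightarrow>
     (\<exists>y. \<forall>b<a. killed n1 n2 n3 T X b (y b) \<and> (\<exists>z. tri n1 n2 n3 T (X b) (y b) z \<noteq> 0))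
     \<or> (\<forall>y. killed n1 n2 n3 T X a y \<longrightarrow> (\<forall>j<n2. y j = 0))"

lemma killed_update: "b \<le> a \<Longrightarrow> killed n1 n2 n3 T (X(a := x)) b y \<longleftrightarrow> killed n1 n2 n3 T X b y"
  by (auto simp: killed_def)

text \<open>A nonzero vector \<open>ya\<close> in the common kernel of the earlier slices is
  detected by some slice, by conciseness. The condition on the new \<open>x\<close> is that one
  linear functional be nonzero; in this form it can be imposed together with further conditions of
  the same kind.\<close>

lemma rank_cert_step:
  assumes con: "concise n1 n2 n3 T" and cert: "rank_cert n1 n2 n3 T X a" and n: "0 < n1"
  shows "\<exists>f. (\<exists>i<n1. f i \<noteq> 0) \<and> (\<forall>x. (\<Sum>i<n1. x i * f i) \<noteq> 0 \<longrightarrow> rank_cert n1 n2 n3 T (X(a := x)) (Suc a))"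
proof (cases "\<forall>y. killed n1 n2 n3 T X a y \<longrightarrow> (\<forall>j<n2. y j = 0)")
  case True
  have "rank_cert n1 n2 n3 T (X(a := x)) (Suc a)" for x
  proof -
    have "killed n1 n2 n3 T X a y" if "killed n1 n2 n3 T (X(a := x)) (Suc a) y" for y
      using that unfolding killed_def by (metis fun_upd_other less_Suc_eq less_irrefl)
    then show ?thesis using True unfolding rank_cert_def by blast
  qed
  then show ?thesis using n by (intro exI[of _ "\<lambda>_. 1"]) auto
next
  case False
  then obtain ya j where ya: "killed n1 n2 n3 T X a ya" "j < n2" "ya j \<noteq> 0" by blast
  obtain y where y: "\<And>b. b < a \<Longrightarrow> killed n1 n2 n3 T X b (y b)" "\<And>b. b < a \<Longrightarrow> \<exists>z. tri n1 n2 n3 T (X b) (y b) z \<noteq> 0"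
    using cert False unfolding rank_cert_def by blast
  obtain x0 z where z: "tri n1 n2 n3 T x0 ya z \<noteq> 0" using concise2_tri[OF con, of j ya] ya(2,3) by blast
  define f where "f i = tri n1 n2 n3 T (\<lambda>l. of_bool (l = i)) ya z" for i
  have f: "tri n1 n2 n3 T x ya z = (\<Sum>i<n1. x i * f i)" for x unfolding f_def by (rule tri_as_functional)
  have "rank_cert n1 n2 n3 T (X(a := x)) (Suc a)" if "(\<Sum>i<n1. x i * f i) \<noteq> 0" for x
  proof -
    have "killed n1 n2 n3 T (X(a := x)) b ((y(a := ya)) b) \<and> (\<exists>z. tri n1 n2 n3 T ((X(a := x)) b) ((y(a := ya)) b) z \<noteq> 0)"
      if b: "b < Suc a" for b
    proof (cases "b = a")
      case True
      then show ?thesis using ya(1) killed_update[of a a n1 n2 n3 T X x ya] f[of x] \<open>(\<Sum>i<n1. x i * f i) \<noteq> 0\<close>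
        by (metis fun_upd_same order_refl)
    next
      case False
      then have "b < a" using b by simp
      then show ?thesis using y[of b] killed_update[of b a n1 n2 n3 T X x "y b"] by simp
    qed
    then show ?thesis unfolding rank_cert_def by blast
  qed
  moreover have "\<exists>i<n1. f i \<noteq> 0"
  proof (rule ccontr)
    assume "\<not> ?thesis"
    then have "(\<Sum>i<n1. x0 i * f i) = 0" by (intro sum.neutral) auto
    then show False using z f by simp
  qed
  ultimately show ?thesis by blast
qed

text \<open>The certificate yields \<open>r\<close> vectors independent modulo the common kernel.
  For a chain the system is triangular: slice \<open>b\<close> kills every later
  \<open>y b'\<close>, the earlier coefficients are zero by induction, and \<open>y b\<close> itself
  survives.\<close>

lemma rank_cert_family:
  assumes cert: "rank_cert n1 n2 n3 T X r" and r: "r \<le> n2"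
  shows "\<exists>Y. \<forall>c. killed n1 n2 n3 T X r (\<lambda>j. \<Sum>b<r. c b * Y b j) \<longrightarrow> (\<forall>b<r. c b = 0)"
  using cert unfolding rank_cert_def
proof (elim disjE exE)
  fix y assume y: "\<forall>b<r. killed n1 n2 n3 T X b (y b) \<and> (\<exists>z. tri n1 n2 n3 T (X b) (y b) z \<noteq> 0)"
  have "c b = 0" if k: "killed n1 n2 n3 T X r (\<lambda>j. \<Sum>b<r. c b * y b j)" and "b < r" for c b
    using \<open>b < r\<close>
  proof (induction b rule: less_induct)
    case (less b)
    obtain z where z: "tri n1 n2 n3 T (X b) (y b) z \<noteq> 0" using y less.prems by blast
    have "0 = (\<Sum>b'<r. c b' * tri n1 n2 n3 T (X b) (y b') z)"
      using k less.prems unfolding killed_def tri_sum2 by simp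
    also have "\<dots> = (\<Sum>b'<r. if b' = b then c b * tri n1 n2 n3 T (X b) (y b) z else 0)"
    proof (intro sum.cong refl)
      fix b' assume "b' \<in> {..<r}"
      then have "b' < r" by simp
      show "c b' * tri n1 n2 n3 T (X b) (y b') z = (if b' = b then c b * tri n1 n2 n3 T (X b) (y b) z else 0)"
      proof (cases b' b rule: linorder_cases)
        case less': less
        then show ?thesis using less.IH[OF less' \<open>b' < r\<close>] by simp
      next
        case greater
        then show ?thesis using y \<open>b' < r\<close> unfolding killed_def by auto
      qed simp
    qed
    also have "\<dots> = c b * tri n1 n2 n3 T (X b) (y b) z" using less.prems by simp
    finally show ?case using z by simp
  qed
  then show ?thesis by blast
next
  assume 0: "\<forall>y. killed n1 n2 n3 T X r y \<longrightarrow> (\<forall>j<n2. y j = 0)"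
  have "c b = 0" if "killed n1 n2 n3 T X r (\<lambda>j. \<Sum>b<r. c b * of_bool (j = b))" "b < r" for c b
  proof -
    have "b < n2" using that(2) r by simp
    then have "(\<Sum>b'<r. c b' * of_bool (b = b')) = 0" using 0 that(1) by blast
    then show ?thesis unfolding expand_unit_vectors[OF that(2), of c, symmetric] .
  qed
  then show ?thesis by (intro exI[of _ "\<lambda>b j. of_bool (j = b)"]) blast
qed

definition indep_part :: "nat \<Rightarrow> nat \<Rightarrow> (nat \<Rightarrow> nat \<Rightarrow> 'a::field) \<Rightarrow> bool" where
  "indep_part n r X \<longleftrightarrow> (\<forall>c. (\<forall>i<n. (\<Sum>a<r. c a * X a i) = 0) \<longrightarrow> (\<forall>a<r. c a = 0))"

lemma indep_family_part: "indep_family n X \<longleftrightarrow> indep_part n n X"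
  unfolding indep_family_def indep_part_def ..

lemma slice_selection:
  fixes T :: "'a::alg_closed_field tensor3"
  assumes con: "concise n1 n2 n3 T" and r: "r \<le> n1" "0 < n1"
  shows "\<exists>X. rank_cert n1 n2 n3 T X r \<and> rank_cert n1 n3 n2 (\<lambda>i j k. T i k j) X r \<and> indep_part n1 r X"
  using r(1)
proof (induction r)
  case 0
  have "rank_cert n1 n2 n3 T X 0" "rank_cert n1 n3 n2 (\<lambda>i j k. T i k j) X 0" for X
    unfolding rank_cert_def by simp_all
  moreover have "indep_part n1 0 X" for X :: "nat \<Rightarrow> nat \<Rightarrow> 'a" by (simp add: indep_part_def)
  ultimately show ?case by blast
next
  case (Suc a)
  then obtain X where X: "rank_cert n1 n2 n3 T X a" "rank_cert n1 n3 n2 (\<lambda>i j k. T i k j) X a" "indep_part n1 a X" by auto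
  obtain f where f: "\<exists>i<n1. f i \<noteq> 0" "\<And>x. (\<Sum>i<n1. x i * f i) \<noteq> 0 \<Longrightarrow> rank_cert n1 n2 n3 T (X(a := x)) (Suc a)"
    using rank_cert_step[OF con X(1) r(2)] by blast
  have con23: "concise n1 n3 n2 (\<lambda>i j k. T i k j)" using con concise_swap23[of n1 n3 n2 T] by simp
  obtain g where g: "\<exists>i<n1. g i \<noteq> 0"
    "\<And>x. (\<Sum>i<n1. x i * g i) \<noteq> 0 \<Longrightarrow> rank_cert n1 n3 n2 (\<lambda>i j k. T i k j) (X(a := x)) (Suc a)"
    using rank_cert_step[OF con23 X(2) r(2)] by blast
  \<comment> \<open>\<open>w\<close> is orthogonal to the slices already chosen, so a vector not
    orthogonal to \<open>w\<close> is independent of them.\<close>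
  obtain w where w: "\<exists>i\<in>{..<n1}. w i \<noteq> 0" "\<And>b. b < a \<Longrightarrow> (\<Sum>i<n1. w i * X b i) = 0"
    using homogeneous_system[of "{..<a}" "{..<n1}" "\<lambda>b i. X b i"] Suc.prems by auto
  obtain x where x: "(\<Sum>i<n1. x i * f i) \<noteq> 0" "(\<Sum>i<n1. x i * g i) \<noteq> 0" "(\<Sum>i<n1. x i * w i) \<noteq> 0"
    using avoid_hyperplanes[of "[f, g, w]" n1] f(1) g(1) w(1) by auto
  have "indep_part n1 (Suc a) (X(a := x))"
    unfolding indep_part_def
  proof (intro allI impI)
    fix c b assume "\<forall>i<n1. (\<Sum>b<Suc a. c b * (X(a := x)) b i) = 0" "b < Suc a"
    moreover have "(\<Sum>b<Suc a. c b * (X(a := x)) b i) = (\<Sum>b<a. c b * X b i) + c a * x i" for i by simp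
    ultimately have eq: "(\<Sum>b<a. c b * X b i) + c a * x i = 0" if "i < n1" for i using that by simp
    have "0 = (\<Sum>i<n1. w i * ((\<Sum>b<a. c b * X b i) + c a * x i))" using eq by simp
    also have "\<dots> = (\<Sum>i<n1. \<Sum>b<a. c b * (w i * X b i)) + (\<Sum>i<n1. c a * (x i * w i))"
      by (simp add: distrib_left sum.distrib sum_distrib_left ac_simps)
    also have "(\<Sum>i<n1. \<Sum>b<a. c b * (w i * X b i)) = (\<Sum>b<a. c b * (\<Sum>i<n1. w i * X b i))"
      unfolding sum_distrib_left by (rule sum.swap)
    also have "\<dots> = 0" using w(2) by simp
    also have "(\<Sum>i<n1. c a * (x i * w i)) = c a * (\<Sum>i<n1. x i * w i)" by (rule sum_distrib_left[symmetric])
    finally have ca: "c a = 0" using x(3) by simp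
    then have "\<forall>b<a. c b = 0" using X(3) eq unfolding indep_part_def by simp
    then show "c b = 0" using ca \<open>b < Suc a\<close> by (auto simp: less_Suc_eq)
  qed
  then show ?case using f(2)[OF x(1)] g(2)[OF x(2)] by blast
qed

text \<open>The first factor is cut down to \<open>r\<close> generic combinations of slices. Vectors
  independent modulo the common kernels force the concise version to keep dimension at least
  \<open>r\<close> in the other factors, and independence of \<open>X\<close> keeps the first
  dimension equal to \<open>r\<close>.\<close>

lemma restrict_first_factor:
  fixes T :: "'a::alg_closed_field tensor3"
  assumes con: "concise n1 n2 n3 T" and r: "r \<le> n1" "r \<le> n2" "r \<le> n3" "0 < n1"
  shows "\<exists>m2 m3 S. restricts n1 n2 n3 T r m2 m3 S \<and> concise r m2 m3 S \<and> r \<le> m2 \<and> r \<le> m3 \<and> m2 \<le> n2 \<and> m3 \<le> n3"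
proof -
  obtain X where X: "rank_cert n1 n2 n3 T X r" "rank_cert n1 n3 n2 (\<lambda>i j k. T i k j) X r" "indep_part n1 r X"
    using slice_selection[OF con r(1,4)] by blast
  obtain Y where Y: "\<And>c. killed n1 n2 n3 T X r (\<lambda>j. \<Sum>b<r. c b * Y b j) \<Longrightarrow> \<forall>b<r. c b = 0"
    using rank_cert_family[OF X(1) r(2)] by blast
  obtain Z where Z: "\<And>c. killed n1 n3 n2 (\<lambda>i j k. T i k j) X r (\<lambda>j. \<Sum>b<r. c b * Z b j) \<Longrightarrow> \<forall>b<r. c b = 0"
    using rank_cert_family[OF X(2) r(3)] by blast
  define T' where "T' a j k = tri n1 n2 n3 T (X a) (\<lambda>l. of_bool (l = j)) (\<lambda>l. of_bool (l = k))" for a j k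
  have TT': "restricts n1 n2 n3 T r n2 n3 T'" by (rule restrictsI) (simp add: T'_def)
  have tri': "tri r n2 n3 T' x y z = tri n1 n2 n3 T (\<lambda>i. \<Sum>a<r. x a * X a i) y z" for x y z
  proof -
    have "tri r n2 n3 T' x y z = tri n1 n2 n3 T (\<lambda>i. \<Sum>a<r. x a * X a i) (\<lambda>i. \<Sum>a<n2. y a * of_bool (i = a)) (\<lambda>i. \<Sum>a<n3. z a * of_bool (i = a))"
      by (rule tri_compose) (simp add: T'_def)
    also have "\<dots> = tri n1 n2 n3 T (\<lambda>i. \<Sum>a<r. x a * X a i) y z"
      by (rule tri_cong) (simp_all add: expand_unit_vectors[symmetric])
    finally show ?thesis .
  qed
  obtain m1 m2 m3 S where S: "restricts r n2 n3 T' m1 m2 m3 S" "restricts m1 m2 m3 S r n2 n3 T'" "concise m1 m2 m3 S"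
    using exists_equivalent_concise[of r n2 n3 T'] unfolding equivalent_def by blast
  have "concise1 r n2 n3 T'" unfolding concise1_def
  proof (intro allI impI)
    fix x a assume 0: "\<forall>j<n2. \<forall>k<n3. (\<Sum>i<r. x i * T' i j k) = 0" and a: "a < r"
    have "tri n1 n2 n3 T (\<lambda>i. \<Sum>a<r. x a * X a i) y z = 0" for y z
      unfolding tri'[symmetric] by (rule tri_eq_0_if_slices[OF 0])
    then have "\<forall>i<n1. (\<Sum>a<r. x a * X a i) = 0"
      using concise1_tri[of n1 n2 n3 T _ "\<lambda>i. \<Sum>a<r. x a * X a i"] con unfolding concise_def by blast
    then show "x a = 0" using X(3) a unfolding indep_part_def by blast
  qed
  from concise1_le[OF this S(2)] have "r \<le> m1" .
  moreover have "m1 \<le> r" using concise1_le S(1,3) unfolding concise_def by blast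
  ultimately have m1: "m1 = r" by simp
  have "r \<le> m2"
  proof -
    define R where "R b a k = tri r n2 n3 T' (\<lambda>l. of_bool (l = a)) (Y b) (\<lambda>l. of_bool (l = k))" for b a k
    have "restricts r n2 n3 T' r r n3 (\<lambda>a b k. R b a k)" by (rule restrictsI) (simp add: R_def)
    then have "restricts m2 m1 m3 (\<lambda>i j k. S j i k) r r n3 R"
      using restricts_trans[OF S(2)] restricts_swap12[of m2 m1 m3 S r r n3 "\<lambda>a b k. R b a k"] by blast
    moreover have "concise1 r r n3 R" unfolding concise1_def
    proof (intro allI impI)
      fix c b assume 0: "\<forall>a<r. \<forall>k<n3. (\<Sum>b<r. c b * R b a k) = 0" and b: "b < r"
      have "tri n1 n2 n3 T (X a) (\<lambda>j. \<Sum>b<r. c b * Y b j) z = 0" if "a < r" for a z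
      proof -
        have "tri n1 n2 n3 T (X a) (\<lambda>j. \<Sum>b<r. c b * Y b j) z = tri r n2 n3 T' (\<lambda>l. of_bool (l = a)) (\<lambda>j. \<Sum>b<r. c b * Y b j) z"
          unfolding tri' using that by (intro tri_cong refl) (simp add: sum_unit)
        also have "\<dots> = tri r n2 n3 T' (\<lambda>l. of_bool (l = a)) (\<lambda>j. \<Sum>b<r. c b * Y b j) (\<lambda>k. \<Sum>l<n3. z l * of_bool (k = l))"
          by (rule tri_cong) (simp_all add: expand_unit_vectors[symmetric])
        also have "\<dots> = (\<Sum>l<n3. z l * (\<Sum>b<r. c b * R b a l))"
          unfolding tri_sum3 unfolding tri_sum2 R_def ..
        also have "\<dots> = 0" using 0 that by simp
        finally show ?thesis .
      qed
      then show "c b = 0" using Y[of c] b unfolding killed_def by blast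
    qed
    ultimately show ?thesis using concise1_le by blast
  qed
  moreover have "r \<le> m3"
  proof -
    define R where "R b j a = tri r n2 n3 T' (\<lambda>l. of_bool (l = a)) (\<lambda>l. of_bool (l = j)) (Z b)" for b j a
    have "restricts r n2 n3 T' r n2 r (\<lambda>a j b. R b j a)" by (rule restrictsI) (simp add: R_def)
    then have "restricts m3 m2 m1 (\<lambda>i j k. S k j i) r n2 r R"
      using restricts_trans[OF S(2)] restricts_swap13[of m3 m2 m1 S r n2 r "\<lambda>a j b. R b j a"] by blast
    moreover have "concise1 r n2 r R" unfolding concise1_def
    proof (intro allI impI)
      fix c b assume 0: "\<forall>j<n2. \<forall>a<r. (\<Sum>b<r. c b * R b j a) = 0" and b: "b < r"
      have "tri n1 n3 n2 (\<lambda>i j k. T i k j) (X a) (\<lambda>j. \<Sum>b<r. c b * Z b j) y = 0" if "a < r" for a y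
      proof -
        have "tri n1 n3 n2 (\<lambda>i j k. T i k j) (X a) (\<lambda>j. \<Sum>b<r. c b * Z b j) y = tri n1 n2 n3 T (X a) y (\<lambda>j. \<Sum>b<r. c b * Z b j)"
          by (rule tri_swap23)
        also have "\<dots> = tri r n2 n3 T' (\<lambda>l. of_bool (l = a)) y (\<lambda>j. \<Sum>b<r. c b * Z b j)"
          unfolding tri' using that by (intro tri_cong refl) (simp add: sum_unit)
        also have "\<dots> = tri r n2 n3 T' (\<lambda>l. of_bool (l = a)) (\<lambda>k. \<Sum>l<n2. y l * of_bool (k = l)) (\<lambda>j. \<Sum>b<r. c b * Z b j)"
          by (rule tri_cong) (simp_all add: expand_unit_vectors[symmetric])
        also have "\<dots> = (\<Sum>l<n2. y l * (\<Sum>b<r. c b * R b l a))"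
          unfolding tri_sum2 unfolding tri_sum3 R_def ..
        also have "\<dots> = 0" using 0 that by simp
        finally show ?thesis .
      qed
      then show "c b = 0" using Z[of c] b unfolding killed_def by blast
    qed
    ultimately show ?thesis using concise1_le by blast
  qed
  moreover have "m2 \<le> n2"
    using concise1_le[of m2 m1 m3 "\<lambda>i j k. S j i k" n2 r n3 "\<lambda>i j k. T' j i k"] S
      restricts_swap12[of n2 r n3 T' m2 m1 m3 S] unfolding concise_def by blast
  moreover have "m3 \<le> n3"
    using concise1_le[of m3 m2 m1 "\<lambda>i j k. S k j i" n3 n2 r "\<lambda>i j k. T' k j i"] S
      restricts_swap13[of n3 n2 r T' m3 m2 m1 S] unfolding concise_def by blast
  ultimately show ?thesis using restricts_trans[OF TT' S(1)] S(3) unfolding m1 by blast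
qed

text \<open>The reduction is applied to each factor in turn; its two-sided bounds fix a dimension
  that has already come down to \<open>r\<close>.\<close>

lemma restricts_concise_cube:
  fixes T :: "'a::alg_closed_field tensor3"
  assumes con: "concise n1 n2 n3 T" and r: "r \<le> n1" "r \<le> n2" "r \<le> n3" "0 < r"
  shows "\<exists>S. restricts n1 n2 n3 T r r r S \<and> concise r r r S"
proof -
  obtain m2 m3 S1 where S1: "restricts n1 n2 n3 T r m2 m3 S1" "concise r m2 m3 S1" "r \<le> m2" "r \<le> m3"
    using restrict_first_factor[OF con r(1-3)] r by auto
  have "concise m2 r m3 (\<lambda>i j k. S1 j i k)" using S1(2) concise_swap12[of m2 r m3 S1] by simp
  from restrict_first_factor[OF this S1(3) order_refl S1(4)] r S1
  obtain l1 l3 S2 where S2: "restricts m2 r m3 (\<lambda>i j k. S1 j i k) r l1 l3 S2" "concise r l1 l3 S2" "r \<le> l1" "r \<le> l3" "l1 \<le> r"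
    by auto
  have l1: "l1 = r" using S2 by simp
  have S1S2: "restricts r m2 m3 S1 r r l3 (\<lambda>i j k. S2 j i k)"
    using S2(1) restricts_swap12[of m2 r m3 S1 r r l3 "\<lambda>i j k. S2 j i k"] unfolding l1 by simp
  have "concise r l3 r (\<lambda>i j k. S2 i k j)" using S2(2) concise_swap23[of r l3 r S2] unfolding l1 by simp
  then have "concise l3 r r (\<lambda>i j k. S2 j k i)" using concise_swap12[of l3 r r "\<lambda>i j k. S2 i k j"] by simp
  from restrict_first_factor[OF this S2(4) order_refl order_refl] r S2
  obtain k1 k2 S3 where S3: "restricts l3 r r (\<lambda>i j k. S2 j k i) r k1 k2 S3" "concise r k1 k2 S3" "r \<le> k1" "r \<le> k2" "k1 \<le> r" "k2 \<le> r"
    by auto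
  have k: "k1 = r" "k2 = r" using S3 by simp_all
  have "restricts r l3 r (\<lambda>i j k. S2 i k j) r r r (\<lambda>i j k. S3 j i k)"
    using S3(1) restricts_swap12[of l3 r r "\<lambda>i j k. S2 i k j" r r r "\<lambda>i j k. S3 j i k"] unfolding k by simp
  then have "restricts r r l3 S2 r r r (\<lambda>i j k. S3 k i j)"
    using restricts_swap23[of r l3 r S2 r r r "\<lambda>i j k. S3 k i j"] by simp
  then have S23: "restricts r r l3 (\<lambda>i j k. S2 j i k) r r r (\<lambda>i j k. S3 k j i)"
    using restricts_swap12[of r r l3 "\<lambda>i j k. S2 j i k" r r r "\<lambda>i j k. S3 k j i"] by simp
  have "concise r r r (\<lambda>i j k. S3 k j i)"
  proof -
    have "concise r r r (\<lambda>i j k. S3 j i k)" using S3(2) concise_swap12[of r r r S3] unfolding k by simp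
    then have "concise r r r (\<lambda>i j k. S3 k i j)" using concise_swap23[of r r r "\<lambda>i j k. S3 j i k"] by simp
    then show ?thesis using concise_swap12[of r r r "\<lambda>i j k. S3 k i j"] by simp
  qed
  then show ?thesis using restricts_trans[OF S1(1) restricts_trans[OF S1S2 S23]] by blast
qed

section \<open>Bases\<close>

text \<open>For \<open>r < n\<close> some unit vector lies outside the span of the family; otherwise
  all \<open>n\<close> unit vectors would be combinations of \<open>r\<close> vectors.\<close>

lemma indep_part_extend:
  assumes "indep_part n r X" "r \<le> n"
  shows "\<exists>X'. indep_family n X' \<and> (\<forall>a<r. X' a = X a)"
  using assms(2,1)
proof (induction r arbitrary: X rule: inc_induct)
  case base
  then show ?case unfolding indep_family_part by blast
next
  case (step r)
  have "\<exists>p<n. \<not> (\<exists>c. \<forall>i<n. of_bool (i = p) = (\<Sum>a<r. c a * X a i))"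
  proof (rule ccontr)
    assume "\<not> ?thesis"
    then obtain c where c: "\<And>p i. p < n \<Longrightarrow> i < n \<Longrightarrow> of_bool (i = p) = (\<Sum>a<r. c p a * X a i)" by metis
    obtain t where t: "\<exists>p\<in>{..<n}. t p \<noteq> 0" "\<And>a. a < r \<Longrightarrow> (\<Sum>p<n. t p * c p a) = 0"
      using homogeneous_system[of "{..<r}" "{..<n}" "\<lambda>a p. c p a"] step.hyps by auto
    have "t i = 0" if "i < n" for i
    proof -
      have "t i = (\<Sum>p<n. t p * of_bool (i = p))" by (rule expand_unit_vectors[OF that])
      also have "\<dots> = (\<Sum>p<n. \<Sum>a<r. t p * c p a * X a i)" using c that by (simp add: sum_distrib_left mult.assoc)
      also have "\<dots> = (\<Sum>a<r. \<Sum>p<n. t p * c p a * X a i)" by (rule sum.swap)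
      also have "\<dots> = 0" using t(2) by (simp add: sum_distrib_right[symmetric])
      finally show ?thesis .
    qed
    then show False using t(1) by auto
  qed
  then obtain p where p: "p < n" "\<And>c. \<not> (\<forall>i<n. of_bool (i = p) = (\<Sum>a<r. c a * X a i))" by blast
  have "indep_part n (Suc r) (X(r := \<lambda>i. of_bool (i = p)))"
    unfolding indep_part_def
  proof (intro allI impI)
    fix c a assume "\<forall>i<n. (\<Sum>a<Suc r. c a * (X(r := \<lambda>i. of_bool (i = p))) a i) = 0" "a < Suc r"
    then have eq: "(\<Sum>a<r. c a * X a i) + c r * of_bool (i = p) = 0" if "i < n" for i using that by simp
    have "c r = 0"
    proof (rule ccontr)
      assume nz: "c r \<noteq> 0"
      have "of_bool (i = p) = (\<Sum>a<r. (- c a / c r) * X a i)" if "i < n" for i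
      proof -
        have "(\<Sum>a<r. (- c a / c r) * X a i) = (\<Sum>a<r. (- 1 / c r) * (c a * X a i))" by (intro sum.cong) simp_all
        also have "\<dots> = (- 1 / c r) * (\<Sum>a<r. c a * X a i)" by (rule sum_distrib_left[symmetric])
        also have "(\<Sum>a<r. c a * X a i) = - (c r * of_bool (i = p))" using eq[OF that] by (simp add: eq_neg_iff_add_eq_0)
        finally show ?thesis using nz by simp
      qed
      then show False using p(2)[of "\<lambda>a. - c a / c r"] by blast
    qed
    moreover from this have "\<forall>a<r. c a = 0" using eq step.prems unfolding indep_part_def by simp
    ultimately show "c a = 0" using \<open>a < Suc r\<close> by (auto simp: less_Suc_eq)
  qed
  from step.IH[OF this] obtain X' where X': "indep_family n X'" "\<And>a. a < Suc r \<Longrightarrow> X' a = (X(r := \<lambda>i. of_bool (i = p))) a"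
    by blast
  have "X' a = X a" if "a < r" for a using X'(2)[of a] that by simp
  then show ?case using X'(1) by blast
qed

lemma indep_part_1: "i < n \<Longrightarrow> X 0 i \<noteq> 0 \<Longrightarrow> indep_part n 1 X"
  unfolding indep_part_def by (auto simp: lessThan_Suc)

lemma dual_basis:
  assumes F: "indep_family n F"
  shows "\<exists>X. indep_family n X \<and> (\<forall>a<n. \<forall>b<n. (\<Sum>i<n. X a i * F b i) = of_bool (a = b))"
proof -
  have "indep_family n (\<lambda>i b. F b i)"
    unfolding indep_family_def
  proof (intro allI impI)
    fix c i assume 0: "\<forall>b<n. (\<Sum>i<n. c i * F b i) = 0" and i: "i < n"
    obtain d where d: "\<And>l. l < n \<Longrightarrow> of_bool (l = i) = (\<Sum>b<n. d b * F b l)"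
      using indep_family_span[OF F, of "\<lambda>l. of_bool (l = i)"] by blast
    have "c i = (\<Sum>l<n. of_bool (l = i) * c l)" using i by (simp add: sum_unit)
    also have "\<dots> = (\<Sum>l<n. \<Sum>b<n. d b * (c l * F b l))" using d by (simp add: sum_distrib_right sum_distrib_left ac_simps)
    also have "\<dots> = (\<Sum>b<n. d b * (\<Sum>l<n. c l * F b l))" unfolding sum_distrib_left by (rule sum.swap)
    also have "\<dots> = 0" using 0 by simp
    finally show "c i = 0" .
  qed
  note span = indep_family_span[OF this]
  have "\<forall>a. \<exists>c. \<forall>b<n. of_bool (a = b) = (\<Sum>i<n. c i * F b i)"
  proof
    fix a
    show "\<exists>c. \<forall>b<n. of_bool (a = b) = (\<Sum>i<n. c i * F b i)"
      using span[of "\<lambda>b. of_bool (a = b)"] .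
  qed
  from choice[OF this] obtain X where X: "\<And>a b. b < n \<Longrightarrow> of_bool (a = b) = (\<Sum>i<n. X a i * F b i)" by blast
  have "indep_family n X"
    unfolding indep_family_def
  proof (intro allI impI)
    fix c b assume 0: "\<forall>i<n. (\<Sum>a<n. c a * X a i) = 0" and b: "b < n"
    have "c b = (\<Sum>a<n. c a * of_bool (b = a))" by (rule expand_unit_vectors[OF b])
    also have "\<dots> = (\<Sum>a<n. \<Sum>i<n. c a * X a i * F b i)" using X[OF b] by (simp add: eq_commute sum_distrib_left mult.assoc)
    also have "\<dots> = (\<Sum>i<n. (\<Sum>a<n. c a * X a i) * F b i)" unfolding sum_distrib_right by (rule sum.swap)
    also have "\<dots> = 0" using 0 by simp
    finally show "c b = 0" .
  qed
  then show ?thesis using X by (intro exI[of _ X]) auto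
qed

section \<open>Concise tensors of format three\<close>

lemma sum_less_3: "(\<Sum>i<3::nat. f i) = f 0 + f 1 + f 2" for f :: "nat \<Rightarrow> 'a::comm_monoid_add"
  by (simp add: numeral_3_eq_3 numeral_2_eq_2)

lemma less_3_cases: "i < 3 \<Longrightarrow> i = 0 \<or> i = 1 \<or> i = (2::nat)"
  by auto

lemma tri_linear3: "tri n1 n2 n3 T x y (\<lambda>l. a * p l + b * q l) = a * tri n1 n2 n3 T x y p + b * tri n1 n2 n3 T x y q"
  by (simp add: tri_def algebra_simps sum.distrib sum_distrib_left)

lemma tri_span1:
  assumes "indep_family n1 X" "\<And>a. a < n1 \<Longrightarrow> tri n1 n2 n3 T (X a) y z = 0"
  shows "tri n1 n2 n3 T x y z = 0"
proof -
  obtain c where c: "\<And>i. i < n1 \<Longrightarrow> x i = (\<Sum>a<n1. c a * X a i)" using indep_family_span[OF assms(1), of x] by blast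
  have "tri n1 n2 n3 T x y z = tri n1 n2 n3 T (\<lambda>i. \<Sum>a<n1. c a * X a i) y z" by (rule tri_cong) (simp_all add: c)
  also have "\<dots> = 0" unfolding tri_sum1 using assms(2) by simp
  finally show ?thesis .
qed

lemma tri_span2:
  assumes "indep_family n2 Y" "\<And>a. a < n2 \<Longrightarrow> tri n1 n2 n3 T x (Y a) z = 0"
  shows "tri n1 n2 n3 T x y z = 0"
  using tri_span1[OF assms(1), of n1 n3 "\<lambda>i j k. T j i k" x z y] assms(2) tri_swap12[of n2 n1 n3 T _ x z] by simp

lemma tri_span3:
  assumes "indep_family n3 Z" "\<And>a. a < n3 \<Longrightarrow> tri n1 n2 n3 T x y (Z a) = 0"
  shows "tri n1 n2 n3 T x y z = 0"
  using tri_span2[OF assms(1), of n1 n2 "\<lambda>i j k. T i k j" x y z] assms(2) tri_swap23[of n1 n3 n2 T x _ y] by simp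

lemma indep_family_unit: "indep_family n (\<lambda>a i. of_bool (i = a))"
  unfolding indep_family_def using expand_unit_vectors by metis

text \<open>Functionals \<open>L 0, ..., L (n - 1)\<close> that separate points form a basis of the
  dual space, so all prescribed values are attained. The abstract \<open>L\<close> stands for
  contractions of a tensor with two arguments fixed.\<close>

lemma dual_vectors:
  fixes L :: "nat \<Rightarrow> (nat \<Rightarrow> 'a::field) \<Rightarrow> 'a"
  assumes lin: "\<And>k x. L k x = (\<Sum>a<n. x a * L k (\<lambda>i. of_bool (i = a)))"
    and inj: "\<And>x. (\<And>k. k < n \<Longrightarrow> L k x = 0) \<Longrightarrow> \<forall>i<n. x i = 0"
  shows "\<exists>X. \<forall>i. \<forall>k<n. L k (X i) = of_bool (k = i)"
proof -
  have "indep_family n (\<lambda>a k. L k (\<lambda>i. of_bool (i = a)))"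
    unfolding indep_family_def
  proof (intro allI impI)
    fix c a assume "\<forall>k<n. (\<Sum>a<n. c a * L k (\<lambda>i. of_bool (i = a))) = 0" "a < n"
    then show "c a = 0" using inj[of c] lin[of _ c] by simp
  qed
  note span = indep_family_span[OF this]
  have "\<forall>i. \<exists>x. \<forall>k<n. L k x = of_bool (k = i)"
  proof
    fix i
    obtain c where "\<And>k. k < n \<Longrightarrow> of_bool (k = i) = (\<Sum>a<n. c a * L k (\<lambda>i. of_bool (i = a)))"
      using span[of "\<lambda>k. of_bool (k = i)"] by blast
    then show "\<exists>x. \<forall>k<n. L k x = of_bool (k = i)" using lin[of _ c] by (intro exI[of _ c]) simp
  qed
  from choice[OF this] show ?thesis .
qed

lemma tri_as_functional2: "tri n1 n2 n3 T x y z = (\<Sum>j<n2. y j * tri n1 n2 n3 T x (\<lambda>l. of_bool (l = j)) z)"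
proof -
  have "tri n1 n2 n3 T x y z = tri n1 n2 n3 T x (\<lambda>l. \<Sum>i<n2. y i * of_bool (l = i)) z"
    by (rule tri_cong) (simp_all add: expand_unit_vectors[symmetric])
  then show ?thesis unfolding tri_sum2 .
qed

lemma tri_as_functional3: "tri n1 n2 n3 T x y z = (\<Sum>k<n3. z k * tri n1 n2 n3 T x y (\<lambda>l. of_bool (l = k)))"
proof -
  have "tri n1 n2 n3 T x y z = tri n1 n2 n3 T x y (\<lambda>l. \<Sum>i<n3. z i * of_bool (l = i))"
    by (rule tri_cong) (simp_all add: expand_unit_vectors[symmetric])
  then show ?thesis unfolding tri_sum3 .
qed

text \<open>
  If \<open>T(\<cdot>, h, \<cdot>)\<close> and \<open>T(\<cdot>, \<cdot>, g)\<close> are both nondegenerate, the only entry of negative weight in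
  suitable bases, \<open>T(x, h, g)\<close> with \<open>x\<close> in a complement, vanishes because \<open>T(\<cdot>, h, g)\<close> has rank one.
\<close>

lemma null_algebra_case:
  fixes T :: "'a::field tensor3"
  assumes left: "\<And>x. (\<And>z. tri 3 3 3 T x h z = 0) \<Longrightarrow> \<forall>i<3. x i = 0"
    and right: "\<And>y. (\<And>x. tri 3 3 3 T x y g = 0) \<Longrightarrow> \<forall>i<3. y i = 0"
    and \<tau>: "0 < \<tau>" "\<tau> < 1 / 2" "binary_entropy (2 * \<tau>) - binary_entropy \<tau> + \<tau> = 0"
  shows "2 powr (\<tau> + binary_entropy \<tau>) \<le> asymptotic_subrank 3 3 3 T"
proof -
  obtain p where p: "p < 3" "g p \<noteq> 0"
  proof (rule ccontr)
    assume "\<not> thesis"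
    then have "g p = 0" if "p < 3" for p using \<open>\<And>p. p < 3 \<Longrightarrow> g p \<noteq> 0 \<Longrightarrow> thesis\<close> that by blast
    then have "tri 3 3 3 T x (\<lambda>_. 1) g = 0" for x unfolding tri_def by simp
    from right[OF this] show False by (metis zero_less_numeral zero_neq_one)
  qed
  obtain Z where Z: "indep_family 3 Z" "Z 0 = g"
    using indep_part_extend[OF indep_part_1[of p 3 "\<lambda>_. g"]] p by auto
  \<comment> \<open>\<open>X\<close> is dual to \<open>Z\<close> under the pairing given by
    \<open>h\<close>; in the same way \<open>Y\<close> is dual to \<open>X\<close> under the pairing
    given by \<open>g\<close>.\<close>
  obtain X where X: "\<And>i k. k < 3 \<Longrightarrow> tri 3 3 3 T (X i) h (Z k) = of_bool (k = i)"
  proof -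
    have "\<exists>X. \<forall>i. \<forall>k<3. (\<lambda>k x. tri 3 3 3 T x h (Z k)) k (X i) = of_bool (k = i)"
    proof (rule dual_vectors)
      show "tri 3 3 3 T x h (Z k) = (\<Sum>a<3. x a * tri 3 3 3 T (\<lambda>i. of_bool (i = a)) h (Z k))" for k x
        by (rule tri_as_functional)
      show "\<forall>i<3. x i = 0" if "\<And>k. k < 3 \<Longrightarrow> tri 3 3 3 T x h (Z k) = 0" for x
        by (rule left) (rule tri_span3[OF Z(1) that])
    qed
    then show ?thesis using that by blast
  qed
  have indX: "indep_family 3 X" unfolding indep_family_def
  proof (intro allI impI)
    fix c k assume 0: "\<forall>i<3. (\<Sum>a<3. c a * X a i) = 0" and k: "k < (3::nat)"
    have "0 = tri 3 3 3 T (\<lambda>i. 0) h (Z k)" by (simp add: tri_def)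
    also have "\<dots> = tri 3 3 3 T (\<lambda>i. \<Sum>a<3. c a * X a i) h (Z k)" by (rule tri_cong) (simp_all add: 0)
    also have "\<dots> = (\<Sum>a<3. c a * of_bool (k = a))" unfolding tri_sum1 using X[OF k] by simp
    also have "\<dots> = c k" by (rule expand_unit_vectors[OF k, symmetric])
    finally show "c k = 0" ..
  qed
  obtain Y where Y: "\<And>j i. i < 3 \<Longrightarrow> tri 3 3 3 T (X i) (Y j) g = of_bool (i = j)"
  proof -
    have "\<exists>Y. \<forall>j. \<forall>i<3. (\<lambda>i y. tri 3 3 3 T (X i) y g) i (Y j) = of_bool (i = j)"
    proof (rule dual_vectors)
      show "tri 3 3 3 T (X k) y g = (\<Sum>a<3. y a * tri 3 3 3 T (X k) (\<lambda>i. of_bool (i = a)) g)" for k y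
        by (rule tri_as_functional2)
      show "\<forall>i<3. y i = 0" if "\<And>k. k < 3 \<Longrightarrow> tri 3 3 3 T (X k) y g = 0" for y
        by (rule right) (rule tri_span1[OF indX that])
    qed
    then show ?thesis using that by blast
  qed
  \<comment> \<open>With \<open>h\<close> as second vector of index 0, the slices
    \<open>b = 0\<close> and \<open>c = 0\<close> are both identity matrices, and the pattern
    concerns only these two.\<close>
  define S where "S a b c = tri 3 3 3 T (X a) (if b = 0 then h else Y b) (Z c)" for a b c
  have S0: "S a 0 c = of_bool (c = a)" if "c < 3" for a c using X[OF that] by (simp add: S_def)
  have S1: "S a b 0 = of_bool (a = b)" if "a < 3" "b \<noteq> 0" for a b using Y[OF that(1)] that Z(2) by (simp add: S_def)
  have "2 powr (\<tau> + binary_entropy \<tau>) \<le> asymptotic_subrank 3 3 3 S"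
    by (rule null_algebra_pattern_lower_bound[OF _ _ _ _ _ _ _ _ _ _ _ \<tau>]) (simp_all add: S0 S1)
  moreover have "restricts 3 3 3 T 3 3 3 S" by (rule restrictsI) (simp add: S_def)
  moreover have "nonzero_on 3 3 3 S" by (rule nonzero_onI[of 0 _ 0 _ 0]) (simp_all add: S0)
  ultimately show ?thesis using asymptotic_subrank_mono by fastforce
qed

section \<open>Singular spaces of 3 x 3 matrices\<close>

definition det3 :: "(nat \<Rightarrow> nat \<Rightarrow> 'a::field) \<Rightarrow> 'a" where
  "det3 m = m 0 0 * (m 1 1 * m 2 2 - m 1 2 * m 2 1) - m 0 1 * (m 1 0 * m 2 2 - m 1 2 * m 2 0)
     + m 0 2 * (m 1 0 * m 2 1 - m 1 1 * m 2 0)"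

text \<open>Cramer's rule without division: each \<open>y j * det3 m\<close> is a combination of the
  vanishing sums, with cofactors as coefficients.\<close>

lemma det3_eq_0:
  assumes "j < 3" "y j \<noteq> 0" and y: "\<And>k. k < 3 \<Longrightarrow> (\<Sum>j<3. y j * m j k) = 0"
  shows "det3 m = 0"
proof -
  define s where "s k = y 0 * m 0 k + y 1 * m 1 k + y 2 * m 2 k" for k
  have s: "s 0 = 0" "s 1 = 0" "s 2 = 0" using y[of 0] y[of 1] y[of 2] by (simp_all add: s_def sum_less_3)
  have "y 0 * det3 m = s 0 * (m 1 1 * m 2 2 - m 1 2 * m 2 1) - s 1 * (m 1 0 * m 2 2 - m 1 2 * m 2 0)
      + s 2 * (m 1 0 * m 2 1 - m 1 1 * m 2 0)"
    by (simp add: det3_def s_def algebra_simps)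
  moreover have "y 1 * det3 m = - s 0 * (m 0 1 * m 2 2 - m 0 2 * m 2 1) + s 1 * (m 0 0 * m 2 2 - m 0 2 * m 2 0)
      - s 2 * (m 0 0 * m 2 1 - m 0 1 * m 2 0)"
    by (simp add: det3_def s_def algebra_simps)
  moreover have "y 2 * det3 m = s 0 * (m 0 1 * m 1 2 - m 0 2 * m 1 1) - s 1 * (m 0 0 * m 1 2 - m 0 2 * m 1 0)
      + s 2 * (m 0 0 * m 1 1 - m 0 1 * m 1 0)"
    by (simp add: det3_def s_def algebra_simps)
  ultimately have "y 0 * det3 m = 0" "y 1 * det3 m = 0" "y 2 * det3 m = 0" using s by simp_all
  then show ?thesis using assms(1,2) less_3_cases[of j] by auto
qed

text \<open>A kernel vector is used in place of \<open>det3\<close>, so that the notion is visibly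
  independent of the basis and its negation is the hypothesis of
  \<open>null_algebra_case\<close>.\<close>

definition singular :: "'a::field tensor3 \<Rightarrow> bool" where
  "singular T \<longleftrightarrow> (\<forall>x. \<exists>y. (\<exists>j<3. y j \<noteq> 0) \<and> (\<forall>z. tri 3 3 3 T x y z = 0))"

lemma singular_basis_change:
  assumes S: "\<And>a b c. a < 3 \<Longrightarrow> b < 3 \<Longrightarrow> c < 3 \<Longrightarrow> S a b c = tri 3 3 3 T (X a) (Y b) (Z c)"
    and Y: "indep_family 3 Y" and T: "singular T"
  shows "singular S"
  unfolding singular_def
proof
  fix x
  obtain y j where y: "j < 3" "y j \<noteq> 0" "\<And>z. tri 3 3 3 T (\<lambda>i. \<Sum>a<3. x a * X a i) y z = 0"
    using T unfolding singular_def by blast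
  obtain d where d: "\<And>i. i < 3 \<Longrightarrow> y i = (\<Sum>b<3. d b * Y b i)" using indep_family_span[OF Y, of y] by blast
  have "tri 3 3 3 S x d z = 0" for z
  proof -
    have "tri 3 3 3 S x d z
        = tri 3 3 3 T (\<lambda>i. \<Sum>a<3. x a * X a i) (\<lambda>i. \<Sum>b<3. d b * Y b i) (\<lambda>i. \<Sum>c<3. z c * Z c i)"
      by (rule tri_compose) (rule S)
    also have "\<dots> = tri 3 3 3 T (\<lambda>i. \<Sum>a<3. x a * X a i) y (\<lambda>i. \<Sum>c<3. z c * Z c i)"
      by (rule tri_cong) (simp_all add: d)
    finally show ?thesis using y(3) by simp
  qed
  moreover have "\<exists>b<3. d b \<noteq> 0"
  proof (rule ccontr)
    assume "\<not> ?thesis"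
    then have "(\<Sum>b<3. d b * Y b j) = 0" by (intro sum.neutral) auto
    then show False using d[OF y(1)] y(2) by simp
  qed
  ultimately show "\<exists>y. (\<exists>j<3. y j \<noteq> 0) \<and> (\<forall>z. tri 3 3 3 S x y z = 0)" by blast
qed

lemma singular_det3:
  assumes "singular S"
  shows "det3 (\<lambda>b c. \<Sum>a<3. v a * S a b c) = 0"
proof -
  obtain y j where y: "j < 3" "y j \<noteq> 0" "\<And>z. tri 3 3 3 S v y z = 0" using assms unfolding singular_def by blast
  show ?thesis
  proof (rule det3_eq_0[of j y, OF y(1,2)])
    fix k :: nat assume k: "k < 3"
    have "0 = tri 3 3 3 S v y (\<lambda>l. of_bool (l = k))" using y(3) by simp
    also have "\<dots> = (\<Sum>j<3. y j * tri 3 3 3 S v (\<lambda>l. of_bool (l = j)) (\<lambda>l. of_bool (l = k)))" by (rule tri_as_functional2)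
    also have "\<dots> = (\<Sum>j<3. y j * (\<Sum>a<3. v a * S a j k))" using k by (intro sum.cong refl) (simp add: tri_unit23)
    finally show "(\<Sum>j<3. y j * (\<Sum>a<3. v a * S a j k)) = 0" ..
  qed
qed

text \<open>Conciseness gives a slice of rank at least two, and singularity makes the rank exactly
  two. Its kernels on both sides, completed along a nonzero 2 x 2 minor, are bases in which it
  becomes \<open>diag(1, 1, 0)\<close>.\<close>

lemma singular_normal_form:
  fixes T :: "'a::field tensor3"
  assumes con: "concise 3 3 3 T" and sing: "singular T"
  shows "\<exists>S. equivalent 3 3 3 T 3 3 3 S \<and> singular S \<and> (\<forall>b<3. \<forall>c<3. S 0 b c = of_bool (b = c \<and> b < 2))"
proof -
  obtain x j j' k k' where jk: "j < 3" "j' < 3" "k < 3" "k' < 3" and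
    minor: "(\<Sum>i<3. x i * T i j k) * (\<Sum>i<3. x i * T i j' k') \<noteq> (\<Sum>i<3. x i * T i j k') * (\<Sum>i<3. x i * T i j' k)"
    using exists_rank_two_slice[OF con] by auto
  define m where "m j k = (\<Sum>i<3. x i * T i j k)" for j k
  define D where "D = m j k * m j' k' - m j k' * m j' k"
  have D: "D \<noteq> 0" using minor unfolding D_def m_def[symmetric] by simp
  have tm: "tri 3 3 3 T x (\<lambda>l. of_bool (l = b)) (\<lambda>l. of_bool (l = c)) = m b c" if "b < 3" "c < 3" for b c
    unfolding m_def by (rule tri_unit23[OF that])
  obtain y2 q where y2: "q < 3" "y2 q \<noteq> 0" "\<And>z. tri 3 3 3 T x y2 z = 0" using sing unfolding singular_def by blast
  have ymul: "(\<Sum>b<3. y2 b * m b c) = 0" if "c < 3" for c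
  proof -
    have "0 = tri 3 3 3 T x y2 (\<lambda>l. of_bool (l = c))" using y2(3) by simp
    also have "\<dots> = (\<Sum>b<3. y2 b * m b c)" by (subst tri_as_functional2) (simp add: tm that)
    finally show ?thesis ..
  qed
  \<comment> \<open>The columns of \<open>m\<close> are orthogonal to \<open>y2\<close> and hence do
    not span; a dependency among them is the kernel vector \<open>z2\<close> on the other
    side.\<close>
  have "\<not> indep_family 3 (\<lambda>c b. m b c)"
  proof
    assume "indep_family 3 (\<lambda>c b. m b c)"
    from indep_family_span[OF this, of "\<lambda>b. of_bool (b = q)"]
    obtain d where d: "\<And>b. b < 3 \<Longrightarrow> of_bool (b = q) = (\<Sum>c<3. d c * m b c)" by blast
    have "y2 q = (\<Sum>b<3. of_bool (b = q) * y2 b)" using y2(1) by (simp add: sum_unit)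
    also have "\<dots> = (\<Sum>b<3. \<Sum>c<3. d c * (y2 b * m b c))" using d by (simp add: sum_distrib_right sum_distrib_left ac_simps)
    also have "\<dots> = (\<Sum>c<3. d c * (\<Sum>b<3. y2 b * m b c))" unfolding sum_distrib_left by (rule sum.swap)
    also have "\<dots> = 0" using ymul by simp
    finally show False using y2(2) by simp
  qed
  then obtain z2 r where z2': "\<And>b. b < 3 \<Longrightarrow> (\<Sum>c<3. z2 c * m b c) = 0" and z2: "r < 3" "z2 r \<noteq> 0"
    unfolding indep_family_def by blast
  have z2z: "tri 3 3 3 T x y z2 = 0" for y
  proof (rule tri_span2[OF indep_family_unit])
    fix b :: nat assume b: "b < 3"
    show "tri 3 3 3 T x (\<lambda>l. of_bool (l = b)) z2 = 0"
      by (subst tri_as_functional3) (use z2'[OF b] tm[OF b] in simp)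
  qed
  have "\<exists>i<3. x i \<noteq> 0"
  proof (rule ccontr)
    assume "\<not> ?thesis"
    then have "m b c = 0" for b c unfolding m_def by (intro sum.neutral) auto
    then show False using D by (simp add: D_def)
  qed
  then obtain X where X: "indep_family 3 X" "X 0 = x"
    using indep_part_extend[OF indep_part_1[of _ 3 "\<lambda>_. x"]] by auto
  define Y where "Y b = (if b = 0 then (\<lambda>l. of_bool (l = j)) else if b = 1 then (\<lambda>l. of_bool (l = j')) else y2)" for b :: nat
  \<comment> \<open>The coefficients are the inverse of the minor \<open>D\<close>, which makes
    \<open>Z 0\<close> and \<open>Z 1\<close> dual to rows \<open>j\<close> and \<open>j'\<close> of
    \<open>m\<close>.\<close>
  define Z where "Z c = (if c = 0 then (\<lambda>l. m j' k' / D * of_bool (l = k) + - m j' k / D * of_bool (l = k'))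
    else if c = 1 then (\<lambda>l. - m j k' / D * of_bool (l = k) + m j k / D * of_bool (l = k')) else z2)" for c :: nat
  have tZ: "tri 3 3 3 T x y (Z 0) = m j' k' / D * tri 3 3 3 T x y (\<lambda>l. of_bool (l = k)) + - m j' k / D * tri 3 3 3 T x y (\<lambda>l. of_bool (l = k'))"
    "tri 3 3 3 T x y (Z 1) = - m j k' / D * tri 3 3 3 T x y (\<lambda>l. of_bool (l = k)) + m j k / D * tri 3 3 3 T x y (\<lambda>l. of_bool (l = k'))"
    "tri 3 3 3 T x y (Z 2) = 0" for y
    by (simp_all only: Z_def tri_linear3 if_True if_False one_neq_zero refl) (simp add: z2z)
  have YZ: "tri 3 3 3 T x (Y b) (Z c) = of_bool (b = c \<and> b < 2)" if "b < 3" "c < 3" for b c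
  proof -
    have "b = 0 \<or> b = 1 \<or> b = 2" "c = 0 \<or> c = 1 \<or> c = 2" using that by auto
    moreover have "m j' k' / D * m j k + - m j' k / D * m j k' = 1" "m j' k' / D * m j' k + - m j' k / D * m j' k' = 0"
      "- m j k' / D * m j k + m j k / D * m j k' = 0" "- m j k' / D * m j' k + m j k / D * m j' k' = 1"
      using D by (simp_all add: field_simps) (simp_all add: D_def algebra_simps)
    ultimately show ?thesis
      using jk by (elim disjE) (simp_all add: Y_def tZ tZ(2)[unfolded One_nat_def] tm y2(3))
  qed
  have indY: "indep_family 3 Y" unfolding indep_family_def
  proof (intro allI impI)
    fix c b assume 0: "\<forall>i<3. (\<Sum>b<3. c b * Y b i) = 0" and b: "b < (3::nat)"
    have eq: "(\<Sum>b<3. c b * of_bool (b = l \<and> b < 2)) = 0" if "l < 3" for l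
    proof -
      have "0 = tri 3 3 3 T x (\<lambda>i. 0) (Z l)" by (simp add: tri_def)
      also have "\<dots> = tri 3 3 3 T x (\<lambda>i. \<Sum>b<3. c b * Y b i) (Z l)" by (rule tri_cong) (simp_all add: 0)
      also have "\<dots> = (\<Sum>b<3. c b * of_bool (b = l \<and> b < 2))" unfolding tri_sum2 using YZ that by simp
      finally show ?thesis ..
    qed
    have c: "c 0 = 0" "c 1 = 0" using eq[of 0] eq[of 1] by (simp_all add: sum_less_3)
    then have "c 2 * y2 q = 0" using 0 y2(1) by (auto simp: sum_less_3 Y_def)
    then have "c 2 = 0" using y2(2) by simp
    then show "c b = 0" using c less_3_cases[OF b] by auto
  qed
  have indZ: "indep_family 3 Z" unfolding indep_family_def
  proof (intro allI impI)
    fix c b assume 0: "\<forall>i<3. (\<Sum>b<3. c b * Z b i) = 0" and b: "b < (3::nat)"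
    have eq: "(\<Sum>b<3. c b * of_bool (l = b \<and> l < 2)) = 0" if "l < 3" for l
    proof -
      have "0 = tri 3 3 3 T x (Y l) (\<lambda>i. 0)" by (simp add: tri_def)
      also have "\<dots> = tri 3 3 3 T x (Y l) (\<lambda>i. \<Sum>b<3. c b * Z b i)" by (rule tri_cong) (simp_all add: 0)
      also have "\<dots> = (\<Sum>b<3. c b * of_bool (l = b \<and> l < 2))" unfolding tri_sum3 using YZ that by simp
      finally show ?thesis ..
    qed
    have c: "c 0 = 0" "c 1 = 0" using eq[of 0] eq[of 1] by (simp_all add: sum_less_3)
    then have "c 2 * z2 r = 0" using 0 z2(1) by (auto simp: sum_less_3 Z_def)
    then have "c 2 = 0" using z2(2) by simp
    then show "c b = 0" using c less_3_cases[OF b] by auto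
  qed
  define S where "S a b c = tri 3 3 3 T (X a) (Y b) (Z c)" for a b c
  have "equivalent 3 3 3 T 3 3 3 S"
    by (rule restricts_basis_change[of _ _ _ _ _ X Y Z]) (simp_all add: S_def X indY indZ)
  moreover have "singular S" by (rule singular_basis_change[OF _ indY sing, of S X Z]) (simp add: S_def)
  moreover have "\<forall>b<3. \<forall>c<3. S 0 b c = of_bool (b = c \<and> b < 2)" using YZ X(2) by (simp add: S_def)
  ultimately show ?thesis by blast
qed

text \<open>The values at 0, at 1 and at one further element of the field determine the
  coefficients.\<close>

lemma quadratic_zero:
  fixes p0 p1 p2 :: "'a::alg_closed_field"
  assumes "\<And>s. p0 + p1 * s + p2 * (s * s) = 0"
  shows "p1 = 0" "p2 = 0"
proof -
  have p0: "p0 = 0" using assms[of 0] by simp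
  have p1: "p1 + p2 = 0" using assms[of 1] p0 by simp
  obtain s :: 'a where s: "s \<notin> {0, 1}" using infinite_alg_closed_field ex_new_if_finite[of "{0, 1 :: 'a}"] by blast
  have "s * (p1 + p2 * s) = 0" using assms[of s] p0 by (simp add: algebra_simps)
  then have "p1 + p2 * s = 0" using s by simp
  moreover have "p2 * (s - 1) = (p1 + p2 * s) - (p1 + p2)" by (simp add: algebra_simps)
  ultimately have "p2 * (s - 1) = 0" using p1 by simp
  then show "p2 = 0" using s by simp
  then show "p1 = 0" using p1 by simp
qed

text \<open>
  The coefficients of \<open>s\<close> and \<open>s^2\<close> in the determinant of \<open>B + s diag(1, 1, 0)\<close>, polarized.
\<close>

lemma singular_relations:
  fixes S :: "'a::alg_closed_field tensor3"
  assumes sing: "singular S" and S0: "\<forall>b<3. \<forall>c<3. S 0 b c = of_bool (b = c \<and> b < 2)"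
  shows "S 1 2 2 = 0" "S 2 2 2 = 0"
    "S 1 0 2 * S 1 2 0 + S 1 1 2 * S 1 2 1 = 0" "S 2 0 2 * S 2 2 0 + S 2 1 2 * S 2 2 1 = 0"
    "S 1 0 2 * S 2 2 0 + S 1 1 2 * S 2 2 1 + (S 2 0 2 * S 1 2 0 + S 2 1 2 * S 1 2 1) = 0"
proof -
  have rel: "v * S 1 2 2 + w * S 2 2 2 = 0 \<and>
      (v * S 1 0 2 + w * S 2 0 2) * (v * S 1 2 0 + w * S 2 2 0) + (v * S 1 1 2 + w * S 2 1 2) * (v * S 1 2 1 + w * S 2 2 1) = 0" for v w
  proof -
    define B where "B b c = v * S 1 b c + w * S 2 b c" for b c
    define p0 where "p0 = det3 B"
    define p1 where "p1 = B 2 2 * (B 0 0 + B 1 1) - (B 0 2 * B 2 0 + B 1 2 * B 2 1)"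
    have "p0 + p1 * s + B 2 2 * (s * s) = 0" for s
    proof -
      define m where "m b c = (\<Sum>a<3. (if a = 0 then s else if a = 1 then v else w) * S a b c)" for b c
      have m: "m b c = s * of_bool (b = c \<and> b < 2) + B b c" if "b < 3" "c < 3" for b c
        unfolding m_def using S0 that by (simp add: sum_less_3 B_def)
      have "det3 m = 0" unfolding m_def by (rule singular_det3[OF sing])
      then show ?thesis unfolding det3_def p0_def p1_def by (simp add: m algebra_simps)
    qed
    then have "p1 = 0" "B 2 2 = 0" using quadratic_zero[of p0 p1 "B 2 2"] by blast+
    then show ?thesis by (simp add: p1_def B_def)
  qed
  show "S 1 2 2 = 0" "S 2 2 2 = 0" using rel[of 1 0] rel[of 0 1] by simp_all
  show 1: "S 1 0 2 * S 1 2 0 + S 1 1 2 * S 1 2 1 = 0" using rel[of 1 0] by simp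
  show 2: "S 2 0 2 * S 2 2 0 + S 2 1 2 * S 2 2 1 = 0" using rel[of 0 1] by simp
  have "(S 1 0 2 + S 2 0 2) * (S 1 2 0 + S 2 2 0) + (S 1 1 2 + S 2 1 2) * (S 1 2 1 + S 2 2 1) = 0"
    using rel[of 1 1] by simp
  then have "(S 1 0 2 * S 1 2 0 + S 1 1 2 * S 1 2 1) + (S 2 0 2 * S 2 2 0 + S 2 1 2 * S 2 2 1)
    + (S 1 0 2 * S 2 2 0 + S 1 1 2 * S 2 2 1 + (S 2 0 2 * S 1 2 0 + S 2 1 2 * S 1 2 1)) = 0"
    by (simp add: algebra_simps)
  then show "S 1 0 2 * S 2 2 0 + S 1 1 2 * S 2 2 1 + (S 2 0 2 * S 1 2 0 + S 2 1 2 * S 1 2 1) = 0"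
    unfolding 1 2 by simp
qed

text \<open>For \<open>a = 1, 2\<close> let \<open>r_a = (S a 2 0, S a 2 1)\<close> and
  \<open>k_a = (S a 0 2, S a 1 2)\<close>. The relations say that the products
  \<open>k_1 r_1\<close>, \<open>k_2 r_2\<close> and \<open>k_1 r_2 + k_2 r_1\<close> vanish, while
  \<open>e = k_2 r_1\<close> does not. This makes \<open>r_1\<close> and \<open>r_2\<close>
  independent. Mixing slices 1 and 2 by the adjugate of their matrix turns them into
  \<open>(D, 0)\<close> and \<open>(0, D)\<close>, and the relations then force the columns to be
  \<open>(0, -e)\<close> and \<open>(e, 0)\<close>.\<close>

lemma determinant_case:
  fixes S :: "'a::alg_closed_field tensor3"
  assumes sing: "singular S" and S0: "\<And>b c. b < 3 \<Longrightarrow> c < 3 \<Longrightarrow> S 0 b c = of_bool (b = c \<and> b < 2)"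
    and nz: "S 2 0 2 * S 1 2 0 + S 2 1 2 * S 1 2 1 \<noteq> 0"
  shows "2 powr (binary_entropy (1 / 3) + 2 / 3) \<le> asymptotic_subrank 3 3 3 S"
proof -
  have "\<forall>b<3. \<forall>c<3. S 0 b c = of_bool (b = c \<and> b < 2)" using S0 by blast
  note rel = singular_relations[OF sing this]
  define e where "e = S 2 0 2 * S 1 2 0 + S 2 1 2 * S 1 2 1"
  define D where "D = S 1 2 0 * S 2 2 1 - S 1 2 1 * S 2 2 0"
  have e: "e \<noteq> 0" using nz by (simp add: e_def)
  have e': "S 1 0 2 * S 2 2 0 + S 1 1 2 * S 2 2 1 = - e" using rel(5) unfolding e_def by (rule eq_neg_iff_add_eq_0[THEN iffD2])
  \<comment> \<open>If the rows were parallel, \<open>e\<close> times the row of slice 2 would be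
    the row of slice 1 times a vanishing product; so the row of slice 2 would be zero, against
    \<open>e'\<close>.\<close>
  have D: "D \<noteq> 0"
  proof
    assume "D = 0"
    then have DD: "S 1 2 0 * S 2 2 1 = S 1 2 1 * S 2 2 0" by (simp add: D_def)
    have "S 2 2 0 * e = S 1 2 0 * (S 2 0 2 * S 2 2 0 + S 2 1 2 * S 2 2 1)"
      using DD unfolding e_def by (simp add: algebra_simps)
    then have 1: "S 2 2 0 = 0" using rel(4) e by simp
    have "S 2 2 1 * e = S 1 2 1 * (S 2 0 2 * S 2 2 0 + S 2 1 2 * S 2 2 1)"
      using DD unfolding e_def by (simp add: algebra_simps)
    then have "S 2 2 1 = 0" using rel(4) e by simp
    then show False using 1 e e' by simp
  qed
  define X where "X a i = (if a = 0 then (if i = 0 then 1 else 0) else if a = 1 then (if i = 0 then 0 else if i = 1 then S 2 2 1 else - S 1 2 1)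
     else (if i = 0 then 0 else if i = 1 then - S 2 2 0 else S 1 2 0))" for a i :: nat
  define R where "R a b c = (\<Sum>i<3. X a i * S i b c)" for a b c
  have R: "R 0 b c = S 0 b c" "R 1 b c = S 2 2 1 * S 1 b c - S 1 2 1 * S 2 b c" "R 2 b c = S 1 2 0 * S 2 b c - S 2 2 0 * S 1 b c" for b c
    by (simp_all add: R_def X_def sum_less_3)
  \<comment> \<open>This identity and the next three are combinations of the orthogonality relations
    with coefficients quadratic in the rows.\<close>
  have "D * R 1 0 2 = 0"
  proof -
    have "D * R 1 0 2 = S 2 2 1 * S 2 2 1 * (S 1 0 2 * S 1 2 0 + S 1 1 2 * S 1 2 1) + S 1 2 1 * S 1 2 1 * (S 2 0 2 * S 2 2 0 + S 2 1 2 * S 2 2 1)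
       - S 2 2 1 * S 1 2 1 * (S 1 0 2 * S 2 2 0 + S 1 1 2 * S 2 2 1 + (S 2 0 2 * S 1 2 0 + S 2 1 2 * S 1 2 1))"
      unfolding R D_def by (simp add: algebra_simps)
    then show ?thesis unfolding rel by simp
  qed
  then have r1: "R 1 0 2 = 0" using D by simp
  have "D * R 2 1 2 = 0"
  proof -
    have "D * R 2 1 2 = S 2 2 0 * S 2 2 0 * (S 1 0 2 * S 1 2 0 + S 1 1 2 * S 1 2 1) + S 1 2 0 * S 1 2 0 * (S 2 0 2 * S 2 2 0 + S 2 1 2 * S 2 2 1)
       - S 2 2 0 * S 1 2 0 * (S 1 0 2 * S 2 2 0 + S 1 1 2 * S 2 2 1 + (S 2 0 2 * S 1 2 0 + S 2 1 2 * S 1 2 1))"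
      unfolding R D_def by (simp add: algebra_simps)
    then show ?thesis unfolding rel by simp
  qed
  then have r2: "R 2 1 2 = 0" using D by simp
  have "D * R 2 0 2 = D * e"
  proof -
    have "D * R 2 0 2 - D * e = - S 2 2 0 * S 2 2 1 * (S 1 0 2 * S 1 2 0 + S 1 1 2 * S 1 2 1) - S 1 2 0 * S 1 2 1 * (S 2 0 2 * S 2 2 0 + S 2 1 2 * S 2 2 1)
        + S 2 2 0 * S 1 2 1 * (S 1 0 2 * S 2 2 0 + S 1 1 2 * S 2 2 1 + (S 2 0 2 * S 1 2 0 + S 2 1 2 * S 1 2 1))"
      unfolding R D_def e_def by (simp add: algebra_simps)
    then show ?thesis unfolding rel by simp
  qed
  then have r3: "R 2 0 2 = e" using D by simp
  have "D * R 1 1 2 = - (D * e)"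
  proof -
    have "D * R 1 1 2 + D * e = - S 2 2 0 * S 2 2 1 * (S 1 0 2 * S 1 2 0 + S 1 1 2 * S 1 2 1) - S 1 2 0 * S 1 2 1 * (S 2 0 2 * S 2 2 0 + S 2 1 2 * S 2 2 1)
        + S 1 2 0 * S 2 2 1 * (S 1 0 2 * S 2 2 0 + S 1 1 2 * S 2 2 1 + (S 2 0 2 * S 1 2 0 + S 2 1 2 * S 1 2 1))"
      unfolding R D_def e_def by (simp add: algebra_simps)
    then show ?thesis unfolding rel by (simp add: eq_neg_iff_add_eq_0)
  qed
  then have "D * (R 1 1 2 + e) = 0" by (simp add: algebra_simps)
  then have r4: "R 1 1 2 = - e" using D by (simp add: eq_neg_iff_add_eq_0)
  have r5: "R 1 2 0 = D" "R 1 2 1 = 0" "R 2 2 0 = 0" "R 2 2 1 = D"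
    unfolding R D_def by (simp_all add: algebra_simps)
  have r6: "R i 2 2 = 0" if "i < 3" for i using less_3_cases[OF that] rel(1,2) S0[of 2 2]
    by (elim disjE; simp only: R; simp)
  have r0: "R 0 b c = of_bool (b = c \<and> b < 2)" if "b < 3" "c < 3" for b c using S0[OF that] by (simp add: R)
  have "2 powr (binary_entropy (1 / 3) + 2 / 3) \<le> asymptotic_subrank 3 3 3 R"
    by (rule determinant_pattern_lower_bound) (use e D in \<open>simp_all only: r0 r1 r2 r3 r4 r5 r6\<close>, simp_all)
  moreover have "restricts 3 3 3 S 3 3 3 R"
    by (rule restrictsI[of _ _ _ _ _ _ _ _ X "\<lambda>b l. of_bool (l = b)" "\<lambda>c l. of_bool (l = c)"]) (simp add: tri_unit23 R_def)
  moreover have "nonzero_on 3 3 3 R" by (rule nonzero_onI[of 0 _ 0 _ 0]) (simp_all add: r0)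
  ultimately show ?thesis using asymptotic_subrank_mono by fastforce
qed

section \<open>Matrices supported on row 1 and column 0\<close>

definition arrow :: "'a::zero tensor3 \<Rightarrow> bool" where
  "arrow S \<longleftrightarrow> (\<forall>a<3. S a 0 1 = 0 \<and> S a 0 2 = 0 \<and> S a 2 1 = 0 \<and> S a 2 2 = 0)"

lemma concise3_entry:
  assumes con: "concise n1 n2 n3 S" and "k < n3"
  shows "\<exists>i<n1. \<exists>j<n2. S i j k \<noteq> 0"
proof (rule ccontr)
  assume "\<not> ?thesis"
  then have "(\<Sum>l<n3. of_bool (l = k) * S i j l) = 0" if "i < n1" "j < n2" for i j
    using that assms(2) by (simp add: sum_unit)
  then show False
    using con concise1D[of n3 n2 n1 "\<lambda>i j k. S k j i" "\<lambda>l. of_bool (l = k)" k] assms(2)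
    unfolding concise_def by simp
qed

lemma concise2_entry:
  assumes con: "concise n1 n2 n3 S" and "j < n2"
  shows "\<exists>i<n1. \<exists>k<n3. S i j k \<noteq> 0"
proof (rule ccontr)
  assume "\<not> ?thesis"
  then have "(\<Sum>l<n2. of_bool (l = j) * S i l k) = 0" if "i < n1" "k < n3" for i k
    using that assms(2) by (simp add: sum_unit)
  then show False
    using con concise1D[of n2 n1 n3 "\<lambda>i j k. S j i k" "\<lambda>l. of_bool (l = j)" j] assms(2)
    unfolding concise_def by simp
qed

lemma indep_family_3:
  assumes "det3 Y \<noteq> 0"
  shows "indep_family 3 Y"
  unfolding indep_family_def
proof (intro allI impI, rule ccontr)
  fix c a assume "\<forall>i<3. (\<Sum>a<3. c a * Y a i) = 0" "a < 3" "c a \<noteq> 0"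
  then show False using det3_eq_0[of a c Y] assms by simp
qed

text \<open>In a plane, all vectors \<open>(S a 2 0, S a 2 1)\<close> are orthogonal to all vectors
  \<open>(S b 0 2, S b 1 2)\<close>, and by conciseness neither family is zero; so each spans a
  line. Bases adapted to these lines clear every required entry except
  \<open>R a 0 1\<close>.\<close>

lemma arrow_case:
  fixes S :: "'a::alg_closed_field tensor3"
  assumes con: "concise 3 3 3 S" and sing: "singular S"
    and S0: "\<And>b c. b < 3 \<Longrightarrow> c < 3 \<Longrightarrow> S 0 b c = of_bool (b = c \<and> b < 2)"
    and zero: "S 2 0 2 * S 1 2 0 + S 2 1 2 * S 1 2 1 = 0"
  shows "\<exists>R. equivalent 3 3 3 S 3 3 3 R \<and> arrow R"
proof -
  have "\<forall>b<3. \<forall>c<3. S 0 b c = of_bool (b = c \<and> b < 2)" using S0 by blast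
  note rel = singular_relations[OF sing this]
  have rel22: "S a 2 2 = 0" if "a < 3" for a using less_3_cases[OF that] rel(1,2) S0[of 2 2] by auto
  have zero': "S 1 0 2 * S 2 2 0 + S 1 1 2 * S 2 2 1 = 0" using rel(5) zero by simp
  have orth: "S b 0 2 * S a 2 0 + S b 1 2 * S a 2 1 = 0" if "a < 3" "b < 3" for a b
    using less_3_cases[OF that(1)] less_3_cases[OF that(2)] rel(3,4) zero zero' S0 by (elim disjE) simp_all
  obtain a0 k0 where a0: "a0 < 3" "k0 < 3" "S a0 2 k0 \<noteq> 0" using concise2_entry[OF con, of 2] by auto
  obtain b0 j0 where b0: "b0 < 3" "j0 < 3" "S b0 j0 2 \<noteq> 0" using concise3_entry[OF con, of 2] by auto
  define p q where "p = S a0 2 0" and "q = S a0 2 1"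
  define p' q' where "p' = S b0 0 2" and "q' = S b0 1 2"
  have pq: "p \<noteq> 0 \<or> q \<noteq> 0" using a0 rel22[OF a0(1)] less_3_cases[OF a0(2)] by (auto simp: p_def q_def)
  have pq': "p' \<noteq> 0 \<or> q' \<noteq> 0" using b0 rel22[OF b0(1)] less_3_cases[OF b0(2)] by (auto simp: p'_def q'_def)
  define Y where "Y b l = (if b = 0 then (if l = 0 then p else if l = 1 then q else 0)
    else if b = 1 then of_bool (l = (if p = 0 then 0 else 1)) else of_bool (l = 2))" for b l :: nat
  define Z where "Z c l = (if c = 1 then (if l = 0 then p' else if l = 1 then q' else 0)
    else if c = 0 then of_bool (l = (if p' = 0 then 0 else 1)) else of_bool (l = 2))" for c l :: nat
  have indY: "indep_family 3 Y" by (rule indep_family_3) (use pq in \<open>auto simp: det3_def Y_def\<close>)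
  have indZ: "indep_family 3 Z" by (rule indep_family_3) (use pq' in \<open>auto simp: det3_def Z_def\<close>)
  define R where "R a b c = (\<Sum>j<3. Y b j * (\<Sum>k<3. Z c k * S a j k))" for a b c
  have R: "R a b c = tri 3 3 3 S (\<lambda>i. of_bool (i = a)) (Y b) (Z c)" if "a < 3" for a b c
    unfolding tri_nested sum_unit[OF that] R_def ..
  have equiv: "equivalent 3 3 3 S 3 3 3 R"
    by (rule restricts_basis_change[of _ _ _ _ _ "\<lambda>a i. of_bool (i = a)" Y Z]) (simp_all add: R indY indZ indep_family_unit)
  have conR: "concise 3 3 3 R" using concise_transfer[OF con] equiv unfolding equivalent_def by blast
  have singR: "singular R" by (rule singular_basis_change[OF _ indY sing, of R "\<lambda>a i. of_bool (i = a)" Z]) (simp add: R)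
  have z1: "R a 0 2 = 0" if "a < 3" for a
    using orth[OF a0(1) that] by (simp add: R_def Y_def Z_def sum_less_3 p_def q_def algebra_simps)
  have z2: "R a 2 1 = 0" if "a < 3" for a
    using orth[OF that b0(1)] by (simp add: R_def Y_def Z_def sum_less_3 p'_def q'_def algebra_simps)
  have z3: "R a 2 2 = 0" if "a < 3" for a
    using rel22[OF that] by (simp add: R_def Y_def Z_def sum_less_3)
  have z4: "R a 0 1 = 0" if a: "a < 3" for a
  proof (rule ccontr)
    assume "R a 0 1 \<noteq> 0"
    \<comment> \<open>With the other zeros in place the determinant is a single product of three
      linear forms. Conciseness makes two of them nonzero, so on a generic vector the product
      vanishes only if the third form, \<open>R a 0 1\<close>, is zero.\<close>
    have prod: "(\<Sum>a<3. v a * R a 0 1) * (\<Sum>a<3. v a * R a 1 2) * (\<Sum>a<3. v a * R a 2 0) = 0" for v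
    proof -
      have "(\<Sum>a<3. v a * R a 0 2) = 0" "(\<Sum>a<3. v a * R a 2 1) = 0" "(\<Sum>a<3. v a * R a 2 2) = 0"
        using z1 z2 z3 by (simp_all add: sum_less_3)
      then show ?thesis using singular_det3[OF singR, of v] unfolding det3_def by (simp add: mult.assoc)
    qed
    obtain i j where "i < 3" "j < 3" "R i j 2 \<noteq> 0" using concise3_entry[OF conR, of 2] by auto
    then have 1: "\<exists>i<3. R i 1 2 \<noteq> 0" using z1[of i] z3[of i] less_3_cases[of j] by auto
    obtain i k where "i < 3" "k < 3" "R i 2 k \<noteq> 0" using concise2_entry[OF conR, of 2] by auto
    then have 2: "\<exists>i<3. R i 2 0 \<noteq> 0" using z2[of i] z3[of i] less_3_cases[of k] by auto
    obtain v where "(\<Sum>i<3. v i * R i 0 1) \<noteq> 0" "(\<Sum>i<3. v i * R i 1 2) \<noteq> 0" "(\<Sum>i<3. v i * R i 2 0) \<noteq> 0"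
      using avoid_hyperplanes[of "[\<lambda>i. R i 0 1, \<lambda>i. R i 1 2, \<lambda>i. R i 2 0]" 3] 1 2 \<open>R a 0 1 \<noteq> 0\<close> a by auto
    then show False using prod[of v] by simp
  qed
  have "arrow R" using z1 z2 z3 z4 by (simp add: arrow_def)
  then show ?thesis using equiv by blast
qed

text \<open>The linear forms \<open>S i 0 0\<close> and \<open>S i 2 0\<close> in \<open>i\<close>
  are independent by conciseness (\<open>ykill\<close>). If both vanish at index 2, then row 1 and
  column 0 are nondegenerate contractions and the null algebra appears. Otherwise bases adapted to a
  common zero of the two forms give the pattern with exponent 3/2.\<close>

lemma arrow_normalized_lower_bound:
  fixes S :: "'a::field tensor3"
  assumes con: "concise 3 3 3 S" and arr: "arrow S"
    and e: "\<And>a. a < 3 \<Longrightarrow> S a 1 1 = of_bool (a = 0)" and k: "\<And>a. a < 3 \<Longrightarrow> S a 1 2 = of_bool (a = 1)"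
    and \<tau>: "0 < \<tau>" "\<tau> < 1 / 2" "binary_entropy (2 * \<tau>) - binary_entropy \<tau> + \<tau> = 0"
  shows "2 powr (\<tau> + binary_entropy \<tau>) \<le> asymptotic_subrank 3 3 3 S"
proof -
  have z: "S a 0 1 = 0" "S a 0 2 = 0" "S a 2 1 = 0" "S a 2 2 = 0" if "a < 3" for a
    using arr that by (simp_all add: arrow_def)
  have ykill: "y 0 = 0 \<and> y 2 = 0" if y: "y 1 = 0" "\<And>i. i < 3 \<Longrightarrow> y 0 * S i 0 0 + y 2 * S i 2 0 = 0" for y :: "nat \<Rightarrow> 'a"
  proof -
    have "(\<Sum>j<3. y j * S i j c) = 0" if "i < 3" "c < 3" for i c
      using less_3_cases[OF that(2)] z[OF that(1)] y(1) y(2)[OF that(1)] by (elim disjE) (simp_all add: sum_less_3)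
    then have "y j = 0" if "j < 3" for j
      using con concise1D[of 3 3 3 "\<lambda>i j k. S j i k" y j] that unfolding concise_def by blast
    then show ?thesis by simp
  qed
  show ?thesis
  proof (cases "S 2 0 0 = 0 \<and> S 2 2 0 = 0")
    case True
    have d: "S 2 1 0 \<noteq> 0"
    proof
      assume "S 2 1 0 = 0"
      have "(\<Sum>i<3. of_bool (i = 2) * S i j c) = 0" if "j < 3" "c < 3" for j c
        using less_3_cases[OF that(1)] less_3_cases[OF that(2)] True \<open>S 2 1 0 = 0\<close> z[of 2] e[of 2] k[of 2]
        by (elim disjE) (simp_all add: sum_less_3)
      then show False using con concise1D[of 3 3 3 S "\<lambda>i. of_bool (i = 2)" 2] unfolding concise_def by simp
    qed
    show ?thesis
    proof (rule null_algebra_case[of S "\<lambda>l. of_bool (l = 1)" "\<lambda>l. of_bool (l = 0)", OF _ _ \<tau>])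
      fix x assume "\<And>z. tri 3 3 3 S x (\<lambda>l. of_bool (l = 1)) z = 0"
      then have x: "(\<Sum>i<3. x i * S i 1 c) = 0" if "c < 3" for c using that tri_unit23[of 1 3 c 3 3 S x] by simp
      have "x 0 = 0" "x 1 = 0" using x[of 1] x[of 2] e k by (simp_all add: sum_less_3)
      moreover from this have "x 2 = 0" using x[of 0] d by (simp add: sum_less_3)
      ultimately show "\<forall>i<3. x i = 0" using less_3_cases by auto
    next
      fix y assume 0: "\<And>x. tri 3 3 3 S x y (\<lambda>l. of_bool (l = 0)) = 0"
      have y: "(\<Sum>j<3. y j * S i j 0) = 0" if "i < 3" for i
        using 0[of "\<lambda>l. of_bool (l = i)"] tri_unit23[of i 3 0 3 3 "\<lambda>i j k. S j i k" y] tri_swap12[of 3 3 3 S y "\<lambda>l. of_bool (l = i)"] that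
        by simp
      have y1: "y 1 = 0" using y[of 2] True d by (simp add: sum_less_3)
      have "y 0 = 0 \<and> y 2 = 0" by (rule ykill[of y, OF y1]) (use y y1 in \<open>simp add: sum_less_3\<close>)
      then show "\<forall>i<3. y i = 0" using y1 less_3_cases by auto
    qed
  next
    case False
    \<comment> \<open>A common zero of the two forms. It is not a multiple of the unit vector of
      index 2, at which one of the forms is nonzero.\<close>
    obtain g where g: "\<exists>i\<in>{..<3}. g i \<noteq> 0" "(\<Sum>i<3. g i * S i 0 0) = 0" "(\<Sum>i<3. g i * S i 2 0) = 0"
      using homogeneous_system[of "{0, 2}" "{..<3}" "\<lambda>b i. S i b 0"] by auto
    have g01: "g 0 \<noteq> 0 \<or> g 1 \<noteq> 0"
    proof (rule ccontr)
      assume "\<not> ?thesis"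
      moreover from this have "g 2 \<noteq> 0" using g(1) less_3_cases by fastforce
      ultimately show False using g(2,3) False by (simp add: sum_less_3)
    qed
    \<comment> \<open>The vector \<open>(h0, h1, 0)\<close> is a unit vector chosen to form a basis
      together with \<open>g\<close> and the unit vector of index 2.\<close>
    define h0 h1 where "h0 = (if g 1 \<noteq> 0 then 1 else 0 :: 'a)" and "h1 = (if g 1 \<noteq> 0 then 0 else 1 :: 'a)"
    have D: "h0 * g 1 - h1 * g 0 \<noteq> 0" using g01 by (auto simp: h0_def h1_def)
    define al ro where "al = h0 * S 0 0 0 + h1 * S 1 0 0" and "ro = h0 * S 0 2 0 + h1 * S 1 2 0"
    \<comment> \<open>Both forms vanish on \<open>g\<close>, so their independence must show on the
      other two basis vectors.\<close>
    have E: "S 2 0 0 * ro - S 2 2 0 * al \<noteq> 0"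
    proof
      assume E0: "S 2 0 0 * ro - S 2 2 0 * al = 0"
      define f where "f i = - S 2 2 0 * S i 0 0 + S 2 0 0 * S i 2 0" for i
      have f2: "f 2 = 0" by (simp add: f_def)
      have fh: "h0 * f 0 + h1 * f 1 = 0" using E0 by (simp add: f_def al_def ro_def algebra_simps)
      have "g 0 * f 0 + g 1 * f 1 + g 2 * f 2 = - S 2 2 0 * (\<Sum>i<3. g i * S i 0 0) + S 2 0 0 * (\<Sum>i<3. g i * S i 2 0)"
        by (simp add: f_def sum_less_3 algebra_simps)
      then have fg: "g 0 * f 0 + g 1 * f 1 = 0" using g f2 by simp
      have "(h0 * g 1 - h1 * g 0) * f 0 = g 1 * (h0 * f 0 + h1 * f 1) - h1 * (g 0 * f 0 + g 1 * f 1)"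
        "(h0 * g 1 - h1 * g 0) * f 1 = h0 * (g 0 * f 0 + g 1 * f 1) - g 0 * (h0 * f 0 + h1 * f 1)"
        by (simp_all add: algebra_simps)
      then have "(h0 * g 1 - h1 * g 0) * f 0 = 0" "(h0 * g 1 - h1 * g 0) * f 1 = 0" unfolding fh fg by simp_all
      then have "f 0 = 0" "f 1 = 0" using D by (metis mult_eq_0_iff)+
      then have "f i = 0" if "i < 3" for i using less_3_cases[OF that] f2 by auto
      then have "- S 2 2 0 = 0 \<and> S 2 0 0 = 0"
        using ykill[of "\<lambda>i. if i = 0 then - S 2 2 0 else if i = 2 then S 2 0 0 else 0"] by (simp add: f_def)
      then show False using False by simp
    qed
    \<comment> \<open>Relative to the basis \<open>X\<close>, the vectors \<open>Z 1\<close> and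
      \<open>Z 2\<close> turn row 1 into multiples of the forms dual to \<open>X 1\<close> and
      \<open>X 2\<close>, and \<open>Y 1\<close> and \<open>Y 2\<close> turn column 0 into multiples
      of the forms dual to \<open>X 1\<close> and \<open>X 0\<close>.\<close>
    define X where "X a l = (if a = 0 then of_bool (l = 2) else if a = 1 then (if l = 0 then h0 else if l = 1 then h1 else 0) else g l)" for a l :: nat
    define Y where "Y b l = (if b = 0 then of_bool (l = 1) else if b = 1 then (if l = 0 then - S 2 2 0 else if l = 2 then S 2 0 0 else 0)
      else (if l = 0 then - ro else if l = 2 then al else 0))" for b l :: nat
    define Z where "Z c l = (if c = 0 then of_bool (l = 0) else if c = 1 then (if l = 0 then 0 else if l = 1 then - g 1 else g 0)
      else (if l = 0 then 0 else if l = 1 then - h1 else h0))" for c l :: nat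
    define R where "R a b c = (\<Sum>i<3. X a i * (\<Sum>j<3. Y b j * (\<Sum>k<3. Z c k * S i j k)))" for a b c
    have R: "R a b c = tri 3 3 3 S (X a) (Y b) (Z c)" for a b c unfolding tri_nested R_def ..
    note ex = R_def X_def Y_def Z_def sum_less_3
    have ent: "S 0 1 1 = 1" "S 1 1 1 = 0" "S 2 1 1 = 0" "S 0 1 2 = 0" "S 1 1 2 = 1" "S 2 1 2 = 0"
      using e[of 0] e[of 1] e[of 2] k[of 0] k[of 1] k[of 2] by simp_all
    note zs = z[of 0, simplified] z[of 1, simplified] z[of 2, simplified] ent[unfolded One_nat_def]
    have r101: "R 1 0 1 = - (h0 * g 1 - h1 * g 0)" by (simp add: ex zs algebra_simps)
    have r202: "R 2 0 2 = h0 * g 1 - h1 * g 0" by (simp add: ex zs algebra_simps)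
    have r110: "R 1 1 0 = S 2 0 0 * ro - S 2 2 0 * al" by (simp add: ex zs al_def ro_def algebra_simps)
    have r020: "R 0 2 0 = - (S 2 0 0 * ro - S 2 2 0 * al)" by (simp add: ex zs algebra_simps)
    have r102: "R 1 0 2 = 0" "R 1 2 0 = 0" "R 2 0 1 = 0" "R 0 0 1 = 0" "R 0 0 2 = 0" "R 0 1 0 = 0"
      by (simp_all add: ex zs al_def ro_def algebra_simps)
    have gg: "g 0 * S 0 0 0 + g 1 * S 1 0 0 + g 2 * S 2 0 0 = 0" "g 0 * S 0 2 0 + g 1 * S 1 2 0 + g 2 * S 2 2 0 = 0"
      using g(2,3) by (simp_all add: sum_less_3)
    have "R 2 1 0 = - S 2 2 0 * (g 0 * S 0 0 0 + g 1 * S 1 0 0 + g 2 * S 2 0 0) + S 2 0 0 * (g 0 * S 0 2 0 + g 1 * S 1 2 0 + g 2 * S 2 2 0)"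
      by (simp add: ex zs algebra_simps)
    then have r210: "R 2 1 0 = 0" unfolding gg by simp
    have "R 2 2 0 = - ro * (g 0 * S 0 0 0 + g 1 * S 1 0 0 + g 2 * S 2 0 0) + al * (g 0 * S 0 2 0 + g 1 * S 1 2 0 + g 2 * S 2 2 0)"
      by (simp add: ex zs algebra_simps)
    then have r220: "R 2 2 0 = 0" unfolding gg by simp
    have blk: "R i b c = 0" if "b \<in> {1, 2}" "c \<in> {1, 2}" for i b c
      using that by (auto simp: R_def Y_def Z_def sum_less_3 zs)
    have nz: "R 1 0 1 \<noteq> 0" "R 1 1 0 \<noteq> 0" "R 2 0 2 \<noteq> 0" "R 0 2 0 \<noteq> 0" unfolding r101 r202 r110 r020 using D E by simp_all
    have "2 powr (3 / 2) \<le> asymptotic_subrank 3 3 3 R"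
      by (rule V_pattern_lower_bound[OF nz r102(1,2,3) r210 r220 r102(4,5,6)]) (rule blk)
    moreover have "restricts 3 3 3 S 3 3 3 R" by (rule restrictsI[of _ _ _ _ _ _ _ _ X Y Z]) (simp add: R)
    moreover have "nonzero_on 3 3 3 R" using nz(1) by (intro nonzero_onI[of 1 _ 0 _ 1]) simp_all
    ultimately have "2 powr (3 / 2) \<le> asymptotic_subrank 3 3 3 S" using asymptotic_subrank_mono by fastforce
    moreover have "2 powr (\<tau> + binary_entropy \<tau>) \<le> 2 powr (3 / 2)"
      using tau_exponent_bounds(2)[OF tau_gt_third[OF \<tau>] \<tau>(2)] by (intro powr_mono) auto
    ultimately show ?thesis by linarith
  qed
qed

text \<open>Columns 1 and 2 meet the support only in row 1, so conciseness makes the forms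
  \<open>S i 1 1\<close> and \<open>S i 1 2\<close> independent. The dual of a basis that extends
  them achieves the normalization.\<close>

lemma arrow_lower_bound:
  fixes S :: "'a::field tensor3"
  assumes con: "concise 3 3 3 S" and arr: "arrow S"
    and \<tau>: "0 < \<tau>" "\<tau> < 1 / 2" "binary_entropy (2 * \<tau>) - binary_entropy \<tau> + \<tau> = 0"
  shows "2 powr (\<tau> + binary_entropy \<tau>) \<le> asymptotic_subrank 3 3 3 S"
proof -
  have z: "S a 0 1 = 0" "S a 0 2 = 0" "S a 2 1 = 0" "S a 2 2 = 0" if "a < 3" for a
    using arr that by (simp_all add: arrow_def)
  define F0 where "F0 b i = (if b = 0 then S i 1 1 else S i 1 2)" for b i :: nat
  have "indep_part 3 2 F0" unfolding indep_part_def
  proof (intro allI impI)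
    fix c b assume 0: "\<forall>i<3. (\<Sum>a<2. c a * F0 a i) = 0" and b: "b < (2::nat)"
    define y where "y l = (if l = 0 then 0 else c (l - 1))" for l :: nat
    have "(\<Sum>l<3. y l * S i j l) = 0" if "i < 3" "j < 3" for i j
      using less_3_cases[OF that(2)] z[OF that(1)] 0 that(1)
      by (elim disjE) (auto simp: sum_less_3 sum_less_2 y_def F0_def)
    then have "y l = 0" if "l < 3" for l
      using con concise1D[of 3 3 3 "\<lambda>i j k. S k j i" y l] that unfolding concise_def by blast
    from this[of "Suc b"] show "c b = 0" using b by (simp add: y_def)
  qed
  from indep_part_extend[OF this] obtain F where F: "indep_family 3 F" "\<And>b. b < 2 \<Longrightarrow> F b = F0 b" by auto
  obtain X where X: "indep_family 3 X" "\<And>a b. a < 3 \<Longrightarrow> b < 3 \<Longrightarrow> (\<Sum>i<3. X a i * F b i) = of_bool (a = b)"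
    using dual_basis[OF F(1)] by blast
  define R where "R a b c = (\<Sum>i<3. X a i * S i b c)" for a b c
  have equiv: "equivalent 3 3 3 S 3 3 3 R"
    by (rule restricts_basis_change[of _ _ _ _ _ X "\<lambda>b l. of_bool (l = b)" "\<lambda>c l. of_bool (l = c)"])
      (simp_all add: R_def tri_unit23 X indep_family_unit)
  have conR: "concise 3 3 3 R" using concise_transfer[OF con] equiv unfolding equivalent_def by blast
  have arrR: "arrow R" using z by (simp add: arrow_def R_def)
  have e: "R a 1 1 = of_bool (a = 0)" if "a < 3" for a
    using X(2)[OF that, of 0] F(2)[of 0] by (simp add: R_def F0_def)
  have k: "R a 1 2 = of_bool (a = 1)" if "a < 3" for a
    using X(2)[OF that, of 1] F(2)[of 1] by (simp add: R_def F0_def)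
  have nzR: "nonzero_on 3 3 3 R" using e[of 0] by (intro nonzero_onI[of 0 _ 1 _ 1]) simp_all
  have nzS: "nonzero_on 3 3 3 S" using restricts_nonzero_on[OF _ nzR] equiv unfolding equivalent_def by blast
  show ?thesis
    using arrow_normalized_lower_bound[OF conR arrR e k \<tau>] asymptotic_subrank_equivalent(1)[OF equiv nzS] by simp
qed

lemma concise_nonzero_on:
  assumes "concise n1 n2 n3 T" "n3 > 0"
  shows "nonzero_on n1 n2 n3 T"
proof -
  obtain i j where "i < n1" "j < n2" "T i j 0 \<noteq> 0" using concise3_entry[OF assms] by blast
  then show ?thesis using assms(2) by (intro nonzero_onI[of i _ j _ 0])
qed

lemma singular_lower_bound:
  fixes T :: "'a::alg_closed_field tensor3"
  assumes con: "concise 3 3 3 T" and sing: "singular T"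
    and \<tau>: "0 < \<tau>" "\<tau> < 1 / 2" "binary_entropy (2 * \<tau>) - binary_entropy \<tau> + \<tau> = 0"
  shows "2 powr (\<tau> + binary_entropy \<tau>) \<le> asymptotic_subrank 3 3 3 T"
proof -
  obtain S where S: "equivalent 3 3 3 T 3 3 3 S" "singular S" "\<And>b c. b < 3 \<Longrightarrow> c < 3 \<Longrightarrow> S 0 b c = of_bool (b = c \<and> b < 2)"
    using singular_normal_form[OF con sing] by blast
  have nzT: "nonzero_on 3 3 3 T" using concise_nonzero_on[OF con] by simp
  note eqS = asymptotic_subrank_equivalent[OF S(1) nzT]
  have conS: "concise 3 3 3 S" using concise_transfer[OF con] S(1) unfolding equivalent_def by blast
  show ?thesis
  proof (cases "S 2 0 2 * S 1 2 0 + S 2 1 2 * S 1 2 1 = 0")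
    case True
    obtain R where R: "equivalent 3 3 3 S 3 3 3 R" "arrow R" using arrow_case[OF conS S(2,3) True] by blast
    have conR: "concise 3 3 3 R" using concise_transfer[OF conS] R(1) unfolding equivalent_def by blast
    show ?thesis
      using arrow_lower_bound[OF conR R(2) \<tau>] asymptotic_subrank_equivalent(1)[OF R(1) eqS(2)] eqS(1) by simp
  next
    case False
    have "2 powr (\<tau> + binary_entropy \<tau>) \<le> 2 powr (binary_entropy (1 / 3) + 2 / 3)"
      using tau_exponent_bounds(2)[OF tau_gt_third[OF \<tau>] \<tau>(2)] entropy_third_bounds(1) by (intro powr_mono) auto
    also have "\<dots> \<le> asymptotic_subrank 3 3 3 S" by (rule determinant_case[OF S(2,3) False])
    finally show ?thesis using eqS(1) by simp
  qed
qed

lemma asymptotic_subrank_swap13: "asymptotic_subrank n3 n2 n1 (\<lambda>i j k. T k j i) = asymptotic_subrank n1 n2 n3 T"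
  using asymptotic_subrank_swap12[of n3 n2 n1 "\<lambda>i j k. T k i j"] asymptotic_subrank_swap23[of n2 n3 n1 "\<lambda>i j k. T j i k"]
    asymptotic_subrank_swap12[of n2 n1 n3 T] by simp

text \<open>Singularity is tested in the second and the third factor because its failure in both is
  precisely the existence of the vectors \<open>h\<close> and \<open>g\<close> for
  \<open>null_algebra_case\<close>.\<close>

lemma concise_three_lower_bound:
  fixes T :: "'a::alg_closed_field tensor3"
  assumes con: "concise 3 3 3 T"
    and \<tau>: "0 < \<tau>" "\<tau> < 1 / 2" "binary_entropy (2 * \<tau>) - binary_entropy \<tau> + \<tau> = 0"
  shows "2 powr (\<tau> + binary_entropy \<tau>) \<le> asymptotic_subrank 3 3 3 T"
proof -
  have con12: "concise 3 3 3 (\<lambda>i j k. T j i k)" using con concise_swap12[of 3 3 3 T] by simp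
  have con13: "concise 3 3 3 (\<lambda>i j k. T k j i)"
    using concise_swap12[of 3 3 3 "\<lambda>i j k. T k i j"] concise_swap23[of 3 3 3 "\<lambda>i j k. T j i k"] con12 by simp
  have tri13: "tri 3 3 3 (\<lambda>i j k. T k j i) z y x = tri 3 3 3 T x y z" for x y z
    using tri_swap12[of 3 3 3 "\<lambda>i j k. T k i j" z y x] tri_swap23[of 3 3 3 "\<lambda>i j k. T j i k" y z x] tri_swap12[of 3 3 3 T y x z] by simp
  have tri12: "tri 3 3 3 (\<lambda>i j k. T j i k) y x z = tri 3 3 3 T x y z" for x y z by (rule tri_swap12)
  consider "singular (\<lambda>i j k. T j i k)" | "singular (\<lambda>i j k. T k j i)"
    | "\<not> singular (\<lambda>i j k. T j i k)" "\<not> singular (\<lambda>i j k. T k j i)" by blast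
  then show ?thesis
  proof cases
    case 1
    from singular_lower_bound[OF con12 this \<tau>] show ?thesis unfolding asymptotic_subrank_swap12[of 3 3 3 T] .
  next
    case 2
    from singular_lower_bound[OF con13 this \<tau>] show ?thesis unfolding asymptotic_subrank_swap13[of 3 3 3 T] .
  next
    case 3
    obtain h where h: "\<And>x. (\<forall>z. tri 3 3 3 T x h z = 0) \<Longrightarrow> \<forall>i<3. x i = 0"
      using 3(1) unfolding singular_def tri12 by blast
    obtain g where g: "\<And>y. (\<forall>x. tri 3 3 3 T x y g = 0) \<Longrightarrow> \<forall>i<3. y i = 0"
      using 3(2) unfolding singular_def tri13 by blast
    show ?thesis by (rule null_algebra_case[OF _ _ \<tau>, of T h g]) (use h g in blast)+
  qed
qed

theorem theorem2p6:
  fixes n1 n2 n3 :: nat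
    and T :: "'a::alg_closed_field tensor3"
    and \<tau> c1 c2 :: real
  assumes c1: "c1 = 2 powr binary_entropy (1/3)"
    and tau: "\<tau> = (THE t. 0 < t \<and> t < 1/2 \<and> binary_entropy (2 * t) - binary_entropy t + t = 0)"
    and c2: "c2 = 2 powr (\<tau> + binary_entropy \<tau>)"
    and T: "T \<in> tensor_space n1 n2 n3"
    and nonzero: "T \<noteq> (\<lambda>_ _ _. 0)"
  defines "a \<equiv> asymptotic_subrank n1 n2 n3 T = 1"
    and "b \<equiv> asymptotic_subrank n1 n2 n3 T = c1"
    and "c \<equiv> asymptotic_subrank n1 n2 n3 T = 2"
    and "d \<equiv> asymptotic_subrank n1 n2 n3 T \<ge> c2"
  shows "(a \<or> b \<or> c \<or> d) \<and>
    \<not> (a \<and> b) \<and> \<not> (a \<and> c) \<and> \<not> (a \<and> d) \<and> \<not> (b \<and> c) \<and> \<not> (b \<and> d) \<and> \<not> (c \<and> d)"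
proof -
  have \<tau>: "0 < \<tau>" "\<tau> < 1 / 2" "binary_entropy (2 * \<tau>) - binary_entropy \<tau> + \<tau> = 0"
    using theI'[OF exists_unique_tau] unfolding tau by blast+
  \<comment> \<open>Mutual exclusion of the four alternatives amounts to
    \<open>1 < c1 < 2 < c2\<close>.\<close>
  have c1_bounds: "1 < c1" "c1 < 2"
  proof -
    have "2 powr 0 < (2::real) powr binary_entropy (1 / 3)" "(2::real) powr binary_entropy (1 / 3) < 2 powr 1"
      using entropy_third_bounds by (intro powr_less_mono; simp)+
    then show "1 < c1" "c1 < 2" unfolding c1 by simp_all
  qed
  have c2_bound: "2 < c2"
  proof -
    have "(2::real) powr 1 < 2 powr (\<tau> + binary_entropy \<tau>)"
      using tau_exponent_bounds(1)[OF tau_gt_third[OF \<tau>] \<tau>(2)] by (intro powr_less_mono) auto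
    then show ?thesis unfolding c2 by simp
  qed
  have "\<exists>i j k. T i j k \<noteq> 0"
  proof (rule ccontr)
    assume "\<not> ?thesis"
    then have "T = (\<lambda>_ _ _. 0)" by (intro ext) simp
    then show False using nonzero by simp
  qed
  then have nzT: "nonzero_on n1 n2 n3 T"
    using T unfolding tensor_space_def nonzero_on_def by blast
  obtain m1 m2 m3 S where S: "equivalent n1 n2 n3 T m1 m2 m3 S" "concise m1 m2 m3 S"
    using exists_equivalent_concise by blast
  note eqS = asymptotic_subrank_equivalent[OF S(1) nzT]
  define Q where "Q = asymptotic_subrank m1 m2 m3 S"
  have Q1: "1 \<le> Q" unfolding Q_def by (rule asymptotic_subrank_ge_1[OF eqS(2)])
  have nz12: "nonzero_on m2 m1 m3 (\<lambda>i j k. S j i k)" and nz13: "nonzero_on m3 m2 m1 (\<lambda>i j k. S k j i)"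
    using eqS(2) unfolding nonzero_on_def by blast+
  have con12: "concise m2 m1 m3 (\<lambda>i j k. S j i k)" using S(2) concise_swap12[of m2 m1 m3 S] by simp
  have con13: "concise m3 m2 m1 (\<lambda>i j k. S k j i)"
    using concise_swap12[of m3 m2 m1 "\<lambda>i j k. S k i j"] concise_swap23[of m2 m3 m1 "\<lambda>i j k. S j i k"] con12 by simp
  have le: "Q \<le> m1" "Q \<le> m2" "Q \<le> m3"
    using asymptotic_subrank_le_dim[OF eqS(2)] asymptotic_subrank_le_dim[OF nz12] asymptotic_subrank_le_dim[OF nz13]
    unfolding Q_def asymptotic_subrank_swap12[of m2 m1 m3 S] asymptotic_subrank_swap13[of m3 m2 m1 S] by simp_all
  have m: "m1 \<ge> 1" "m2 \<ge> 1" "m3 \<ge> 1" using eqS(2) unfolding nonzero_on_def by auto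
  have "Q = 1 \<or> Q = c1 \<or> Q = 2 \<or> Q \<ge> c2"
  proof -
    consider "m1 = 1 \<or> m2 = 1 \<or> m3 = 1" | "m1 = 2" "m2 \<ge> 2" "m3 \<ge> 2" | "m2 = 2" "m1 \<ge> 2" "m3 \<ge> 2"
      | "m3 = 2" "m1 \<ge> 2" "m2 \<ge> 2" | "m1 \<ge> 3" "m2 \<ge> 3" "m3 \<ge> 3" using m by linarith
    then show ?thesis
    proof cases
      case 1
      then have "Q \<le> 1" using le by auto
      then show ?thesis using Q1 by simp
    next
      case 2
      then show ?thesis using concise_two[of m2 m3 S] S(2) eqS(2) unfolding Q_def c1 by auto
    next
      case 3
      then show ?thesis using concise_two[of m1 m3 "\<lambda>i j k. S j i k"] con12 nz12
        unfolding Q_def c1 asymptotic_subrank_swap12[of m2 m1 m3 S, symmetric] by auto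
    next
      case 4
      then show ?thesis using concise_two[of m2 m1 "\<lambda>i j k. S k j i"] con13 nz13
        unfolding Q_def c1 asymptotic_subrank_swap13[of m3 m2 m1 S, symmetric] by auto
    next
      case 5
      obtain R where R: "restricts m1 m2 m3 S 3 3 3 R" "concise 3 3 3 R"
        using restricts_concise_cube[OF S(2), of 3] 5 by auto
      have "nonzero_on 3 3 3 R" using concise_nonzero_on[OF R(2)] by simp
      then have "asymptotic_subrank 3 3 3 R \<le> Q" unfolding Q_def by (rule asymptotic_subrank_mono[OF R(1)])
      then show ?thesis using concise_three_lower_bound[OF R(2) \<tau>] unfolding c2 by linarith
    qed
  qed
  then show ?thesis using c1_bounds c2_bound unfolding a_def b_def c_def d_def eqS(1) Q_def by auto
qed

end
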